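(* Let $\epsilon\in(0,1)$ and let $d\ge2$ be an integer. Fix an integer $k$ with $1\le k\le d-1$. Then, for all $i\in\mathbb{N}\setminus\{0\}$, $\alpha\in[0,k/2)$, and $x\in[-1,1]^{d-k}$, $$\sum_{\substack{(\ell,m)\in I_d^{(k)}\\ m\ge\epsilon\ell\\ \lambda^{d,k}_{\ell,m}\in[i^2,(i+1)^2]}}\alpha_m(\mathbb{S}^k)\;\mathscr{X}^{d,k}_{\ell,m}(x)\,\Big[\sqrt{\lambda^{d,k}_{\ell,m}}/\ell\Big]^{2\alpha}\lesssim_\epsilon i^{d-1}\,\min\{i,1/|x|\}^{k-2\alpha}.$$
   Context: For nonnegative quantities $X,Y$, $X\lesssim Y$ means $X\le CY$ for a positive constant $C$, and the subscript in $\lesssim_\epsilon$ indicates that the implicit constant may depend on the parameter $\epsilon$; here $d$ and $k$ are fixed. $\mathbb{N}=\{0,1,2,\dots\}$; $\mathbb{N}_r=\mathbb{N}+(r-1)/2$ for integers $r\ge1$. For $\ell\in\mathbb{N}_r$, $\lambda^r_\ell=\ell^2-((r-1)/2)^2$. For $m\in\mathbb{N}_k$, $\alpha_m(\mathbb{S}^k)$ (not to be confused with the exponent $\alpha$) is the dimension of the space of spherical harmonics on the unit sphere $\mathbb{S}^k\subset\mathbb{R}^{1+k}$ of degree $m-(k-1)/2$. Set $I_d^{(k)}=\{(\ell,m):\ell\in\mathbb{N}_d,\ m\in\mathbb{N}_k,\ \ell\ge m+(d-k)/2\}$ and $\lambda^{d,k}_{\ell,m}=\lambda^d_\ell-\lambda^k_m$.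 Let $J_d^{(k)}=\{(\ell_d,\ell_{d-1},\dots,\ell_k)\in\mathbb{N}_d\times\mathbb{N}_{d-1}\times\dots\times\mathbb{N}_k:\ell_d\ge\ell_{d-1}\ge\dots\ge\ell_k\}$. For $r\ge2$, $\ell\in\mathbb{N}_r$, $m\in\mathbb{N}_{r-1}$ with $\ell\ge m$, and $t\in[-1,1]$, let $$\widetilde X^r_{\ell,m}(t)=c_{\ell m}(1-t^2)^{m/2-(r-2)/4}P^{(m,m)}_{\ell-m-1/2}(t),\qquad c_{\ell m}=\frac{[\ell\,\Gamma(\ell-m+1/2)\,\Gamma(\ell+m+1/2)]^{1/2}}{2^m\,\Gamma(\ell+1/2)},$$ where $P^{(a,b)}_j(t)=\frac{(-1)^j}{2^jj!}(1-t)^{-a}(1+t)^{-b}\big(\frac{d}{dt}\big)^j\big((1-t)^{a+j}(1+t)^{b+j}\big)$ is the Jacobi polynomial of degree $j\in\mathbb{N}$ and indices $a,b>-1$ (note that $\ell-m-1/2\in\mathbb{N}$). For $(\ell,m)\in I_d^{(k)}$ and $x=(x_d,x_{d-1},\dots,x_{k+1})\in[-1,1]^{d-k}$, $$\mathscr{X}^{d,k}_{\ell,m}(x)=\sum_{\substack{(\ell_d,\dots,\ell_k)\in J_d^{(k)}\\ \ell_d=\ell,\ \ell_k=m}}|\widetilde X^d_{\ell_d,\ell_{d-1}}(x_d)|^2\cdots|\widetilde X^{k+1}_{\ell_{k+1},\ell_k}(x_{k+1})|^2.$$ $|x|$ is the Euclidean norm, and $\min\{i,1/|x|\}$ is read as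 $i$ when $x=0$.
   Formalization: The implicit constant may depend on α as well as on ε, d, k (uniform in i and x); a constant uniform over all α∈[0,k/2) is impossible: for d=2, k=1, x=0, α→1/2 the left side is at least of order i log i, the right side of order i. *)

theory Defs
  imports
    "HOL-Analysis.Analysis"
    "HOL-Computational_Algebra.Polynomial"
    "HOL-Library.Function_Algebras"
begin

definition NN :: "nat \<Rightarrow> real set" where
  "NN r = {real n + (real r - 1) / 2 | n :: nat. True}"

definition eigval :: "nat \<Rightarrow> real \<Rightarrow> real" where
  "eigval r l = l^2 - ((real r - 1) / 2)^2"

definition eigval2 :: "nat \<Rightarrow> nat \<Rightarrow> real \<Rightarrow> real \<Rightarrow> real" where
  "eigval2 d k l m = eigval d l - eigval k m"

definition I_set :: "nat \<Rightarrow> nat \<Rightarrow> (real \<times> real) set" where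
  "I_set d k = {(l, m). l \<in> NN d \<and> m \<in> NN k \<and> l \<ge> m + (real d - real k) / 2}"

text \<open>A tuple \<open>(l\<^sub>d, \<dots>, l\<^sub>k)\<close> is an extensional function \<open>L\<close> on \<open>{k..d}\<close> with \<open>L j = l\<^sub>j\<close>.\<close>

definition J_set :: "nat \<Rightarrow> nat \<Rightarrow> (nat \<Rightarrow> real) set" where
  "J_set d k = {L \<in> (\<Pi>\<^sub>E j\<in>{k..d}. NN j). \<forall>j\<in>{k..<d}. L j \<le> L (Suc j)}"


subsection \<open>Spherical harmonics\<close>

definition fscale :: "real \<Rightarrow> ('a \<Rightarrow> real) \<Rightarrow> 'a \<Rightarrow> real" where
  "fscale c f = (\<lambda>x. c * f x)"

interpretation fun_space: vector_space "fscale :: real \<Rightarrow> ('a \<Rightarrow> real) \<Rightarrow> 'a \<Rightarrow> real"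
  by unfold_locales (auto simp: fscale_def fun_eq_iff algebra_simps)

text \<open>Since the dimension \<open>k\<close> varies, a point of \<open>\<real>\<^bsup>1+k\<^esup>\<close> is a function \<open>nat \<Rightarrow> real\<close>, of
  which only the coordinates \<open>0, \<dots>, k\<close> matter.\<close>

definition unit_sphere :: "nat \<Rightarrow> (nat \<Rightarrow> real) set" where
  "unit_sphere k = {x. (\<forall>i>k. x i = 0) \<and> (\<Sum>i\<le>k. (x i)^2) = 1}"

definition homogeneous_polys :: "nat \<Rightarrow> nat \<Rightarrow> ((nat \<Rightarrow> real) \<Rightarrow> real) set" where
  "homogeneous_polys k n =
     fun_space.span {(\<lambda>x. \<Prod>i\<le>k. x i ^ e i) | e :: nat \<Rightarrow> nat. (\<Sum>i\<le>k. e i) = n}"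

definition laplacian :: "nat \<Rightarrow> ((nat \<Rightarrow> real) \<Rightarrow> real) \<Rightarrow> (nat \<Rightarrow> real) \<Rightarrow> real" where
  "laplacian k f x = (\<Sum>i\<le>k. (deriv ^^ 2) (\<lambda>s. f (x(i := s))) (x i))"

text \<open>Restrictions to the sphere are represented as functions vanishing off the sphere.\<close>

definition spherical_harmonics :: "nat \<Rightarrow> nat \<Rightarrow> ((nat \<Rightarrow> real) \<Rightarrow> real) set" where
  "spherical_harmonics k n =
     {(\<lambda>x. if x \<in> unit_sphere k then p x else 0) | p.
        p \<in> homogeneous_polys k n \<and> (\<forall>x. laplacian k p x = 0)}"

definition sph_dim :: "nat \<Rightarrow> real \<Rightarrow> nat" where
  "sph_dim k m = fun_space.dim (spherical_harmonics k (nat \<lfloor>m - (real k - 1) / 2\<rfloor>))"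


subsection \<open>Jacobi polynomials and the functions X\<close>

definition rodrigues :: "nat \<Rightarrow> real \<Rightarrow> real \<Rightarrow> real \<Rightarrow> real" where
  "rodrigues j a b t = (-1)^j / (2^j * fact j) * (1 - t) powr (-a) * (1 + t) powr (-b) *
     (deriv ^^ j) (\<lambda>s. (1 - s) powr (a + real j) * (1 + s) powr (b + real j)) t"

text \<open>The Rodrigues formula makes sense on the open interval only; the polynomial it defines
  there also provides the values at the endpoints.\<close>

definition jacobi_poly :: "nat \<Rightarrow> real \<Rightarrow> real \<Rightarrow> real poly" where
  "jacobi_poly j a b = (THE p. \<forall>t\<in>{-1<..<1}. poly p t = rodrigues j a b t)"

lemma higher_deriv_weight:
  fixes A B :: real
  shows "\<exists>q. \<forall>t\<in>{-1<..<1}. (deriv ^^ n) (\<lambda>s. (1 - s) powr A * (1 + s) powr B) t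
           = (1 - t) powr (A - real n) * (1 + t) powr (B - real n) * poly q t"
proof (induction n)
  case 0
  show ?case by (rule exI[of _ 1]) simp
next
  case (Suc n)
  let ?F = "(deriv ^^ n) (\<lambda>s. (1 - s) powr A * (1 + s) powr B)"
  obtain q where q: "\<And>t. t \<in> {-1<..<1} \<Longrightarrow>
      ?F t = (1 - t) powr (A - real n) * (1 + t) powr (B - real n) * poly q t"
    using Suc.IH by blast
  define a where "a = A - real n"
  define b where "b = B - real n"
  let ?r = "smult (-a) ([:1, 1:] * q) + smult b ([:1, -1:] * q) + [:1, 0, -1:] * pderiv q"
  show ?case
  proof (intro exI[of _ ?r] ballI)
    fix t :: real assume t: "t \<in> {-1<..<1}"
    have D: "((\<lambda>t. (1 - t) powr a * (1 + t) powr b * poly q t) has_real_derivative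
        ((1 - t) powr (a - 1) * (1 + t) powr (b - 1) * poly ?r t)) (at t)"
    proof -
      have e: "(1 - t) powr a = (1 - t) powr (a - 1) * (1 - t)"
        "(1 + t) powr b = (1 + t) powr (b - 1) * (1 + t)"
        using t by (auto simp: powr_diff)
      show ?thesis using t
        by (auto intro!: derivative_eq_intros simp: e algebra_simps)
    qed
    have "(?F has_real_derivative
        ((1 - t) powr (a - 1) * (1 + t) powr (b - 1) * poly ?r t)) (at t)"
      by (rule has_field_derivative_transform_within_open[OF D, of "{-1<..<1}"])
        (use t q in \<open>auto simp: a_def b_def\<close>)
    then have "deriv ?F t = (1 - t) powr (a - 1) * (1 + t) powr (b - 1) * poly ?r t"
      by (rule DERIV_imp_deriv)
    then show "(deriv ^^ Suc n) (\<lambda>s. (1 - s) powr A * (1 + s) powr B) t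
        = (1 - t) powr (A - real (Suc n)) * (1 + t) powr (B - real (Suc n)) * poly ?r t"
      by (simp add: a_def b_def algebra_simps)
  qed
qed

lemma poly_jacobi_poly:
  assumes "t \<in> {-1<..<1}"
  shows "poly (jacobi_poly j a b) t = rodrigues j a b t"
proof -
  obtain q where q: "\<And>t. t \<in> {-1<..<1} \<Longrightarrow>
      (deriv ^^ j) (\<lambda>s. (1 - s) powr (a + real j) * (1 + s) powr (b + real j)) t
      = (1 - t) powr a * (1 + t) powr b * poly q t"
    using higher_deriv_weight[of j "a + real j" "b + real j"] by auto
  let ?p = "smult ((-1)^j / (2^j * fact j)) q"
  have p: "\<forall>t\<in>{-1<..<1}. poly ?p t = rodrigues j a b t"
  proof
    fix t :: real assume t: "t \<in> {-1<..<1}"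
    then have "(1 - t) powr a \<noteq> 0" "(1 + t) powr b \<noteq> 0" by auto
    then show "poly ?p t = rodrigues j a b t"
      unfolding rodrigues_def q[OF t] by (simp add: powr_minus divide_simps)
  qed
  have "p' = ?p" if "\<forall>t\<in>{-1<..<1}. poly p' t = rodrigues j a b t" for p'
  proof (rule ccontr)
    assume "p' \<noteq> ?p"
    then have "finite {t. poly (p' - ?p) t = 0}"
      by (intro poly_roots_finite) auto
    moreover have "{-1<..<1::real} \<subseteq> {t. poly (p' - ?p) t = 0}"
      using p that by auto
    ultimately have "finite {-1<..<1::real}" by (rule rev_finite_subset)
    then show False by (simp add: infinite_Ioo)
  qed
  with p have "jacobi_poly j a b = ?p"
    unfolding jacobi_poly_def by (intro the_equality) auto
  with p assms show ?thesis by simp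
qed

text \<open>Real powers of nonnegative bases with the usual convention \<open>0\<^sup>0 = 1\<close> (whereas
  \<open>0 powr 0 = 0\<close>); it is needed at the endpoints \<open>t = \<plusminus>1\<close>, where the exponent may vanish.\<close>

definition rpow :: "real \<Rightarrow> real \<Rightarrow> real" where
  "rpow x a = (if a = 0 then 1 else x powr a)"

definition c_coeff :: "real \<Rightarrow> real \<Rightarrow> real" where
  "c_coeff l m = sqrt (l * Gamma (l - m + 1/2) * Gamma (l + m + 1/2)) /
     (2 powr m * Gamma (l + 1/2))"

definition X_tilde :: "nat \<Rightarrow> real \<Rightarrow> real \<Rightarrow> real \<Rightarrow> real" where
  "X_tilde r l m t = c_coeff l m * rpow (1 - t^2) (m / 2 - (real r - 2) / 4) *
     poly (jacobi_poly (nat \<lfloor>l - m - 1/2\<rfloor>) m m) t"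

text \<open>A point \<open>x = (x\<^sub>d, \<dots>, x\<^bsub>k+1\<^esub>)\<close> is a function of which only the values on \<open>{k+1..d}\<close> matter.\<close>

definition X_scr :: "nat \<Rightarrow> nat \<Rightarrow> real \<Rightarrow> real \<Rightarrow> (nat \<Rightarrow> real) \<Rightarrow> real" where
  "X_scr d k l m x = (\<Sum>L | L \<in> J_set d k \<and> L d = l \<and> L k = m.
     \<Prod>j\<in>{k+1..d}. \<bar>X_tilde j (L j) (L (j - 1)) (x j)\<bar>^2)"

definition min_inv :: "nat \<Rightarrow> real \<Rightarrow> real" where
  "min_inv i s = (if s = 0 then real i else min (real i) (1 / s))"

definition cluster_set :: "real \<Rightarrow> nat \<Rightarrow> nat \<Rightarrow> nat \<Rightarrow> (real \<times> real) set" where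
  "cluster_set \<epsilon> d k i = {(l, m) \<in> I_set d k. m \<ge> \<epsilon> * l \<and>
     eigval2 d k l m \<in> {(real i)^2..(real i + 1)^2}}"


subsection \<open>The index sets of the finite sums are finite\<close>

lemma finite_NN_le: "finite (NN r \<inter> {..B})"
proof (rule finite_subset)
  show "NN r \<inter> {..B} \<subseteq> (\<lambda>n. real n + (real r - 1) / 2) ` {..nat \<lceil>B + 1\<rceil>}"
  proof
    fix y assume "y \<in> NN r \<inter> {..B}"
    then obtain n where n: "y = real n + (real r - 1) / 2" "y \<le> B"
      by (auto simp: NN_def)
    have "real n \<le> B + 1" using n by (simp add: field_simps)
    then have "n \<le> nat \<lceil>B + 1\<rceil>" by linarith
    with n show "y \<in> (\<lambda>n. real n + (real r - 1) / 2) ` {..nat \<lceil>B + 1\<rceil>}" by auto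
  qed
qed simp

lemma finite_J_slice:
  "finite {L. L \<in> J_set d k \<and> L d = l \<and> L k = m}"
proof (rule finite_subset)
  show "{L. L \<in> J_set d k \<and> L d = l \<and> L k = m} \<subseteq> (\<Pi>\<^sub>E j\<in>{k..d}. NN j \<inter> {..l})"
  proof
    fix L assume L: "L \<in> {L. L \<in> J_set d k \<and> L d = l \<and> L k = m}"
    have "L j \<le> L d" if "k \<le> j" "j \<le> d" for j
      using that(2,1)
    proof (induction rule: inc_induct)
      case (step n)
      then have "L n \<le> L (Suc n)" using L by (auto simp: J_set_def)
      with step show ?case by auto
    qed simp
    with L show "L \<in> (\<Pi>\<^sub>E j\<in>{k..d}. NN j \<inter> {..l})"
      by (auto simp: J_set_def PiE_iff)
  qed
qed (auto intro: finite_PiE finite_NN_le)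

lemma finite_cluster_set:
  assumes "1 \<le> k" "k < d"
  shows "finite (cluster_set \<epsilon> d k i)"
proof -
  define D where "D = ((real d - 1) / 2)^2"
  define K where "K = ((real k - 1) / 2)^2"
  define B where "B = 2 * ((real i + 1)^2 + D)"
  have K: "K \<ge> 0" by (simp add: K_def)
  have "(l, m) \<in> (NN d \<inter> {..B}) \<times> (NN k \<inter> {..B})" if "(l, m) \<in> cluster_set \<epsilon> d k i" for l m
  proof -
    have lm: "l \<in> NN d" "m \<in> NN k" "l \<ge> m + (real d - real k) / 2"
      and le: "l^2 - D - (m^2 - K) \<le> (real i + 1)^2"
      using that by (auto simp: D_def K_def cluster_set_def I_set_def eigval2_def eigval_def)
    have m0: "m \<ge> 0" using lm(2) assms by (auto simp: NN_def)
    have dk: "real d - real k \<ge> 1" using assms by linarith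
    have lm': "l - m \<ge> 1/2" using lm(3) dk by (simp add: field_simps)
    have "(l - m) * (l + m) \<ge> 1/2 * (l + m)"
      using lm' m0 by (intro mult_right_mono) auto
    moreover have "(l - m) * (l + m) = l^2 - m^2" by (simp add: algebra_simps power2_eq_square)
    ultimately have "1/2 * (l + m) \<le> l^2 - m^2" by simp
    then have "l + m \<le> B"
      using le K unfolding B_def by (simp add: field_simps)
    then show ?thesis using lm m0 lm' by auto
  qed
  then have "cluster_set \<epsilon> d k i \<subseteq> (NN d \<inter> {..B}) \<times> (NN k \<inter> {..B})" by auto
  then show ?thesis by (rule finite_subset) (intro finite_cartesian_product finite_NN_le)
qed

subsection \<open>Dependence of the implicit constant on the exponent\<close>

text \<open>The exponent \<open>\<alpha>\<close> is treated as a fixed parameter, like \<open>d\<close>, \<open>k\<close> and \<open>\<epsilon>\<close>: no constant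
  works for all \<open>\<alpha> \<in> [0, k/2)\<close> at once. Both sides being continuous in \<open>\<alpha>\<close>, such a constant
  would also serve for \<open>\<alpha> = k/2\<close>, but there, for \<open>d = 2\<close>, \<open>k = 1\<close>, \<open>x = 0\<close>, the left-hand side
  is at least a multiple of \<open>i log i\<close> while the right-hand side is \<open>C i\<close>.\<close>

end

theory Submission
  imports Defs
begin

text \<open>Put \<open>x = sin \<theta>\<close>. The function \<open>v(\<theta>) = (cos \<theta>)\<^bsup>(r-1)/2\<^esup> X(sin \<theta>)\<close> solves
  \<open>v'' + (l\<^sup>2 - (m\<^sup>2 - 1/4) sec\<^sup>2 \<theta>) v = 0\<close>. A Sonin functional, shifted at the Airy scale of the turning
  point, is monotone and gives \<open>v\<^sup>2 \<lesssim> l (l + |l\<^sup>2 cos\<^sup>2 \<theta> - m\<^sup>2|)\<^bsup>-1/2\<^esup>\<close> uniformly when \<open>m \<ge> \<epsilon> l\<close>, with fast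
  decay far beyond the turning point; the normalization is read off from the explicit values at
  \<open>\<theta> = 0\<close>. Bounds of this kind are stable under summation over an intermediate index, which controls
  \<open>\<X>\<close> by induction on \<open>d\<close>. In the cluster, a given value \<open>\<nu>\<close> of \<open>l - m\<close> is attained by
  \<open>O(1 + i/\<nu>)\<close> pairs, so the estimate reduces to one sum over \<open>\<nu>\<close>; it is singular only where \<open>\<nu>\<close> is
  comparable to \<open>i |x|\<close>, and there like \<open>\<Sum> j\<^bsup>-1/2\<^esup>\<close>. Finally
  \<open>\<alpha>\<^sub>m(\<S>\<^sup>k) \<lesssim> m\<^bsup>k-1\<^esup>\<close> because a harmonic polynomial is determined by its Cauchy data on a hyperplane.\<close>

subsection \<open>A Sonin functional for a potential well\<close>

text \<open>With the plain WKB weight the error terms carry powers of \<open>1/q\<close> and blow up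
  at the turning point. The shift caps them, and as \<open>q1\<close> has a fixed sign, the term
  \<open>A * q1\<close> dominates them all the way to the turning point, with no asymptotic
  matching. The condition m >= \<epsilon> l enters as \<open>l^2 \<le> B * M\<close>: it keeps the
  turning point away from the pole, so that constants depend on \<open>B\<close> alone. Wells too
  shallow for their Airy scale are settled by the energy, and the finitely many small m by
  compactness. Decay beyond the turning point is kept only as a fixed power \<open>K\<close>, since
  such powers survive the summation over intermediate indices; \<open>2 * K\<close> has only to
  reach \<open>1 + s\<close>, where s = k - 2 \<alpha>. The condition \<alpha> < k/2 makes the sum
  over \<nu> of (\<nu> + Y)^(-1-s), with Y comparable to i |x|, converge, with a constant of order
  1/s.\<close>

text \<open>For \<open>v'' = - q v\<close> and any \<open>X\<close>, the derivative of \<open>(q X + X''/2) v\<^sup>2 - X' v v' + X v'\<^sup>2\<close> is a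
  multiple of \<open>v\<^sup>2\<close>; here \<open>X = (q + A)\<^bsup>-1/2\<^esup>\<close>, where \<open>A = 0\<close> would be the WKB weight.\<close>

lemma shifted_sonin_deriv:
  fixes v p q q1 q2 q3 X :: "real \<Rightarrow> real" and A :: real
  defines "X \<equiv> \<lambda>t. 1 / sqrt (q t + A)"
  assumes v: "(v has_real_derivative p t) (at t)"
    and p: "(p has_real_derivative - q t * v t) (at t)"
    and q: "(q has_real_derivative q1 t) (at t)"
    and q1: "(q1 has_real_derivative q2 t) (at t)"
    and q2: "(q2 has_real_derivative q3 t) (at t)"
    and pos: "q t + A > 0"
  shows "((\<lambda>t. (q t * X t - q2 t * X t ^ 3 / 4 + 3 / 8 * (q1 t)^2 * X t ^ 5) * (v t)^2
              + q1 t * X t ^ 3 * v t * p t / 2 + X t * (p t)^2)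
    has_real_derivative
      X t ^ 3 * (v t)^2 * (A * q1 t - q3 t / 4 + 9 / 8 * q1 t * q2 t * (X t)^2
        - 15 / 16 * q1 t ^ 3 * X t ^ 4)) (at t)"
proof -
  have s: "sqrt (q t + A) > 0" using pos by simp
  have dX: "(X has_real_derivative - q1 t * X t ^ 3 / 2) (at t)"
    unfolding X_def using pos s
    by (auto intro!: derivative_eq_intros q simp: field_simps power3_eq_cube power2_eq_square)
  \<comment> \<open>Trades \<open>q\<close> for \<open>A\<close>: the terms
    \<open>q1 * X * v^2\<close> and \<open>- q * q1 * X^3 * v^2\<close> of the derivative combine
    into \<open>A * q1 * X^3 * v^2\<close>.\<close>
  have e: "q t * (X t)^2 = 1 - A * (X t)^2"
    using pos by (simp add: X_def power_divide field_simps)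
  have k: "q t * q1 t * X t ^ 3 * (v t)^2 = q1 t * X t * (v t)^2 - A * q1 t * X t ^ 3 * (v t)^2"
  proof -
    have "q t * q1 t * X t ^ 3 * (v t)^2 = q1 t * X t * (v t)^2 * (q t * (X t)^2)"
      by (simp add: power2_eq_square power3_eq_cube)
    then show ?thesis unfolding e by (simp add: algebra_simps power2_eq_square power3_eq_cube)
  qed
  show ?thesis
    apply (rule DERIV_cong)
     apply (rule dX v p q q1 q2 DERIV_const DERIV_cdivide DERIV_add DERIV_diff DERIV_mult DERIV_power)+
    using k
    apply (simp add: field_simps power2_eq_square power3_eq_cube eval_nat_numeral)
    done
qed


text \<open>\<open>M\<close> stands for m^2 - 1/4, and \<open>t\<close> runs from the equator to the
  pole. The two limits select the solution that is regular at the pole; the first one is stated for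
  \<open>v / cos\<close> because the energy contains \<open>M * (v / cos)^2\<close>.\<close>

locale potential_well =
  fixes v p :: "real \<Rightarrow> real" and l M B :: real
  assumes M_pos: "0 < M" and l_ge: "1 \<le> l" and l_M: "l^2 \<le> B * M" and depth_ge: "l / 2 \<le> l^2 - M"
    and dv: "\<And>t. 0 \<le> t \<Longrightarrow> t < pi / 2 \<Longrightarrow> (v has_real_derivative p t) (at t)"
    and dp: "\<And>t. 0 \<le> t \<Longrightarrow> t < pi / 2 \<Longrightarrow>
      (p has_real_derivative - (l^2 - M * (1 + (tan t)^2)) * v t) (at t)"
    and lim_v: "((\<lambda>t. v t / cos t) \<longlongrightarrow> 0) (at_left (pi / 2))"
    and lim_p: "(p \<longlongrightarrow> 0) (at_left (pi / 2))"
begin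

definition "q t = l^2 - M * (1 + (tan t)^2)"
definition "q1 t = - 2 * M * tan t * (1 + (tan t)^2)"
definition "q2 t = - 2 * M * (1 + (tan t)^2) * (1 + 3 * (tan t)^2)"
definition "q3 t = q1 t * (8 + 12 * (tan t)^2)"
definition "q0 = l^2 - M"
text \<open>With \<open>q' \<approx> (l\<^sup>2 q\<^sub>0)\<^bsup>1/2\<^esup>\<close> at the turning point, its Airy region is \<open>|q| \<lesssim> (l\<^sup>2 q\<^sub>0)\<^bsup>1/3\<^esup>\<close>.\<close>

definition "A = 16 * B * root 3 (l^2 * q0)"
definition "energy t = q t * (v t)^2 + (p t)^2"
text \<open>If v is close to b q^(-1/4) cos(phase), this is about b^2: the squared WKB amplitude, in
  which all bounds of the locale are expressed.\<close>

definition "S = energy 0 / sqrt q0"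
text \<open>Large enough for the constant 27 * 65538 \<open>B ^ 5\<close> of shallow wells and for
  120000 \<open>B ^ 4\<close> of deep ones.\<close>

definition "C1 = 2 * 10^6 * B^5"
definition "X t = 1 / sqrt (q t + A)"
definition "sonin t = (q t * X t - q2 t * X t ^ 3 / 4 + 3 / 8 * (q1 t)^2 * X t ^ 5) * (v t)^2
              + q1 t * X t ^ 3 * v t * p t / 2 + X t * (p t)^2"

lemma q0_pos: "0 < q0" and q0_ge: "l / 2 \<le> q0"
  using depth_ge l_ge by (auto simp: q0_def)

lemma B_ge: "1 \<le> B"
proof (rule ccontr)
  assume "\<not> 1 \<le> B"
  then have "B * M < 1 * M" using M_pos by (intro mult_strict_right_mono) auto
  then show False using l_M q0_pos by (simp add: q0_def)
qed

lemma A_cube: "A ^ 3 = 4096 * B ^ 3 * (l^2 * q0)"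
  using q0_pos by (simp add: A_def power_mult_distrib)

text \<open>The depth condition \<open>l / 2 \<le> q0\<close> keeps the Airy scale at least of order
  \<open>l\<close>. This is the source of the summand \<open>l\<close> in the denominators of the
  final pointwise bounds.\<close>

lemma A_ge: "12 * B * l \<le> A"
proof -
  have "0 \<le> A" unfolding A_def using B_ge q0_pos by auto
  moreover have "(12 * B * l) ^ 3 \<le> A ^ 3"
  proof -
    have "1728 * l \<le> 4096 * q0" using q0_ge l_ge by simp
    then have "B ^ 3 * l^2 * (1728 * l) \<le> B ^ 3 * l^2 * (4096 * q0)"
      using B_ge by (intro mult_left_mono) auto
    then show ?thesis unfolding A_cube by (simp add: power_mult_distrib power2_eq_square power3_eq_cube mult_ac)
  qed
  moreover have "0 \<le> 12 * B * l" using B_ge l_ge by simp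
  ultimately show ?thesis using power_mono_iff[of "12 * B * l" A 3] by simp
qed

lemma A_pos: "0 < A" and A_ge_B: "12 * B \<le> A"
proof -
  have "12 * B * 1 \<le> 12 * B * l"
    using B_ge l_ge by (intro mult_left_mono) auto
  then show "0 < A" "12 * B \<le> A" using A_ge B_ge by linarith+
qed

lemma S_nonneg: "0 \<le> S"
  using q0_pos by (simp add: S_def energy_def q_def q0_def)

lemma energy_0: "energy 0 = S * sqrt q0"
  using q0_pos by (simp add: S_def)

lemma C1_ge: "2 * 10^6 \<le> C1"
  using B_ge by (simp add: C1_def)

lemma cos_pos: "0 \<le> t \<Longrightarrow> t < pi / 2 \<Longrightarrow> 0 < cos t"
  by (intro cos_gt_zero_pi) auto

lemma tan_ge0: "0 \<le> t \<Longrightarrow> t < pi / 2 \<Longrightarrow> 0 \<le> tan t"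
  using tan_pos_pi2_le by auto

lemma tan_mono: "0 \<le> s \<Longrightarrow> s \<le> t \<Longrightarrow> t < pi / 2 \<Longrightarrow> (tan s)^2 \<le> (tan t)^2"
  using tan_mono_le[of s t] tan_ge0[of s] by (intro power_mono) auto

lemma q_antimono: "0 \<le> s \<Longrightarrow> s \<le> t \<Longrightarrow> t < pi / 2 \<Longrightarrow> q t \<le> q s"
  using tan_mono M_pos by (auto simp: q_def)

lemma dtan: "0 \<le> t \<Longrightarrow> t < pi / 2 \<Longrightarrow> (tan has_real_derivative (1 + (tan t)^2)) (at t)"
  using cos_pos[of t] DERIV_tan[of t] by (simp add: tan_sec power_inverse)

lemma dq:
  assumes "0 \<le> t" "t < pi / 2"
  shows "(q has_real_derivative q1 t) (at t)" "(q1 has_real_derivative q2 t) (at t)"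
    "(q2 has_real_derivative q3 t) (at t)"
proof -
  note d = derivative_eq_intros dtan[OF assms] refl
  show "(q has_real_derivative q1 t) (at t)" unfolding q_def q1_def
    by (rule d)+ (simp add: algebra_simps)
  show "(q1 has_real_derivative q2 t) (at t)" unfolding q1_def q2_def
    by (rule d)+ (simp add: algebra_simps power2_eq_square)
  show "(q2 has_real_derivative q3 t) (at t)" unfolding q2_def q3_def q1_def
    by (rule d)+ (simp add: algebra_simps power2_eq_square)
qed

lemma allowed:
  assumes "0 \<le> q t"
  shows "M * (tan t)^2 \<le> q0" "M * (1 + (tan t)^2) \<le> l^2" "1 + (tan t)^2 \<le> B"
proof -
  show 1: "M * (tan t)^2 \<le> q0" "M * (1 + (tan t)^2) \<le> l^2"
    using assms by (auto simp: q_def q0_def algebra_simps)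
  have "M * (1 + (tan t)^2) \<le> M * B" using 1(2) l_M by (simp add: mult_ac)
  then show "1 + (tan t)^2 \<le> B" using M_pos by simp
qed

lemma q1_sq: "(q1 t)^2 = 4 * (M * (tan t)^2) * (M * (1 + (tan t)^2)) * (1 + (tan t)^2)"
  by (simp add: q1_def power2_eq_square algebra_simps)

lemma q1_nonpos: "0 \<le> t \<Longrightarrow> t < pi / 2 \<Longrightarrow> q1 t \<le> 0"
  using M_pos tan_ge0[of t] by (simp add: q1_def)

text \<open>The factor \<open>16 * B\<close> in \<open>A\<close> is chosen for these inequalities.
  Since \<open>X^2 \<le> 1 / A\<close>, each error term of the Sonin derivative, divided by
  \<open>q1\<close>, becomes a fixed fraction of \<open>A\<close>.\<close>

lemma allowed_derivs:
  assumes "0 \<le> q t"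
  shows "(q1 t)^2 \<le> A ^ 3 / 4" "- q2 t \<le> A^2 / 4" "8 + 12 * (tan t)^2 \<le> A"
proof -
  note a = allowed[OF assms]
  have "(q1 t)^2 \<le> 4 * q0 * l^2 * B"
    unfolding q1_sq using a M_pos q0_pos B_ge by (intro mult_mono) auto
  also have "\<dots> \<le> 1024 * B ^ 3 * (l^2 * q0)"
  proof -
    have "B \<le> B ^ 3" using B_ge by (simp add: self_le_power)
    then have "4 * B \<le> 1024 * B ^ 3" using B_ge by linarith
    then have "4 * B * (l^2 * q0) \<le> 1024 * B ^ 3 * (l^2 * q0)"
      using q0_pos by (intro mult_right_mono) auto
    then show ?thesis by (simp add: mult_ac)
  qed
  also have "\<dots> = A ^ 3 / 4" by (simp add: A_cube)
  finally show "(q1 t)^2 \<le> A ^ 3 / 4" .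
  have "- q2 t = 2 * (M * (1 + (tan t)^2)) * (1 + 3 * (tan t)^2)" by (simp add: q2_def)
  also have "\<dots> \<le> 2 * l^2 * (3 * B)"
    using a M_pos by (intro mult_mono) auto
  also have "\<dots> \<le> (12 * B * l)^2 / 4"
  proof -
    have "6 * B \<le> 36 * B^2" using B_ge by (simp add: power2_eq_square)
    then have "6 * B * l^2 \<le> 36 * B^2 * l^2" by (intro mult_right_mono) auto
    then show ?thesis by (simp add: power_mult_distrib)
  qed
  also have "\<dots> \<le> A^2 / 4" using A_ge B_ge l_ge by (auto intro!: power_mono)
  finally show "- q2 t \<le> A^2 / 4" .
  show "8 + 12 * (tan t)^2 \<le> A" using a(3) A_ge_B by simp
qed

lemma sonin_deriv_nonpos:
  assumes "0 \<le> t" "t < pi / 2" "0 \<le> q t"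
  shows "\<exists>y. (sonin has_real_derivative y) (at t) \<and> y \<le> 0"
proof -
  note ad = allowed_derivs[OF assms(3)]
  have pos: "q t + A > 0" using assms(3) A_pos by simp
  have X2: "(X t)^2 \<le> 1 / A" using pos assms(3) A_pos by (simp add: X_def power_divide frac_le)
  have X0: "0 < X t" using pos by (simp add: X_def)
  let ?y = "A * q1 t - q3 t / 4 + 9 / 8 * q1 t * q2 t * (X t)^2 - 15 / 16 * q1 t ^ 3 * X t ^ 4"
  have q2: "q2 t \<le> 0" using M_pos by (simp add: q2_def)
  have q3: "q3 t / 4 = q1 t * (2 + 3 * (tan t)^2)" by (simp add: q3_def)
  have "?y = (- q1 t) * (- A + (2 + 3 * (tan t)^2) + 9 / 8 * (- q2 t) * (X t)^2 + 15 / 16 * (q1 t)^2 * ((X t)^2 * (X t)^2))"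
    by (simp add: q3 algebra_simps power2_eq_square power3_eq_cube eval_nat_numeral)
  also have "\<dots> \<le> 0"
  proof (rule mult_nonneg_nonpos)
    have a: "9 / 8 * (- q2 t) * (X t)^2 \<le> 9 / 8 * (A^2 / 4) * (1 / A)"
      using ad q2 X2 A_pos by (intro mult_mono) auto
    have b: "15 / 16 * (q1 t)^2 * ((X t)^2 * (X t)^2) \<le> 15 / 16 * (A ^ 3 / 4) * (1 / A * (1 / A))"
      using ad X2 A_pos by (intro mult_mono) auto
    \<comment> \<open>The three error terms take 1/4, 9/32 and 15/64 of \<open>A\<close>, together
      49/64 of it.\<close>
    have "9 / 8 * (A^2 / 4) * (1 / A) = 9 / 32 * A" "15 / 16 * (A ^ 3 / 4) * (1 / A * (1 / A)) = 15 / 64 * A"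
      using A_pos by (auto simp: field_simps power2_eq_square power3_eq_cube)
    then show "- A + (2 + 3 * (tan t)^2) + 9 / 8 * (- q2 t) * (X t)^2 + 15 / 16 * (q1 t)^2 * ((X t)^2 * (X t)^2) \<le> 0"
      using a b ad(3) A_pos by linarith
  qed (use q1_nonpos assms in auto)
  finally have y: "?y \<le> 0" .
  have dp': "(p has_real_derivative - q t * v t) (at t)" using dp[OF assms(1,2)] by (simp add: q_def)
  have "(sonin has_real_derivative X t ^ 3 * (v t)^2 * ?y) (at t)"
    unfolding sonin_def X_def
    by (rule shifted_sonin_deriv[where v = v and p = p and q = q and ?q1.0 = q1 and ?q2.0 = q2 and ?q3.0 = q3 and t = t and A = A, OF dv[OF assms(1,2)] dp' dq[OF assms(1,2)] pos])
  moreover have "X t ^ 3 * (v t)^2 * ?y \<le> 0"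
    using y X0 by (intro mult_nonneg_nonpos) auto
  ultimately show ?thesis by blast
qed

text \<open>At the equator \<open>q1\<close> vanishes, so the functional is the energy over
  \<open>sqrt (q0 + A)\<close> up to the \<open>q2\<close> term, and the lower bounds for
  \<open>q0\<close> and \<open>A\<close> make that term at most one more \<open>q0\<close>.\<close>

lemma sonin_le:
  assumes "0 \<le> t" "t < pi / 2" "0 \<le> q t"
  shows "sonin t \<le> 2 * S"
proof -
  have "sonin t \<le> sonin 0"
  proof (rule DERIV_nonpos_imp_nonincreasing[OF assms(1)])
    fix s assume "0 \<le> s" "s \<le> t"
    then show "\<exists>y. (sonin has_real_derivative y) (at s) \<and> y \<le> 0"
      using assms q_antimono[of s t] by (intro sonin_deriv_nonpos) auto
  qed
  also have "sonin 0 \<le> 2 * S"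
  proof -
    have q: "q 0 = q0" "q1 0 = 0" "q2 0 = - 2 * M" by (auto simp: q_def q1_def q2_def q0_def)
    have pos: "q0 + A > 0" using q0_pos A_pos by simp
    have "M \<le> l^2" using q0_pos by (simp add: q0_def)
    also have "\<dots> \<le> 2 * (l / 2 * (12 * B * l))"
    proof -
      have "l * l * 1 \<le> l * l * (12 * B)" using B_ge by (intro mult_left_mono) auto
      then show ?thesis by (simp add: power2_eq_square mult_ac)
    qed
    also have "\<dots> \<le> 2 * (q0 * (q0 + A))"
      using q0_ge A_ge l_ge B_ge q0_pos by (intro mult_left_mono mult_mono) auto
    finally have m: "M / (2 * (q0 + A)) \<le> q0" using pos by (simp add: field_simps)
    define Y where "Y = 1 / (q0 + A)"
    have "(X 0)^2 = Y" using pos by (simp add: X_def q power_divide Y_def)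
    then have x3: "X 0 ^ 3 = X 0 * Y" by (simp add: power3_eq_cube power2_eq_square)
    have m2: "M / (2 * (q0 + A)) = M * Y / 2" by (simp add: Y_def)
    have "sonin 0 = X 0 * ((q0 + M / (2 * (q0 + A))) * (v 0)^2 + (p 0)^2)"
      unfolding sonin_def q x3 m2 by (simp add: algebra_simps)
    also have "\<dots> \<le> X 0 * ((q0 + q0) * (v 0)^2 + 2 * (p 0)^2)"
      using m pos by (intro mult_left_mono add_mono mult_right_mono) (auto simp: X_def q)
    also have "\<dots> = X 0 * (2 * energy 0)" by (simp add: energy_def q algebra_simps)
    also have "\<dots> \<le> 1 / sqrt q0 * (2 * energy 0)"
      using q0_pos A_pos by (intro mult_right_mono) (auto simp: X_def q energy_def intro!: divide_left_mono)
    finally show ?thesis by (simp add: S_def)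
  qed
  finally show ?thesis .
qed

lemma X_facts:
  assumes "0 \<le> q t"
  shows "0 < X t" "(X t)^2 = 1 / (q t + A)" "X t * (q t + A) = sqrt (q t + A)"
proof -
  have pos: "q t + A > 0" using assms A_pos by simp
  then show "0 < X t" "(X t)^2 = 1 / (q t + A)" by (auto simp: X_def power_divide)
  show "X t * (q t + A) = sqrt (q t + A)" using pos by (simp add: X_def real_div_sqrt)
qed

text \<open>Completing the square in \<open>p\<close> costs 1/16 of the 3/8 in front of
  \<open>q1^2\<close>. The remaining 5/16 controls \<open>v\<close> near the turning point, where
  \<open>q\<close> gives nothing.\<close>

lemma sonin_ge:
  assumes "0 \<le> q t"
  shows "X t * (v t)^2 * (q t + 5 / 16 * (q1 t)^2 / (q t + A)^2) \<le> sonin t"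
proof -
  note X = X_facts[OF assms]
  have x4: "X t ^ 5 = X t * ((X t)^2)^2" "X t ^ 3 = X t * (X t)^2"
    by (simp_all add: eval_nat_numeral)
  have q2: "q2 t \<le> 0" using M_pos by (simp add: q2_def)
  have "sonin t - X t * (v t)^2 * (q t + 5 / 16 * (q1 t)^2 / (q t + A)^2)
      = X t * (p t + q1 t * (X t)^2 * v t / 4)^2 + X t ^ 3 * (v t)^2 * (- q2 t) / 4"
  proof -
    have c: "5 / 16 * (q1 t)^2 / (q t + A)^2 = 5 / 16 * (q1 t)^2 * ((X t)^2)^2"
      by (simp add: X(2) power_divide)
    show ?thesis unfolding c sonin_def x4
      by (simp add: power2_eq_square algebra_simps)
  qed
  moreover have "\<dots> \<ge> 0" using X(1) q2 by (intro add_nonneg_nonneg mult_nonneg_nonneg divide_nonneg_nonneg) auto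
  ultimately show ?thesis by linarith
qed


section \<open>The energy, and wells comparable in depth with their Airy scale\<close>

lemma energy_antimono:
  assumes "0 \<le> s" "s \<le> t" "t < pi / 2"
  shows "energy t \<le> energy s"
proof (rule DERIV_nonpos_imp_nonincreasing[OF assms(2)])
  fix x assume x: "s \<le> x" "x \<le> t"
  then have x': "0 \<le> x" "x < pi / 2" using assms by auto
  have dp': "(p has_real_derivative - q x * v x) (at x)" using dp[OF x'] by (simp add: q_def)
  have "(energy has_real_derivative q1 x * (v x)^2) (at x)"
    unfolding energy_def
    by (rule derivative_eq_intros dq[OF x'] dv[OF x'] dp' refl)+ (simp add: power2_eq_square)
  moreover have "q1 x * (v x)^2 \<le> 0" using q1_nonpos[OF x'] by (intro mult_nonpos_nonneg) auto
  ultimately show "\<exists>y. (energy has_real_derivative y) (at x) \<and> y \<le> 0" by blast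
qed

text \<open>Here \<open>q0\<close> is only of order \<open>l\<close>, and \<open>q1\<close> need not
  be large where \<open>q < A\<close>, so the Sonin bound says too little. In exchange the well is
  just a bounded number of wavelengths \<open>1 / sqrt q0\<close> wide.\<close>

lemma shallow:
  assumes "q0 / 2 < A"
  shows "q0 / M \<le> 32768 * B ^ 4 / q0" "A \<le> 26 * B * q0"
proof -
  have "(q0 / 2) ^ 3 \<le> A ^ 3" using assms q0_pos by (intro power_mono) auto
  then have "q0 ^ 3 \<le> 8 * (4096 * B ^ 3 * (l^2 * q0))"
    unfolding A_cube by (simp add: power_divide)
  then have "q0^2 * q0 \<le> 32768 * B ^ 3 * l^2 * q0"
    by (simp add: power2_eq_square power3_eq_cube)
  then have "q0^2 \<le> 32768 * B ^ 3 * l^2" using q0_pos by simp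
  also have "\<dots> \<le> 32768 * B ^ 3 * (B * M)" using l_M B_ge by (intro mult_left_mono) auto
  finally show "q0 / M \<le> 32768 * B ^ 4 / q0"
    using q0_pos M_pos by (simp add: field_simps power2_eq_square power3_eq_cube eval_nat_numeral)
  have "l^2 \<le> (2 * q0)^2" using q0_ge l_ge by (intro power_mono) auto
  then have "4096 * B ^ 3 * (l^2 * q0) \<le> 4096 * B ^ 3 * ((2 * q0)^2 * q0)"
    using B_ge q0_pos by (intro mult_left_mono mult_right_mono) auto
  also have "\<dots> \<le> (26 * B * q0) ^ 3"
    using B_ge q0_pos by (simp add: power_mult_distrib power2_eq_square power3_eq_cube)
  finally have "A ^ 3 \<le> (26 * B * q0) ^ 3" by (simp add: A_cube)
  then show "A \<le> 26 * B * q0"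
    using power_mono_iff[of A "26 * B * q0" 3] A_pos B_ge q0_pos by simp
qed

text \<open>The energy bounds the slope by \<open>sqrt (energy 0)\<close>; over a width of order
  \<open>1 / sqrt q0\<close> this changes \<open>v\<close> by no more than its natural size
  \<open>sqrt (energy 0 / q0)\<close>.\<close>

lemma v_sq_shallow:
  assumes "q0 / 2 < A" "0 \<le> t" "t < pi / 2" "0 \<le> q t"
  shows "(v t)^2 \<le> (2 + 65536 * B ^ 4) * (S / sqrt q0)"
proof -
  have energy: "0 \<le> energy 0" using energy_0 S_nonneg q0_pos by simp
  have pb: "\<bar>p x\<bar> \<le> sqrt (energy 0)" if "0 \<le> x" "x \<le> t" for x
  proof -
    have "0 \<le> q x" using q_antimono[of x t] that assms by linarith
    then have "(p x)^2 \<le> energy x" by (simp add: energy_def)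
    also have "\<dots> \<le> energy 0" using energy_antimono[of 0 x] that assms by simp
    finally show ?thesis by (metis real_sqrt_abs real_sqrt_le_iff)
  qed
  have "\<bar>v t - v 0\<bar> \<le> sqrt (energy 0) * tan t"
  proof (cases "t = 0")
    case False
    then have "0 < t" using assms by simp
    then obtain z where z: "0 < z" "z < t" "v t - v 0 = (t - 0) * p z"
      using MVT2[of 0 t v p] dv assms by (metis less_le_trans le_less_trans order_less_imp_le)
    have "t \<le> tan t"
    proof -
      have "tan 0 - 0 \<le> tan t - t"
      proof (rule DERIV_nonneg_imp_nondecreasing[OF assms(2), of "\<lambda>x. tan x - x"])
        fix x assume "0 \<le> x" "x \<le> t"
        then show "\<exists>y. ((\<lambda>x. tan x - x) has_real_derivative y) (at x) \<and> 0 \<le> y"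
          using DERIV_diff[OF dtan[of x] DERIV_ident] assms by (intro exI[of _ "(tan x)^2"]) auto
      qed
      then show ?thesis by simp
    qed
    then have "t * \<bar>p z\<bar> \<le> tan t * sqrt (energy 0)"
      using pb[of z] z assms by (intro mult_mono) auto
    then show ?thesis using z assms by (simp add: abs_mult mult.commute)
  qed simp
  moreover have "(v t)^2 \<le> 2 * (v 0)^2 + 2 * (v t - v 0)^2"
    using zero_le_power2[of "v t - 2 * v 0"] by (simp add: power2_eq_square algebra_simps)
  moreover have "(v t - v 0)^2 \<le> (sqrt (energy 0) * tan t)^2"
    using calculation(1) by (metis abs_ge_zero power2_abs power_mono)
  moreover have "(sqrt (energy 0) * tan t)^2 = energy 0 * (tan t)^2"
    using energy by (simp add: power_mult_distrib)
  moreover have "energy 0 * (tan t)^2 \<le> energy 0 * (32768 * B ^ 4 / q0)"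
  proof (intro mult_left_mono energy)
    have "(tan t)^2 \<le> q0 / M" using allowed(1)[OF assms(4)] M_pos by (simp add: field_simps)
    then show "(tan t)^2 \<le> 32768 * B ^ 4 / q0" using shallow(1)[OF assms(1)] by linarith
  qed
  moreover have "(v 0)^2 \<le> energy 0 / q0"
    using q0_pos by (simp add: energy_def q_def q0_def[symmetric] field_simps)
  ultimately have "(v t)^2 \<le> 2 * (energy 0 / q0) + 2 * (energy 0 * (32768 * B ^ 4 / q0))" by linarith
  also have "\<dots> = (2 + 65536 * B ^ 4) * (S / sqrt q0)"
    using q0_pos by (simp add: S_def field_simps)
  finally show ?thesis .
qed

lemma v_sq_allowed:
  assumes "0 \<le> t" "t < pi / 2" "0 \<le> q t"
  shows "(v t)^2 \<le> C1 * S / sqrt (q t + A)"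
proof (cases "q0 / 2 < A")
  case True
  have r: "q t + A \<le> (27 * B)^2 * q0"
  proof -
    have "q t \<le> q0" using M_pos by (simp add: q_def q0_def)
    then have "q t + A \<le> 1 * q0 + 26 * B * q0" using shallow(2)[OF True] by simp
    also have "\<dots> \<le> 1 * B * q0 + 26 * B * q0" using B_ge q0_pos by simp
    also have "\<dots> = 27 * B * 1 * q0" by simp
    also have "\<dots> \<le> 27 * B * (27 * B) * q0" using B_ge q0_pos by (intro mult_mono) auto
    finally show ?thesis by (simp add: power2_eq_square)
  qed
  have pos: "0 < q t + A" using assms A_pos by simp
  have "sqrt (q t + A) \<le> 27 * B * sqrt q0"
    using real_sqrt_le_mono[OF r] B_ge by (simp add: real_sqrt_mult)
  then have a: "1 / sqrt q0 \<le> 27 * B / sqrt (q t + A)"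
    using pos q0_pos by (simp add: field_simps)
  have b: "2 + 65536 * B ^ 4 \<le> 65538 * B ^ 4" using B_ge by simp
  have "(v t)^2 \<le> (2 + 65536 * B ^ 4) * (S * (1 / sqrt q0))"
    using v_sq_shallow[OF True assms] by simp
  also have "\<dots> \<le> (65538 * B ^ 4) * (S * (27 * B / sqrt (q t + A)))"
    using a b S_nonneg B_ge q0_pos by (intro mult_mono mult_left_mono) auto
  also have "\<dots> = (1769526 * B ^ 5) * S / sqrt (q t + A)" by (simp add: eval_nat_numeral)
  also have "\<dots> \<le> C1 * S / sqrt (q t + A)"
    using B_ge S_nonneg pos by (intro divide_right_mono mult_right_mono) (auto simp: C1_def)
  finally show ?thesis .
next
  case False
  note X = X_facts[OF assms(3)]
  define r where "r = q t + A"
  have r: "0 < r" "A \<le> r" using assms A_pos by (auto simp: r_def)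
  have B4: "1 \<le> B ^ 4" using B_ge by simp
  \<comment> \<open>The coefficient of \<open>v^2\<close> in \<open>sonin_ge\<close> has the full
    size of \<open>r\<close>. If \<open>A \<le> q t\<close>, then \<open>q\<close> alone shows it.
    Otherwise \<open>q t < A \<le> q0 / 2\<close> forces \<open>M * (tan t)^2\<close> to be at least
    \<open>q0 / 2\<close>, which makes \<open>(q1 t)^2\<close> at least of order
    \<open>A ^ 3\<close>.\<close>
  have key: "r / (60000 * B ^ 4) \<le> q t + 5 / 16 * (q1 t)^2 / r^2"
  proof (cases "A \<le> q t")
    case True
    have "r / (60000 * B ^ 4) \<le> r / 2" using r B4 by (intro divide_left_mono) auto
    also have "\<dots> \<le> q t" using True by (simp add: r_def)
    finally show ?thesis by (simp add: add_increasing2)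
  next
    case F: False
    have "q0 / 2 \<le> M * (tan t)^2" using F False by (simp add: q_def q0_def algebra_simps)
    then have "4 * (q0 / 2) * (M * 1) * 1 \<le> (q1 t)^2"
      unfolding q1_sq using q0_pos M_pos by (intro mult_mono) auto
    moreover have "q0 * l^2 \<le> q0 * (B * M)" using l_M q0_pos by (intro mult_left_mono) auto
    moreover from calculation(1) have "B * (2 * (q0 * M)) \<le> B * (q1 t)^2"
      using B_ge by (intro mult_left_mono) (auto simp: mult_ac)
    ultimately have "2 * (q0 * l^2) \<le> B * (q1 t)^2" by (simp add: mult_ac)
    then have "2048 * 2 * B ^ 3 * (q0 * l^2) \<le> 2048 * B ^ 3 * (B * (q1 t)^2)"
      using mult_left_mono[of "2 * (q0 * l^2)" "B * (q1 t)^2" "2048 * B ^ 3"] B_ge by (simp add: mult_ac)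
    then have "A ^ 3 \<le> 2048 * B ^ 4 * (q1 t)^2"
      unfolding A_cube by (simp add: mult_ac eval_nat_numeral)
    moreover have "(r / 2) ^ 3 \<le> A ^ 3" using F r by (intro power_mono) (auto simp: r_def)
    ultimately have "r * r^2 \<le> 16384 * B ^ 4 * (q1 t)^2"
      by (simp add: power_divide power2_eq_square power3_eq_cube)
    then have "r \<le> 16384 * B ^ 4 * ((q1 t)^2 / r^2)" using r by (simp add: field_simps)
    then have "r / (60000 * B ^ 4) \<le> 16384 * B ^ 4 * ((q1 t)^2 / r^2) / (60000 * B ^ 4)"
      using B4 by (intro divide_right_mono) auto
    also have "\<dots> = 16384 / 60000 * ((q1 t)^2 / r^2)" using B_ge by simp
    also have "\<dots> \<le> 5 / 16 * ((q1 t)^2 / r^2)" by (intro mult_right_mono) auto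
    finally show ?thesis using assms by simp
  qed
  have "X t * (v t)^2 * (r / (60000 * B ^ 4)) \<le> X t * (v t)^2 * (q t + 5 / 16 * (q1 t)^2 / r^2)"
    using key X(1) by (intro mult_left_mono) auto
  also have "\<dots> \<le> 2 * S" using sonin_ge[OF assms(3)] sonin_le[OF assms] by (simp add: r_def)
  finally have *: "X t * (v t)^2 * (r / (60000 * B ^ 4)) \<le> 2 * S" .
  have "X t * (v t)^2 * r \<le> 120000 * B ^ 4 * S"
  proof -
    have "X t * (v t)^2 * r = X t * (v t)^2 * (r / (60000 * B ^ 4)) * (60000 * B ^ 4)"
      using B_ge by simp
    also have "\<dots> \<le> 2 * S * (60000 * B ^ 4)" using * B4 by (intro mult_right_mono) auto
    finally show ?thesis by (simp add: mult_ac)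
  qed
  also have "X t * (v t)^2 * r = (v t)^2 * (X t * r)" by simp
  also have "X t * r = sqrt r" using X(3) by (simp add: r_def)
  also have "120000 * B ^ 4 * S \<le> C1 * S"
  proof -
    have "B ^ 4 \<le> B ^ 5" using B_ge by (intro power_increasing) auto
    then show ?thesis using S_nonneg B4 by (intro mult_right_mono) (auto simp: C1_def)
  qed
  finally have "(v t)^2 \<le> C1 * S / sqrt r" using r by (simp add: field_simps)
  then show ?thesis by (simp only: r_def)
qed

section \<open>The turning point and the forbidden region beyond it\<close>

definition "\<beta> = arctan (sqrt (q0 / M))"

lemma beta: "0 \<le> \<beta>" "\<beta> < pi / 2" "q \<beta> = 0"
  using q0_pos M_pos arctan_ubound[of "sqrt (q0 / M)"]
  by (auto simp: \<beta>_def q_def tan_arctan q0_def field_simps)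

text \<open>The bound on \<open>v * p\<close> with which the forbidden region is entered. The slope
  is read off the Sonin functional in deep wells and off the energy in shallow ones.\<close>

lemma vp_beta: "\<bar>v \<beta> * p \<beta>\<bar> \<le> C1 * S"
proof -
  have "(v \<beta>)^2 * (p \<beta>)^2 \<le> (C1 * S)^2"
  proof (cases "q0 / 2 < A")
    case True
    have "(p \<beta>)^2 \<le> S * sqrt q0" using energy_antimono[of 0 \<beta>] beta energy_0 by (simp add: energy_def)
    then have "(v \<beta>)^2 * (p \<beta>)^2 \<le> ((2 + 65536 * B ^ 4) * (S / sqrt q0)) * (S * sqrt q0)"
      using v_sq_shallow[OF True, of \<beta>] beta S_nonneg q0_pos B_ge
      by (intro mult_mono mult_nonneg_nonneg divide_nonneg_nonneg add_nonneg_nonneg) auto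
    also have "\<dots> = (2 + 65536 * B ^ 4) * S^2" using q0_pos by (simp add: power2_eq_square)
    also have "\<dots> \<le> C1^2 * S^2"
    proof (rule mult_right_mono)
      have "B ^ 4 \<le> B ^ 5" "1 \<le> B ^ 5" using B_ge by (auto intro: power_increasing)
      then have "2 + 65536 * B ^ 4 \<le> C1 * 1" by (simp add: C1_def)
      also have "\<dots> \<le> C1 * C1" using C1_ge by (intro mult_left_mono) auto
      finally show "2 + 65536 * B ^ 4 \<le> C1^2" by (simp add: power2_eq_square)
    qed simp
    finally show ?thesis by (simp add: power_mult_distrib)
  next
    case False
    have b: "0 \<le> q \<beta>" using beta by simp
    note X = X_facts[OF b]
    define z where "z = q1 \<beta> * (X \<beta>)^2 * v \<beta>"
    have x4: "X \<beta> ^ 5 = X \<beta> * ((X \<beta>)^2)^2" "X \<beta> ^ 3 = X \<beta> * (X \<beta>)^2"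
      by (simp_all add: eval_nat_numeral)
    \<comment> \<open>As \<open>q \<beta> = 0\<close>, the square is now completed in
      \<open>z\<close> rather than in \<open>p\<close>, which leaves 5/6 of
      \<open>p^2\<close>.\<close>
    have "sonin \<beta> = X \<beta> * (3 / 8 * (z + 2 / 3 * p \<beta>)^2 + 5 / 6 * (p \<beta>)^2) + X \<beta> ^ 3 * (v \<beta>)^2 * (- q2 \<beta>) / 4"
      unfolding sonin_def x4 z_def beta(3) by (simp add: power2_eq_square algebra_simps)
    moreover have "0 \<le> X \<beta> ^ 3 * (v \<beta>)^2 * (- q2 \<beta>) / 4"
      using X(1) M_pos by (intro divide_nonneg_nonneg mult_nonneg_nonneg) (auto simp: q2_def)
    ultimately have "X \<beta> * (3 / 8 * (z + 2 / 3 * p \<beta>)^2 + 5 / 6 * (p \<beta>)^2) \<le> 2 * S"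
      using sonin_le[of \<beta>] beta by simp
    moreover have "X \<beta> * (5 / 6 * (p \<beta>)^2) \<le> X \<beta> * (3 / 8 * (z + 2 / 3 * p \<beta>)^2 + 5 / 6 * (p \<beta>)^2)"
      using X(1) by (intro mult_left_mono) auto
    ultimately have "X \<beta> * (5 / 6 * (p \<beta>)^2) \<le> 2 * S" by linarith
    then have "(p \<beta>)^2 \<le> 12 / 5 * S * sqrt A"
      using A_pos by (simp add: X_def beta field_simps)
    moreover have "(v \<beta>)^2 \<le> C1 * S / sqrt A"
      using v_sq_allowed[of \<beta>] beta by simp
    ultimately have "(v \<beta>)^2 * (p \<beta>)^2 \<le> (C1 * S / sqrt A) * (12 / 5 * S * sqrt A)"
      using S_nonneg C1_ge A_pos by (intro mult_mono) auto
    also have "\<dots> = C1 * (12 / 5) * S^2" using A_pos by (simp add: power2_eq_square)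
    also have "\<dots> \<le> C1 * C1 * S^2" using C1_ge by (intro mult_right_mono mult_left_mono) auto
    finally show ?thesis by (simp add: power2_eq_square mult_ac)
  qed
  then have "\<bar>v \<beta> * p \<beta>\<bar> \<le> \<bar>C1 * S\<bar>"
    by (intro power2_le_iff_abs_le[THEN iffD1]) (auto simp: power_mult_distrib)
  then show ?thesis using S_nonneg C1_ge by simp
qed


lemma lim_vv: "(v \<longlongrightarrow> 0) (at_left (pi / 2))"
proof -
  have "((\<lambda>t. v t / cos t * cos t) \<longlongrightarrow> 0 * cos (pi / 2)) (at_left (pi / 2))"
    by (intro tendsto_intros lim_v)
  then have "((\<lambda>t. v t / cos t * cos t) \<longlongrightarrow> 0) (at_left (pi / 2))" by simp
  then show ?thesis
  proof (rule Lim_transform_eventually)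
    have "eventually (\<lambda>t. t \<in> {0<..<pi / 2}) (at_left (pi / 2))"
      by (rule eventually_at_left_real) simp
    then show "eventually (\<lambda>t. v t / cos t * cos t = v t) (at_left (pi / 2))"
    proof eventually_elim
      case (elim t)
      then have "0 < cos t" by (intro cos_pos) auto
      then show ?case by simp
    qed
  qed
qed

lemma nondecreasing_to_zero:
  fixes f f' :: "real \<Rightarrow> real"
  assumes "a \<le> t" "t < b"
    and "\<And>x. a \<le> x \<Longrightarrow> x < b \<Longrightarrow> (f has_real_derivative f' x) (at x)"
    and "\<And>x. a \<le> x \<Longrightarrow> x < b \<Longrightarrow> 0 \<le> f' x"
    and lim: "(f \<longlongrightarrow> 0) (at_left b)"
  shows "f t \<le> 0"
proof (rule tendsto_lowerbound[OF lim])
  have "eventually (\<lambda>x. x \<in> {t<..<b}) (at_left b)"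
    by (rule eventually_at_left_real) (use assms in auto)
  then show "eventually (\<lambda>x. f t \<le> f x) (at_left b)"
  proof eventually_elim
    case (elim x)
    show ?case
    proof (rule DERIV_nonneg_imp_nondecreasing[of t x f])
      show "t \<le> x" using elim by simp
      fix y assume "t \<le> y" "y \<le> x"
      then show "\<exists>z. (f has_real_derivative z) (at y) \<and> 0 \<le> z"
        using assms(3,4)[of y] elim assms(1) by (intro exI[of _ "f' y"]) auto
    qed
  qed
qed simp

lemma beyond_beta: "\<beta> \<le> t \<Longrightarrow> t < pi / 2 \<Longrightarrow> 0 \<le> t \<and> q t \<le> 0"
  using beta q_antimono[of \<beta> t] by auto

lemma dvp:
  assumes "0 \<le> t" "t < pi / 2"
  shows "((\<lambda>t. v t * p t) has_real_derivative ((p t)^2 - q t * (v t)^2)) (at t)"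
  using DERIV_mult[OF dv[OF assms] dp[OF assms]]
  by (simp add: q_def power2_eq_square algebra_simps)

text \<open>Regularity at the pole excludes the growing solution: the derivative
  \<open>p^2 - q * v^2\<close> of \<open>v * p\<close> is nonnegative where
  \<open>q \<le> 0\<close>, and \<open>v * p\<close> ends at 0.\<close>

lemma vp_nonpos:
  assumes "\<beta> \<le> t" "t < pi / 2"
  shows "v t * p t \<le> 0"
proof (rule nondecreasing_to_zero[OF assms])
  show "((\<lambda>t. v t * p t) \<longlongrightarrow> 0) (at_left (pi / 2))"
    using tendsto_mult[OF lim_vv lim_p] by simp
  fix x assume x: "\<beta> \<le> x" "x < pi / 2"
  show "((\<lambda>t. v t * p t) has_real_derivative ((p x)^2 - q x * (v x)^2)) (at x)"
    using dvp beyond_beta[OF x] x by simp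
  show "0 \<le> (p x)^2 - q x * (v x)^2"
    using conjunct2[OF beyond_beta[OF x]] order_trans[OF mult_nonpos_nonneg[of "q x" "(v x)^2"] zero_le_power2[of "p x"]] by simp
qed

lemma v_sq_antimono:
  assumes "\<beta> \<le> s" "s \<le> t" "t < pi / 2"
  shows "(v t)^2 \<le> (v s)^2"
proof (rule DERIV_nonpos_imp_nonincreasing[OF assms(2)])
  fix x assume "s \<le> x" "x \<le> t"
  then have x: "\<beta> \<le> x" "x < pi / 2" using assms by auto
  have "((\<lambda>t. (v t)^2) has_real_derivative 2 * (v x * p x)) (at x)"
    using DERIV_power[OF dv[of x], of 2] beyond_beta[OF x] x by (simp add: mult_ac)
  then show "\<exists>y. ((\<lambda>t. (v t)^2) has_real_derivative y) (at x) \<and> y \<le> 0"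
    using vp_nonpos[OF x] by (intro exI[of _ "2 * (v x * p x)"] conjI) (auto simp: mult.commute)
qed

text \<open>The energy decreases to the limit 0 at the pole. In the forbidden region this reads
  \<open>p^2 \<ge> - q * v^2\<close>, which is the WKB decay rate without any asymptotics.\<close>

lemma energy_nonneg:
  assumes "0 \<le> t" "t < pi / 2"
  shows "0 \<le> energy t"
proof -
  have "((\<lambda>t. l^2 * (v t)^2 - M * (v t / cos t)^2 + (p t)^2) \<longlongrightarrow> l^2 * 0^2 - M * 0^2 + 0^2) (at_left (pi / 2))"
    by (intro tendsto_intros lim_v lim_vv lim_p)
  moreover have "eventually (\<lambda>s. s \<in> {t<..<pi / 2}) (at_left (pi / 2))"
    by (rule eventually_at_left_real) (use assms in auto)
  then have "eventually (\<lambda>s. l^2 * (v s)^2 - M * (v s / cos s)^2 + (p s)^2 \<le> energy t) (at_left (pi / 2))"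
  proof eventually_elim
    case (elim s)
    then have c: "0 < cos s" using cos_pos[of s] assms by auto
    have "1 + (tan s)^2 = 1 / (cos s)^2" using c by (simp add: tan_sec power_inverse inverse_eq_divide power_divide)
    then have "energy s = l^2 * (v s)^2 - M * (v s / cos s)^2 + (p s)^2"
      by (simp add: energy_def q_def algebra_simps power_divide)
    then show ?case using energy_antimono[of t s] elim assms by auto
  qed
  ultimately have "l^2 * 0^2 - M * 0^2 + 0^2 \<le> energy t" by (rule tendsto_upperbound) simp
  then show ?thesis by simp
qed

text \<open>Integrate \<open>(v * p)' \<ge> - q * v^2\<close> from \<beta> to \<open>t\<close>,
  where v^2 is at least \<open>(v t)^2\<close>. The left side contributes at most
  \<open>C1 * S\<close>, and since \<open>- q1\<close> is at most \<open>A * sqrt A\<close> here,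
  the integral of \<open>- q\<close> is at least \<open>(q t)^2 / (2 * A * sqrt A)\<close>.\<close>

lemma v_sq_far_aux:
  assumes "\<beta> \<le> t" "t < pi / 2" "M * (tan t)^2 \<le> 4 * q0" "A \<le> - q t"
  shows "(v t)^2 \<le> 2 * C1 * S / sqrt (- q t)"
proof -
  define E where "E = A * sqrt A"
  have E: "0 < E" "E^2 = A ^ 3" using A_pos by (auto simp: E_def power2_eq_square power3_eq_cube)
  have q1E: "- q1 x \<le> E" if "\<beta> \<le> x" "x \<le> t" for x
  proof -
    have x: "0 \<le> x" "x < pi / 2" using that beta assms by auto
    have m: "M * (tan x)^2 \<le> 4 * q0" using tan_mono[of x t] x that assms M_pos
      by (smt (verit) mult_left_mono)
    then have m2: "M * (1 + (tan x)^2) \<le> 4 * l^2" using M_pos by (simp add: q0_def algebra_simps)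
    then have "M * (1 + (tan x)^2) \<le> M * (4 * B)" using l_M by (simp add: mult_ac)
    then have m3: "1 + (tan x)^2 \<le> 4 * B" using M_pos by simp
    have "(q1 x)^2 \<le> 4 * (4 * q0) * (4 * l^2) * (4 * B)"
      unfolding q1_sq using M_pos q0_pos m
      by (intro mult_mono[OF mult_mono[OF mult_left_mono[OF m] m2] m3]) auto
    also have "\<dots> \<le> 4096 * B ^ 3 * (l^2 * q0)"
    proof -
      have "B \<le> B ^ 3" using B_ge by (simp add: self_le_power)
      then have "256 * B * (l^2 * q0) \<le> 4096 * B ^ 3 * (l^2 * q0)"
        using q0_pos B_ge by (intro mult_right_mono) auto
      then show ?thesis by (simp add: mult_ac)
    qed
    finally have "(- q1 x)^2 \<le> E^2" using E A_cube by simp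
    then show ?thesis using E power2_le_imp_le[of "- q1 x" E] by simp
  qed
  let ?f = "\<lambda>x. v x * p x - (v t)^2 * ((q x)^2 / (2 * E))"
  have "?f \<beta> \<le> ?f t"
  proof (rule DERIV_nonneg_imp_nondecreasing[OF assms(1)])
    fix x assume x: "\<beta> \<le> x" "x \<le> t"
    then have x': "0 \<le> x" "x < pi / 2" using beta assms by auto
    have qx: "q x \<le> 0" using beyond_beta x x' by auto
    have d: "(?f has_real_derivative ((p x)^2 - q x * (v x)^2) - (v t)^2 * (q x * q1 x / E)) (at x)"
      using DERIV_diff[OF dvp[OF x'] DERIV_cmult[OF DERIV_cdivide[OF DERIV_power[OF dq(1)[OF x'], of 2], of "2 * E"], of "(v t)^2"]]
      by (simp add: mult_ac)
    have "(v t)^2 * (q x * q1 x / E) \<le> (v t)^2 * (- q x)"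
    proof (rule mult_left_mono)
      have "(- q x) * (- q1 x) \<le> (- q x) * E" using q1E[OF x] qx by (intro mult_left_mono) auto
      then show "q x * q1 x / E \<le> - q x" using E by (simp add: field_simps)
    qed simp
    also have "\<dots> \<le> (v x)^2 * (- q x)"
      using v_sq_antimono[of x t] x assms qx by (intro mult_right_mono) auto
    also have "\<dots> \<le> (p x)^2 - q x * (v x)^2" by simp
    finally show "\<exists>y. (?f has_real_derivative y) (at x) \<and> 0 \<le> y" using d by (intro exI conjI) auto
  qed
  then have "(v t)^2 * ((q t)^2 / (2 * E)) \<le> C1 * S"
    using vp_nonpos[OF assms(1,2)] vp_beta beta by simp
  then have a: "(v t)^2 * (q t)^2 \<le> 2 * C1 * S * E" using E by (simp add: field_simps)
  have "E * sqrt (- q t) \<le> (- q t) * sqrt (- q t) * sqrt (- q t)"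
    unfolding E_def using assms A_pos by (intro mult_right_mono mult_mono mult_nonneg_nonneg) auto
  also have "\<dots> = (- q t) * (sqrt (- q t) * sqrt (- q t))" by (simp only: mult.assoc)
  also have "\<dots> = (q t)^2" using assms A_pos by (simp add: power2_eq_square)
  finally have "(v t)^2 * (E * sqrt (- q t)) \<le> 2 * C1 * S * E"
    using a mult_left_mono[of "E * sqrt (- q t)" "(q t)^2" "(v t)^2"] by simp
  then have "E * ((v t)^2 * sqrt (- q t)) \<le> E * (2 * C1 * S)" by (simp add: mult_ac)
  then have "(v t)^2 * sqrt (- q t) \<le> 2 * C1 * S" using E by simp
  then show ?thesis using assms A_pos by (simp add: field_simps)
qed

lemma v_sq_near:
  assumes "0 \<le> t" "t < pi / 2" "M * (tan t)^2 \<le> 4 * q0"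
  shows "(v t)^2 \<le> 4 * C1 * S / sqrt (A + \<bar>q t\<bar>)"
proof -
  have CS: "0 \<le> C1 * S" using C1_ge S_nonneg by simp
  consider "0 \<le> q t" | "q t < 0" "- q t \<le> A" | "q t < 0" "A \<le> - q t" by linarith
  then show ?thesis
  proof cases
    case 1
    have "C1 * S / sqrt (q t + A) \<le> 4 * (C1 * S) / sqrt (q t + A)"
      using CS 1 A_pos by (intro divide_right_mono) auto
    then show ?thesis using v_sq_allowed[OF assms(1,2) 1] 1 by (simp add: add.commute)
  next
    case 2
    have t: "\<beta> \<le> t" using 2(1) q_antimono[of t \<beta>] beta assms by (cases "\<beta> \<le> t") auto
    have "(v t)^2 \<le> (v \<beta>)^2" using v_sq_antimono[of \<beta> t] t assms by simp
    also have "\<dots> \<le> C1 * S / sqrt A" using v_sq_allowed[of \<beta>] beta by simp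
    also have "\<dots> \<le> 4 * (C1 * S) / sqrt (A + \<bar>q t\<bar>)"
    proof -
      have "sqrt (A + \<bar>q t\<bar>) \<le> sqrt (4^2 * A)" using 2 A_pos by (intro real_sqrt_le_mono) auto
      also have "\<dots> = 4 * sqrt A" by (simp add: real_sqrt_mult)
      finally have "C1 * S * sqrt (A + \<bar>q t\<bar>) \<le> C1 * S * (4 * sqrt A)" using CS by (intro mult_left_mono) auto
      moreover have "0 < A + \<bar>q t\<bar>" using A_pos by simp
      ultimately show ?thesis using A_pos by (simp add: field_simps)
    qed
    finally show ?thesis by simp
  next
    case 3
    have t: "\<beta> \<le> t" using 3(1) q_antimono[of t \<beta>] beta assms by (cases "\<beta> \<le> t") auto
    have "(v t)^2 \<le> 2 * (C1 * S) / sqrt (- q t)" using v_sq_far_aux[OF t assms(2,3) 3(2)] by simp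
    also have "\<dots> \<le> 4 * (C1 * S) / sqrt (A + \<bar>q t\<bar>)"
    proof -
      have "sqrt (A + \<bar>q t\<bar>) \<le> sqrt (2^2 * (- q t))" using 3 A_pos by (intro real_sqrt_le_mono) auto
      also have "\<dots> = 2 * sqrt (- q t)" by (simp only: real_sqrt_mult real_sqrt_abs)
      finally have "2 * (C1 * S) * sqrt (A + \<bar>q t\<bar>) \<le> 2 * (C1 * S) * (2 * sqrt (- q t))"
        using CS by (intro mult_left_mono) auto
      moreover have "0 < A + \<bar>q t\<bar>" using A_pos by simp
      ultimately show ?thesis using 3 by (simp add: field_simps)
    qed
    finally show ?thesis by simp
  qed
qed

text \<open>In this range \<open>- q\<close> is at least \<open>M * (tan t)^2 / 2\<close>, so
  nonnegativity of the energy makes ln(v^2) fall at least as fast as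
  \<open>sqrt (2 * M) * ln (cos t)\<close>.\<close>

lemma v_sq_decay:
  assumes "0 \<le> s" "s \<le> t" "t < pi / 2" "2 * q0 \<le> M * (tan s)^2"
  shows "(v t)^2 * cos t powr - sqrt (2 * M) \<le> (v s)^2 * cos s powr - sqrt (2 * M)"
proof (rule DERIV_nonpos_imp_nonincreasing[OF assms(2)])
  fix x assume x: "s \<le> x" "x \<le> t"
  then have x': "0 \<le> x" "x < pi / 2" using assms by auto
  define T where "T = tan x"
  define N where "N = sqrt (2 * M)"
  have T: "0 \<le> T" using tan_ge0[OF x'] by (simp add: T_def)
  have MT: "2 * q0 \<le> M * T^2" using tan_mono[of s x] x x' assms M_pos unfolding T_def
    by (smt (verit) mult_left_mono)
  have R: "M * T^2 / 2 \<le> - q x" using MT by (simp add: q_def T_def q0_def algebra_simps)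
  have xb: "\<beta> \<le> x"
  proof (rule ccontr)
    assume "\<not> \<beta> \<le> x"
    then have "0 \<le> q x" using q_antimono[of x \<beta>] beta x' by simp
    then show False using R MT q0_pos by linarith
  qed
  have c: "0 < cos x" using cos_pos[OF x'] .
  have "- q x * (v x)^2 \<le> (p x)^2" using energy_nonneg[OF x'] by (simp add: energy_def)
  then have "M * T^2 / 2 * (v x)^2 \<le> (p x)^2"
    using mult_right_mono[OF R, of "(v x)^2"] by simp
  then have "M * T^2 / 2 * (v x)^2 * (v x)^2 \<le> (v x * p x)^2"
    using mult_right_mono[of _ _ "(v x)^2"] by (fastforce simp: power_mult_distrib mult_ac)
  moreover have "(N / 2 * T * (v x)^2)^2 = M * T^2 / 2 * (v x)^2 * (v x)^2"
    using M_pos by (simp add: N_def power_mult_distrib power2_eq_square field_simps)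
  ultimately have "(N / 2 * T * (v x)^2)^2 \<le> (- (v x * p x))^2" by simp
  then have "N / 2 * T * (v x)^2 \<le> - (v x * p x)"
    using vp_nonpos[OF xb x'(2)] by (intro power2_le_imp_le[of "N / 2 * T * (v x)^2" "- (v x * p x)"]) auto
  then have neg: "2 * (v x * p x) + N * T * (v x)^2 \<le> 0" by simp
  have "((\<lambda>t. (v t)^2 * cos t powr - N) has_real_derivative
      (2 * (v x * p x) + N * T * (v x)^2) * cos x powr - N) (at x)"
  proof -
    have "cos x powr (- N - 1) * sin x = cos x powr (- N) * T"
      using c by (simp add: powr_diff T_def tan_def)
    then show ?thesis using c
      by (auto intro!: derivative_eq_intros dv[OF x'] simp: algebra_simps power2_eq_square)
  qed
  moreover have "(2 * (v x * p x) + N * T * (v x)^2) * cos x powr - N \<le> 0"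
    using neg by (intro mult_nonpos_nonneg) auto
  ultimately show "\<exists>y. ((\<lambda>t. (v t)^2 * cos t powr - sqrt (2 * M)) has_real_derivative y) (at x) \<and> y \<le> 0"
    unfolding N_def by blast
qed

text \<open>The decay is started where \<open>M * (tan s)^2 = 4 * q0\<close>, the end of the range
  of \<open>v_sq_near\<close>; there \<open>cos s = 1 / sqrt (1 + 4 * q0 / M)\<close>.\<close>

lemma v_sq_far:
  assumes "0 \<le> t" "t < pi / 2" "4 * q0 \<le> M * (tan t)^2"
  shows "(v t)^2 \<le> 4 * C1 * S / sqrt q0 * (cos t * sqrt (1 + 4 * q0 / M)) powr sqrt (2 * M)"
proof -
  define s where "s = arctan (sqrt (4 * q0 / M))"
  have s: "0 \<le> s" "s < pi / 2" "tan s = sqrt (4 * q0 / M)"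
    using q0_pos M_pos arctan_ubound[of "sqrt (4 * q0 / M)"] by (auto simp: s_def tan_arctan)
  have ts: "M * (tan s)^2 = 4 * q0" using q0_pos M_pos by (simp add: s(3))
  have cs: "cos s = 1 / sqrt (1 + 4 * q0 / M)"
    using q0_pos M_pos by (simp add: s_def cos_arctan)
  have "sqrt (4 * q0 / M) \<le> sqrt ((tan t)^2)"
    using assms M_pos by (intro real_sqrt_le_mono) (simp add: field_simps)
  then have "tan s \<le> tan t" using s tan_ge0[OF assms(1,2)] by simp
  then have st: "s \<le> t" using s assms by (metis tan_mono_lt_eq leD not_le order_less_le_trans[of "- (pi / 2)" 0] pi_half_gt_zero neg_less_0_iff_less)
  have ct: "0 < cos t" "0 < cos s" using cos_pos assms s by auto
  have "(v t)^2 * cos t powr - sqrt (2 * M) \<le> (v s)^2 * cos s powr - sqrt (2 * M)"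
    using v_sq_decay[of s t] s st assms ts q0_pos by simp
  then have "(v t)^2 \<le> (v s)^2 * (cos t powr sqrt (2 * M) * cos s powr - sqrt (2 * M))"
    using ct by (simp add: powr_minus field_simps)
  also have "cos t powr sqrt (2 * M) * cos s powr - sqrt (2 * M) = (cos t * sqrt (1 + 4 * q0 / M)) powr sqrt (2 * M)"
    using ct q0_pos M_pos by (subst powr_mult) (auto simp: cs powr_minus powr_divide)
  also have "(v s)^2 * \<dots> \<le> 4 * C1 * S / sqrt q0 * \<dots>"
  proof (rule mult_right_mono)
    have "q0 \<le> A + \<bar>q s\<bar>" using ts A_pos q0_pos by (simp add: q_def q0_def algebra_simps)
    then have "4 * C1 * S / sqrt (A + \<bar>q s\<bar>) \<le> 4 * C1 * S / sqrt q0"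
      using q0_pos S_nonneg C1_ge by (intro divide_left_mono) auto
    then show "(v s)^2 \<le> 4 * C1 * S / sqrt q0" using v_sq_near[of s] s ts by simp
  qed simp
  finally show ?thesis .
qed

end

subsection \<open>Jacobi polynomials: differential equation and values at 0\<close>

text \<open>For integer \<open>y\<close> this is the central binomial coefficient over 4^y; in
  general, by the duplication formula, it is Gamma(y + 1/2) / (sqrt(pi) Gamma(y + 1)).\<close>

definition gamma_ratio :: "real \<Rightarrow> real" where
  "gamma_ratio y = Gamma (2 * y + 1) / (4 powr y * (Gamma (y + 1))^2)"

lemma Gamma_real_nonzero: "0 < x \<Longrightarrow> Gamma x \<noteq> (0::real)"
  by (metis Gamma_real_pos less_irrefl)

lemma gamma_ratio_pos: "0 \<le> y \<Longrightarrow> 0 < gamma_ratio y"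
  unfolding gamma_ratio_def by (intro divide_pos_pos mult_pos_pos zero_less_power Gamma_real_pos) auto

lemma Gamma_legendre_duplication_real:
  fixes x :: real
  assumes "0 < x"
  shows "Gamma x * Gamma (x + 1 / 2) = exp ((1 - 2 * x) * ln 2) * sqrt pi * Gamma (2 * x)"
proof -
  have "complex_of_real x \<notin> \<int>\<^sub>\<le>\<^sub>0" "complex_of_real x + 1 / 2 \<notin> \<int>\<^sub>\<le>\<^sub>0"
    using assms by (auto elim!: nonpos_Ints_cases' simp: complex_eq_iff)
  from Gamma_legendre_duplication[OF this]
  have "complex_of_real (Gamma x * Gamma (x + 1 / 2)) = complex_of_real (exp ((1 - 2 * x) * ln 2) * sqrt pi * Gamma (2 * x))"
    by (simp add: Gamma_complex_of_real[symmetric] exp_of_real[symmetric])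
  then show ?thesis by (simp only: of_real_eq_iff)
qed

text \<open>Log-convexity at the midpoint of \<open>y\<close> and \<open>y + 1\<close> bounds
  \<open>(Gamma (y + 1/2))^2\<close> by \<open>Gamma y * Gamma (y + 1)\<close>.\<close>

lemma gamma_ratio_le:
  assumes "0 < y"
  shows "gamma_ratio y \<le> 1 / sqrt (pi * y)"
proof -
  have pw: "exp ((1 - 2 * (y + 1 / 2)) * ln 2) = 1 / 4 powr y"
  proof -
    have "4 powr y = (2 powr 2) powr y" by simp
    also have "\<dots> = exp (2 * y * ln 2)" by (simp only: powr_powr) (simp add: powr_def)
    finally show ?thesis by (simp add: exp_minus field_simps)
  qed
  have "Gamma (y + 1 / 2) * Gamma (y + 1) = 1 / 4 powr y * sqrt pi * Gamma (2 * y + 1)"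
    using Gamma_legendre_duplication_real[of "y + 1 / 2"] pw assms by (simp add: algebra_simps)
  then have e: "sqrt pi * gamma_ratio y * Gamma (y + 1) = Gamma (y + 1 / 2)"
    using assms Gamma_real_nonzero[of "y + 1"]
    by (simp add: gamma_ratio_def field_simps power2_eq_square)
  have "(ln \<circ> Gamma) ((1 - 1 / 2) *\<^sub>R y + (1 / 2) *\<^sub>R (y + 1)) \<le> (1 - 1 / 2) * (ln \<circ> Gamma) y + (1 / 2) * (ln \<circ> Gamma) (y + 1)"
    using assms by (intro convex_onD[OF log_convex_Gamma_real]) auto
  moreover have "(1 - 1 / 2) *\<^sub>R y + (1 / 2) *\<^sub>R (y + 1) = y + 1 / 2" by (simp add: field_simps)
  ultimately have "2 * ln (Gamma (y + 1 / 2)) \<le> ln (Gamma y) + ln (Gamma (y + 1))" by (simp add: o_def)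
  moreover have nz: "Gamma (y + 1 / 2) \<noteq> 0" using assms by (intro Gamma_real_nonzero) auto
  ultimately have "ln ((Gamma (y + 1 / 2))^2) \<le> ln (Gamma y * Gamma (y + 1))"
    using assms Gamma_real_nonzero[of y] Gamma_real_nonzero[of "y + 1"] by (simp add: ln_mult ln_realpow)
  then have "(Gamma (y + 1 / 2))^2 \<le> Gamma y * Gamma (y + 1)"
    using assms nz by (subst (asm) ln_le_cancel_iff) auto
  also have "Gamma (y + 1) = y * Gamma y"
    using assms by (intro Gamma_plus1) (auto elim!: nonpos_Ints_cases')
  then have "Gamma y = Gamma (y + 1) / y" using assms by simp
  finally have "y * (sqrt pi * gamma_ratio y * Gamma (y + 1))^2 \<le> (Gamma (y + 1))^2"
    unfolding e using assms by (simp add: field_simps power2_eq_square)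
  then have "(pi * y) * (gamma_ratio y)^2 * (Gamma (y + 1))^2 \<le> 1 * (Gamma (y + 1))^2"
    by (simp add: power_mult_distrib mult_ac)
  then have "(pi * y) * (gamma_ratio y)^2 \<le> 1"
    using assms Gamma_real_nonzero[of "y + 1"] by (subst (asm) mult_le_cancel_right) auto
  then have "sqrt ((pi * y) * (gamma_ratio y)^2) \<le> 1" by simp
  then have "sqrt (pi * y) * gamma_ratio y \<le> 1"
    using gamma_ratio_pos[of y] assms by (simp add: real_sqrt_mult)
  then show ?thesis using assms by (simp add: field_simps)
qed

section \<open>Derivatives of the weight (1 - t^2)^N\<close>

definition weight_deriv :: "real \<Rightarrow> nat \<Rightarrow> real \<Rightarrow> real" where
  "weight_deriv N j = (deriv ^^ j) (\<lambda>s. (1 - s) powr N * (1 + s) powr N)"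

lemma weight_deriv_0: "weight_deriv N 0 t = (1 - t) powr N * (1 + t) powr N"
  by (simp add: weight_deriv_def)

lemma weight_deriv_deriv:
  assumes t: "t \<in> {-1<..<1}"
  shows "(weight_deriv N j has_real_derivative weight_deriv N (Suc j) t) (at t)"
proof -
  obtain q where q: "\<And>t. t \<in> {-1<..<1} \<Longrightarrow>
      weight_deriv N j t = (1 - t) powr (N - real j) * (1 + t) powr (N - real j) * poly q t"
    using higher_deriv_weight[of j N N] unfolding weight_deriv_def by blast
  have "\<exists>y. ((\<lambda>t. (1 - t) powr (N - real j) * (1 + t) powr (N - real j) * poly q t) has_real_derivative y) (at t)"
    using t by (intro exI) (auto intro!: derivative_eq_intros)
  then obtain y where "((\<lambda>t. (1 - t) powr (N - real j) * (1 + t) powr (N - real j) * poly q t) has_real_derivative y) (at t)"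
    by blast
  then have "(weight_deriv N j has_real_derivative y) (at t)"
    by (rule has_field_derivative_transform_within_open[of _ _ _ "{-1<..<1}"]) (use t q in auto)
  moreover from this have "weight_deriv N (Suc j) t = y"
    by (simp add: weight_deriv_def DERIV_imp_deriv)
  ultimately show ?thesis by simp
qed

lemma DERIV_of_zero:
  assumes "\<And>t. t \<in> {-1<..<1} \<Longrightarrow> f t = 0" "t \<in> {-1<..<(1::real)}" "(f has_real_derivative y) (at t)"
  shows "y = 0"
proof -
  have "((\<lambda>_. 0) has_real_derivative y) (at t)"
    by (rule has_field_derivative_transform_within_open[OF assms(3), of "{-1<..<1}"]) (use assms in auto)
  then show ?thesis by (rule DERIV_unique) auto
qed

text \<open>The weight W solves (1 - t^2) W' + 2 N t W = 0, and this is the j-th derivative of that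
  equation. It yields both the Jacobi equation and the values at 0.\<close>

lemma weight_deriv_rec:
  assumes "t \<in> {-1<..<1}"
  shows "(1 - t^2) * weight_deriv N (Suc j) t + (2 * N - 2 * real j) * t * weight_deriv N j t
     + real j * (2 * N + 1 - real j) * weight_deriv N (j - 1) t = 0"
  using assms
proof (induction j arbitrary: t)
  case 0
  have "((\<lambda>t. (1 - t) powr N * (1 + t) powr N) has_real_derivative
     (- N * (1 - t) powr (N - 1)) * (1 + t) powr N + (1 - t) powr N * (N * (1 + t) powr (N - 1))) (at t)"
    using 0 by (auto intro!: derivative_eq_intros simp: algebra_simps)
  moreover have "((\<lambda>t. (1 - t) powr N * (1 + t) powr N) has_real_derivative weight_deriv N 1 t) (at t)"
    using weight_deriv_deriv[OF 0, of N 0] by (simp add: weight_deriv_0[abs_def])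
  ultimately have "weight_deriv N 1 t = (- N * (1 - t) powr (N - 1)) * (1 + t) powr N + (1 - t) powr N * (N * (1 + t) powr (N - 1))"
    by (rule DERIV_unique[rotated])
  moreover have "(1 - t) powr N = (1 - t) powr (N - 1) * (1 - t)" "(1 + t) powr N = (1 + t) powr (N - 1) * (1 + t)"
    using 0 by (auto simp: powr_diff)
  ultimately have "weight_deriv N 1 t * (1 - t^2) = - 2 * N * t * ((1 - t) powr N * (1 + t) powr N)"
    by (simp only:) (simp add: algebra_simps power2_eq_square)
  then have "(1 - t^2) * weight_deriv N 1 t = - 2 * N * t * ((1 - t) powr N * (1 + t) powr N)"
    by (simp add: mult.commute)
  then show ?case by (simp add: weight_deriv_0 algebra_simps)
next
  case (Suc j)
  \<comment> \<open>For \<open>j = 0\<close> truncated subtraction gives \<open>j - 1 = 0\<close>,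
    but then the coefficient \<open>real j\<close> removes the term.\<close>
  have pre: "(weight_deriv N (j - 1) has_real_derivative weight_deriv N j t) (at t) \<or> j = 0"
    using weight_deriv_deriv[OF Suc.prems, of N "j - 1"] by (cases j) auto
  have c: "((\<lambda>t. real j * (2 * N + 1 - real j) * weight_deriv N (j - 1) t) has_real_derivative
       real j * (2 * N + 1 - real j) * weight_deriv N j t) (at t)"
    using pre by (cases "j = 0") (auto intro!: DERIV_cmult)
  note d = weight_deriv_deriv[OF Suc.prems]
  have "((\<lambda>t. (1 - t^2) * weight_deriv N (Suc j) t + (2 * N - 2 * real j) * t * weight_deriv N j t
     + real j * (2 * N + 1 - real j) * weight_deriv N (j - 1) t) has_real_derivative
     ((1 - t^2) * weight_deriv N (Suc (Suc j)) t - 2 * t * weight_deriv N (Suc j) t)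
      + ((2 * N - 2 * real j) * (weight_deriv N j t + t * weight_deriv N (Suc j) t))
      + real j * (2 * N + 1 - real j) * weight_deriv N j t) (at t)"
    by (rule derivative_eq_intros d c refl)+ (simp add: algebra_simps)
  from DERIV_of_zero[OF _ Suc.prems this] Suc.IH
  have "((1 - t^2) * weight_deriv N (Suc (Suc j)) t - 2 * t * weight_deriv N (Suc j) t)
      + ((2 * N - 2 * real j) * (weight_deriv N j t + t * weight_deriv N (Suc j) t))
      + real j * (2 * N + 1 - real j) * weight_deriv N j t = 0" by blast
  then show ?case by (simp add: algebra_simps)
qed

lemma weight_deriv_at_0:
  assumes "real p < N + 1"
  shows "weight_deriv N (2 * p) 0 = (-1) ^ p * (fact (2 * p) / fact p) * (Gamma (N + 1) / Gamma (N - real p + 1))"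
  using assms
proof (induction p)
  case 0
  then have "Gamma (N + 1) \<noteq> 0" using Gamma_real_nonzero[of "N + 1"] by simp
  then show ?case by (simp add: weight_deriv_0)
next
  case (Suc p)
  have r: "weight_deriv N (Suc (Suc (2 * p))) 0 = - (2 * real p + 1) * (2 * (N - real p)) * weight_deriv N (2 * p) 0"
    using weight_deriv_rec[of 0 N "Suc (2 * p)"] by (simp add: algebra_simps)
  have N: "0 < N - real p" using Suc.prems by simp
  then have G: "Gamma (N - real p + 1) = (N - real p) * Gamma (N - real p)"
    by (intro Gamma_plus1) (auto elim!: nonpos_Ints_cases')
  have f: "fact (2 * Suc p) / fact (Suc p) = 2 * (2 * real p + 1) * (fact (2 * p) / fact p)"
  proof -
    have "(fact (2 * Suc p) :: real) = 2 * (real p + 1) * (2 * real p + 1) * fact (2 * p)"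
      by (simp add: algebra_simps)
    moreover have "(fact (Suc p) :: real) = (real p + 1) * fact p" by (simp add: algebra_simps)
    moreover have "real p + 1 \<noteq> 0" by linarith
    ultimately show ?thesis by (simp only: mult.assoc) (simp add: divide_simps)
  qed
  have "weight_deriv N (2 * Suc p) 0 = - (2 * real p + 1) * (2 * (N - real p)) *
     ((-1) ^ p * (fact (2 * p) / fact p) * (Gamma (N + 1) / ((N - real p) * Gamma (N - real p))))"
    using r Suc G by simp
  also have "\<dots> = (-1) ^ Suc p * (2 * (2 * real p + 1) * (fact (2 * p) / fact p)) * (Gamma (N + 1) / Gamma (N - real p))"
  proof -
    have "- a * (2 * x) * (e * f * (g / (x * h))) = (- 1 * e) * (2 * a * f) * (g / h)" if "x \<noteq> 0" for a x e f g h :: real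
      using that by simp
    from this[of "N - real p" "2 * real p + 1" "(-1) ^ p" "fact (2 * p) / fact p" "Gamma (N + 1)" "Gamma (N - real p)"] N
    show ?thesis by (simp only: power_Suc)
  qed
  also have "\<dots> = (-1) ^ Suc p * (fact (2 * Suc p) / fact (Suc p)) * (Gamma (N + 1) / Gamma (N - real (Suc p) + 1))"
    unfolding f by simp
  finally show ?case .
qed

lemma weight_deriv_odd_at_0: "weight_deriv N (Suc (2 * p)) 0 = 0"
proof (induction p)
  case 0
  then show ?case using weight_deriv_rec[of 0 N 0] by simp
next
  case (Suc p)
  then show ?case using weight_deriv_rec[of 0 N "Suc (Suc (2 * p))"] by simp
qed

section \<open>Jacobi polynomials with equal indices: equation and data at the equator\<close>

context
  fixes m :: real and n :: nat and P :: "real poly" and K :: real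
  defines "P \<equiv> jacobi_poly n m m" and "K \<equiv> (-1) ^ n / (2 ^ n * fact n)"
begin

lemma jp_wtd:
  assumes "t \<in> {-1<..<1}"
  shows "K * weight_deriv (m + real n) n t = weight_deriv m 0 t * poly P t"
proof -
  have "poly P t = K * (1 - t) powr (-m) * (1 + t) powr (-m) * weight_deriv (m + real n) n t"
    unfolding P_def poly_jacobi_poly[OF assms] rodrigues_def K_def weight_deriv_def by simp
  then show ?thesis using assms by (simp add: weight_deriv_0 powr_minus field_simps)
qed

lemma jp_wtd1:
  assumes t: "t \<in> {-1<..<1}"
  shows "K * weight_deriv (m + real n) (Suc n) t = weight_deriv m 0 t * (poly (pderiv P) t - 2 * m * t / (1 - t^2) * poly P t)"
proof -
  have nz: "1 - t^2 \<noteq> 0" using t by (auto simp: power2_eq_1_iff)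
  have w1: "weight_deriv m 1 t = - 2 * m * t / (1 - t^2) * weight_deriv m 0 t"
    using weight_deriv_rec[OF t, of m 0] nz by (simp add: field_simps)
  have "((\<lambda>t. K * weight_deriv (m + real n) n t) has_real_derivative weight_deriv m 1 t * poly P t + weight_deriv m 0 t * poly (pderiv P) t) (at t)"
  proof (rule has_field_derivative_transform_within_open[of _ _ _ "{-1<..<1}"])
    show "((\<lambda>t. weight_deriv m 0 t * poly P t) has_real_derivative weight_deriv m 1 t * poly P t + weight_deriv m 0 t * poly (pderiv P) t) (at t)"
      using DERIV_mult[OF weight_deriv_deriv[OF t, of m 0] poly_DERIV[of P t]] by (simp add: algebra_simps)
  qed (use t jp_wtd in auto)
  moreover have "((\<lambda>t. K * weight_deriv (m + real n) n t) has_real_derivative K * weight_deriv (m + real n) (Suc n) t) (at t)"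
    by (intro DERIV_cmult weight_deriv_deriv t)
  ultimately have "K * weight_deriv (m + real n) (Suc n) t = weight_deriv m 1 t * poly P t + weight_deriv m 0 t * poly (pderiv P) t"
    by (rule DERIV_unique[rotated])
  then show ?thesis unfolding w1 by (simp add: algebra_simps)
qed

lemma jp_wtd2:
  assumes t: "t \<in> {-1<..<1}"
  defines "a \<equiv> m * t / (1 - t^2)" and "b \<equiv> 2 * m * (1 + t^2) / (1 - t^2)^2"
  shows "K * weight_deriv (m + real n) (Suc (Suc n)) t = weight_deriv m 0 t * (poly (pderiv (pderiv P)) t - 4 * a * poly (pderiv P) t
    + (4 * a^2 - b) * poly P t)"
proof -
  have nz: "1 - t^2 \<noteq> 0" using t by (auto simp: power2_eq_1_iff)
  have w1: "weight_deriv m 1 t = - 2 * a * weight_deriv m 0 t"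
    using weight_deriv_rec[OF t, of m 0] nz by (simp add: field_simps a_def)
  define G where "G t = poly (pderiv P) t - 2 * m * t / (1 - t^2) * poly P t" for t
  define G' where "G' = poly (pderiv (pderiv P)) t - (b * poly P t + poly (pderiv P) t * (2 * m * t / (1 - t^2)))"
  have dA: "((\<lambda>t. 2 * m * t / (1 - t^2)) has_real_derivative b) (at t)"
    unfolding b_def using nz
    by (auto intro!: derivative_eq_intros simp: field_simps power2_eq_square)
  have dG: "(G has_real_derivative G') (at t)"
    unfolding G_def G'_def by (rule DERIV_diff[OF poly_DERIV DERIV_mult[OF dA poly_DERIV]])
  have "((\<lambda>t. K * weight_deriv (m + real n) (Suc n) t) has_real_derivative weight_deriv m 1 t * G t + weight_deriv m 0 t * G') (at t)"
  proof (rule has_field_derivative_transform_within_open[of _ _ _ "{-1<..<1}"])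
    show "((\<lambda>t. weight_deriv m 0 t * G t) has_real_derivative weight_deriv m 1 t * G t + weight_deriv m 0 t * G') (at t)"
      using DERIV_mult[OF weight_deriv_deriv[OF t, of m 0] dG] by (simp add: algebra_simps)
  qed (use t jp_wtd1 in \<open>auto simp: G_def\<close>)
  moreover have "((\<lambda>t. K * weight_deriv (m + real n) (Suc n) t) has_real_derivative K * weight_deriv (m + real n) (Suc (Suc n)) t) (at t)"
    by (intro DERIV_cmult weight_deriv_deriv t)
  ultimately have "K * weight_deriv (m + real n) (Suc (Suc n)) t = weight_deriv m 1 t * G t + weight_deriv m 0 t * G'"
    by (rule DERIV_unique[rotated])
  also have "\<dots> = weight_deriv m 0 t * (G' - 2 * a * G t)" unfolding w1 by (simp add: algebra_simps)
  also have "2 * m * t / (1 - t^2) = 2 * a" by (simp add: a_def)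
  then have "G' - 2 * a * G t = poly (pderiv (pderiv P)) t - 4 * a * poly (pderiv P) t + (4 * a^2 - b) * poly P t"
    unfolding G_def G'_def by (simp add: algebra_simps power2_eq_square)
  finally show ?thesis .
qed

text \<open>For the exponent \<open>m + n\<close>, the recurrence at index \<open>Suc n\<close> is a
  second-order equation for the n-th derivative of the weight; dividing out (1 - t^2)^m turns it
  into the equation for \<open>P\<close>.\<close>

lemma jacobi_ode:
  assumes t: "t \<in> {-1<..<1}"
  shows "(1 - t^2) * poly (pderiv (pderiv P)) t - (2 * m + 2) * t * poly (pderiv P) t
    + real n * (real n + 2 * m + 1) * poly P t = 0"
proof -
  define u where "u = 1 - t^2"
  define a where "a = m * t / u"
  define b where "b = 2 * m * (1 + t^2) / u^2"
  have nz: "u \<noteq> 0" using t by (auto simp: power2_eq_1_iff u_def)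
  have w: "weight_deriv m 0 t \<noteq> 0" using t by (simp add: weight_deriv_0)
  have ua: "u * a = m * t" using nz by (simp add: a_def)
  have ub: "u * b = 4 * t * a + 2 * m"
  proof -
    have "u * b = 2 * m * (1 + t^2) / u" using nz by (simp add: b_def power2_eq_square)
    also have "1 + t^2 = u + 2 * t^2" by (simp add: u_def)
    also have "2 * m * (u + 2 * t^2) / u = 2 * m + 4 * t * a"
      using nz by (simp add: a_def field_simps power2_eq_square)
    finally show ?thesis by simp
  qed
  have ta: "2 * m * t / (1 - t^2) = 2 * a" by (simp add: a_def u_def)
  have "K * ((1 - t^2) * weight_deriv (m + real n) (Suc (Suc n)) t + (2 * (m + real n) - 2 * real (Suc n)) * t * weight_deriv (m + real n) (Suc n) t
     + real (Suc n) * (2 * (m + real n) + 1 - real (Suc n)) * weight_deriv (m + real n) n t) = 0"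
    using weight_deriv_rec[OF t, of "m + real n" "Suc n"] by simp
  then have "u * (K * weight_deriv (m + real n) (Suc (Suc n)) t) + (2 * m - 2) * t * (K * weight_deriv (m + real n) (Suc n) t)
     + (real n + 1) * (2 * m + real n) * (K * weight_deriv (m + real n) n t) = 0"
    by (simp add: algebra_simps u_def)
  then have "weight_deriv m 0 t * (u * (poly (pderiv (pderiv P)) t - 4 * a * poly (pderiv P) t
    + (4 * a^2 - b) * poly P t) + (2 * m - 2) * t * (poly (pderiv P) t - 2 * a * poly P t)
     + (real n + 1) * (2 * m + real n) * poly P t) = 0"
    unfolding jp_wtd[OF t] jp_wtd1[OF t] jp_wtd2[OF t] ta a_def[symmetric, unfolded u_def] b_def[symmetric, unfolded u_def]
    by (simp add: algebra_simps u_def a_def b_def)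
  then have e: "u * (poly (pderiv (pderiv P)) t - 4 * a * poly (pderiv P) t
    + (4 * a^2 - b) * poly P t) + (2 * m - 2) * t * (poly (pderiv P) t - 2 * a * poly P t)
     + (real n + 1) * (2 * m + real n) * poly P t = 0" using w by simp
  have "u * (poly (pderiv (pderiv P)) t - 4 * a * poly (pderiv P) t
    + (4 * a^2 - b) * poly P t) + (2 * m - 2) * t * (poly (pderiv P) t - 2 * a * poly P t)
     + (real n + 1) * (2 * m + real n) * poly P t
    = u * poly (pderiv (pderiv P)) t + ((2 * m - 2) * t - 4 * (u * a)) * poly (pderiv P) t
     + (4 * a * (u * a) - u * b - (2 * m - 2) * 2 * t * a + (real n + 1) * (2 * m + real n)) * poly P t"
    by (simp add: algebra_simps power2_eq_square)
  also have "\<dots> = u * poly (pderiv (pderiv P)) t - (2 * m + 2) * t * poly (pderiv P) t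
    + real n * (real n + 2 * m + 1) * poly P t"
    unfolding ua ub by (simp add: algebra_simps)
  finally show ?thesis using e by (simp add: u_def)
qed

lemma poly_at_0: "poly P 0 = K * weight_deriv (m + real n) n 0" "poly (pderiv P) 0 = K * weight_deriv (m + real n) (Suc n) 0"
  using jp_wtd[of 0] jp_wtd1[of 0] by (auto simp: weight_deriv_0)

text \<open>By parity either \<open>P\<close> or its derivative vanishes at 0, and
  \<open>c_coeff\<close> makes the square of the other one an explicit multiple of two gamma ratios.
  The outcome says that the WKB amplitude \<open>S\<close> is at most \<open>2 * l\<close>.\<close>

lemma energy_at_0:
  fixes l q0 c :: real
  defines "l \<equiv> m + real n + 1 / 2" and "q0 \<equiv> l^2 - (m^2 - 1 / 4)" and "c \<equiv> c_coeff l m"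
  assumes m: "1 / 2 \<le> m"
  shows "q0 * (c * poly P 0)^2 + (c * poly (pderiv P) 0)^2 \<le> 2 * l * sqrt q0"
proof -
  have lpos: "0 < l" using m by (simp add: l_def)
  have q0: "q0 = (real n)^2 + real n + 2 * m * real n + m + 1 / 2"
    by (simp add: q0_def l_def power2_eq_square field_simps)
  have q0_pos: "0 < q0" unfolding q0 using m by (simp add: add_nonneg_pos)
  let ?N = "m + real n"
  define g where "g = Gamma (?N + 1)"
  have GN: "0 < Gamma (?N + 1)" using m by simp
  then have g: "g \<noteq> 0" by (simp add: g_def)
  have c2: "c^2 = l * fact n * Gamma (2 * m + real n + 1) / (4 powr m * (Gamma (?N + 1))^2)"
  proof -
    have "l - m + 1 / 2 = real n + 1" by (simp add: l_def)
    then have "Gamma (l - m + 1 / 2) = fact n" using Gamma_fact[of n, where 'a = real] by (simp add: l_def add.commute)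
    moreover have "l + m + 1 / 2 = 2 * m + real n + 1" "l + 1 / 2 = ?N + 1" by (auto simp: l_def)
    moreover have "(2 powr m)^2 = 4 powr m"
      using powr_mult[of 2 2 m] by (simp add: power2_eq_square)
    moreover have "0 \<le> Gamma (2 * m + real n + 1)" using m by simp
    ultimately show ?thesis unfolding c_def c_coeff_def
      using lpos by (simp only: power_divide power_mult_distrib) simp
  qed
  have K2: "K^2 = 1 / (4 ^ n * (fact n)^2)"
    by (simp add: K_def power_divide power_mult_distrib power2_eq_square flip: power_mult_distrib)
  show ?thesis
  proof (cases "even n")
    case True
    then obtain p where p: "n = 2 * p" by (elim evenE)
    define y where "y = m + real p"
    have y: "0 < y" "l / 2 \<le> y" using m by (auto simp: y_def l_def p)
    have z: "poly (pderiv P) 0 = 0" using poly_at_0(2) weight_deriv_odd_at_0[of "m + real n" p] p by simp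
    have "(c * poly P 0)^2 = c^2 * K^2 * (weight_deriv ?N n 0)^2"
      by (simp add: poly_at_0 power_mult_distrib)
    also have "(weight_deriv ?N n 0)^2 = (fact n / fact p * (Gamma (?N + 1) / Gamma (y + 1)))^2"
      using weight_deriv_at_0[of p ?N] m by (simp add: p y_def power_mult_distrib power_divide algebra_simps minus_one_power_iff)
    also have "c^2 * K^2 * \<dots> = l * (fact n / (4 ^ p * (fact p)^2)) * (Gamma (2 * y + 1) / (4 powr y * (Gamma (y + 1))^2))"
    proof -
      have "4 powr m * 4 ^ n = 4 ^ p * (4::real) powr y"
        by (simp add: y_def powr_add powr_realpow p power_mult power2_eq_square flip: power_mult_distrib)
      moreover have "2 * m + real n + 1 = 2 * y + 1" by (simp add: y_def p)
      ultimately show ?thesis unfolding c2 K2 using GN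
        by (simp add: field_simps power2_eq_square)
    qed
    also have "\<dots> = l * gamma_ratio (real p) * gamma_ratio y"
    proof -
      have "Gamma (2 * real p + 1) = fact n" "Gamma (real p + 1) = fact p"
        using Gamma_fact[of n, where 'a = real] Gamma_fact[of p, where 'a = real] by (simp_all add: p add.commute)
      then show ?thesis by (simp add: gamma_ratio_def powr_realpow)
    qed
    finally have e: "(c * poly P 0)^2 = l * gamma_ratio (real p) * gamma_ratio y" .
    have cp: "gamma_ratio (real p) \<le> 1 / sqrt (real n + 1)"
    proof (cases "p = 0")
      case False
      then have "gamma_ratio (real p) \<le> 1 / sqrt (pi * real p)" by (intro gamma_ratio_le) auto
      also have "\<dots> \<le> 1 / sqrt (real n + 1)"
      proof -
        have "real n + 1 \<le> 3 * real p" using False p by simp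
        also have "\<dots> \<le> pi * real p" using pi_gt3 by (intro mult_right_mono) auto
        finally show ?thesis by (intro divide_left_mono) (auto simp: False)
      qed
      finally show ?thesis .
    qed (simp add: p gamma_ratio_def)
    have cy: "gamma_ratio y \<le> 1 / sqrt l"
    proof -
      have "l \<le> 2 * y" using y by simp
      also have "\<dots> \<le> pi * y" using pi_gt3 y by (intro mult_right_mono) auto
      finally have "1 / sqrt (pi * y) \<le> 1 / sqrt l" using y lpos by (intro divide_left_mono) auto
      then show ?thesis using gamma_ratio_le[OF y(1)] by linarith
    qed
    \<comment> \<open>Matches the bounds \<open>1 / sqrt (real n + 1)\<close> and
      \<open>1 / sqrt l\<close> for the two gamma ratios.\<close>
    have "q0 \<le> 2^2 * ((real n + 1) * l)"
    proof -
      have "(real n + 1) * (m + real n + 1 / 2) = m * real n + (real n)^2 + real n * 3 / 2 + m + 1 / 2"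
        by (simp add: field_simps power2_eq_square)
      moreover have "0 \<le> m * real n" using m by simp
      ultimately show ?thesis unfolding q0 l_def using m by simp
    qed
    then have sq: "sqrt q0 \<le> 2 * (sqrt (real n + 1) * sqrt l)"
      using real_sqrt_le_mono[of q0 "2^2 * ((real n + 1) * l)"] by (simp add: real_sqrt_mult)
    have "sqrt q0 * (gamma_ratio (real p) * gamma_ratio y) \<le> 2 * (sqrt (real n + 1) * sqrt l) * (1 / sqrt (real n + 1) * (1 / sqrt l))"
      using sq cp cy gamma_ratio_pos[of "real p"] gamma_ratio_pos[of y] y lpos q0_pos by (intro mult_mono) auto
    also have "\<dots> = 2" using lpos by simp
    finally have "sqrt q0 * (gamma_ratio (real p) * gamma_ratio y) * (l * sqrt q0) \<le> 2 * (l * sqrt q0)"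
      using lpos q0_pos by (intro mult_right_mono) auto
    moreover have "sqrt q0 * (gamma_ratio (real p) * gamma_ratio y) * (l * sqrt q0) = (sqrt q0 * sqrt q0) * (l * gamma_ratio (real p) * gamma_ratio y)"
      by (simp only: mult_ac)
    ultimately show ?thesis using q0_pos unfolding e z by simp
  next
    case False
    then obtain p' where p': "n = 2 * p' + 1" by (elim oddE)
    define p where "p = Suc p'"
    have p: "Suc n = 2 * p" "0 < p" by (auto simp: p' p_def)
    have np: "real n = 2 * real p - 1" using p by (metis add_diff_cancel_left' of_nat_Suc of_nat_mult of_nat_numeral)
    define y where "y = m + real p"
    have y: "0 < y" using m by (auto simp: y_def)
    have z: "poly P 0 = 0" unfolding poly_at_0 p' using weight_deriv_odd_at_0[of "m + real (2 * p' + 1)" p'] by simp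
    have "(c * poly (pderiv P) 0)^2 = c^2 * K^2 * (weight_deriv ?N (Suc n) 0)^2"
      by (simp add: poly_at_0 power_mult_distrib)
    also have "(weight_deriv ?N (Suc n) 0)^2 = (fact (2 * p) / fact p * (Gamma (?N + 1) / Gamma y))^2"
    proof -
      have "real p < ?N + 1" "?N - real p + 1 = y" using m np p by (auto simp: y_def)
      then show ?thesis using weight_deriv_at_0[of p ?N] by (simp add: p power_mult_distrib power_divide minus_one_power_iff)
    qed
    also have "fact (2 * p) = 2 * real p * fact n" unfolding p(1)[symmetric] using np by simp
    also have "c^2 * K^2 * (2 * real p * fact n / fact p * (Gamma (?N + 1) / Gamma y))^2
        = 4 * l * real p * y * (2 * real p * fact n / (4 ^ p * (fact p)^2)) * (2 * y * Gamma (2 * y) / (4 powr y * (y * Gamma y)^2))"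
    proof -
      have "4 powr m * 4 ^ n * 4 = 4 powr m * (4::real) ^ Suc n" by simp
      also have "\<dots> = 4 ^ p * (4::real) powr y" unfolding p(1)
        by (simp add: y_def powr_add powr_realpow mult_2 power_add)
      finally have "4 ^ p * (4::real) powr y = 4 powr m * 4 ^ n * 4" by simp
      moreover have "2 * m + real n + 1 = 2 * y" using np by (simp add: y_def)
      ultimately have "c^2 * K^2 * (2 * real p * fact n / fact p * (Gamma (?N + 1) / Gamma y))^2
        = 4 * l * real p * y * 2 * real p * fact n * 2 * y * Gamma (2 * y) / ((4 ^ p * 4 powr y) * ((fact p)^2 * (y * Gamma y)^2))"
        unfolding c2 K2 g_def[symmetric] using g y by (simp add: field_simps power2_eq_square)
      then show ?thesis by (simp add: mult_ac)
    qed
    also have "\<dots> = 4 * l * real p * y * gamma_ratio (real p) * gamma_ratio y"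
    proof -
      have "fact (2 * p) = 2 * real p * fact n" unfolding p(1)[symmetric] using np by simp
      then have "Gamma (2 * real p + 1) = 2 * real p * fact n" "Gamma (real p + 1) = fact p"
        using Gamma_fact[of "2 * p", where 'a = real] Gamma_fact[of p, where 'a = real] by (simp_all add: add.commute)
      moreover have "Gamma (y + 1) = y * Gamma y" "Gamma (2 * y + 1) = 2 * y * Gamma (2 * y)"
        using y by (auto intro!: Gamma_plus1 elim!: nonpos_Ints_cases')
      ultimately show ?thesis by (simp add: gamma_ratio_def powr_realpow)
    qed
    finally have e: "(c * poly (pderiv P) 0)^2 = 4 * l * real p * y * gamma_ratio (real p) * gamma_ratio y" .
    have "gamma_ratio (real p) * gamma_ratio y \<le> 1 / sqrt (pi * real p) * (1 / sqrt (pi * y))"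
      using gamma_ratio_le[of "real p"] gamma_ratio_le[OF y] gamma_ratio_pos[of y] y p by (intro mult_mono) auto
    also have "\<dots> = 1 / (pi * sqrt (real p * y))" by (simp add: real_sqrt_mult)
    finally have "4 * l * real p * y * (gamma_ratio (real p) * gamma_ratio y) \<le> 4 * l * real p * y * (1 / (pi * sqrt (real p * y)))"
      using lpos y by (intro mult_left_mono) auto
    also have "\<dots> = (4 / pi) * l * ((real p * y) / sqrt (real p * y))" by simp
    also have "\<dots> = (4 / pi) * l * sqrt (real p * y)" using y p by (simp add: real_div_sqrt)
    also have "\<dots> \<le> 2 * l * sqrt q0"
    proof (rule mult_mono)
      show "4 / pi * l \<le> 2 * l" using lpos pi_gt3 by (intro mult_right_mono) (auto simp: field_simps)
      have "real p * y \<le> q0" unfolding q0 y_def np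
      proof -
        have "real p * 1 \<le> real p * real p" "m * 1 \<le> m * real p" using m p by (auto intro!: mult_left_mono)
        then show "real p * (m + real p) \<le> (2 * real p - 1)^2 + (2 * real p - 1) + 2 * m * (2 * real p - 1) + m + 1 / 2"
        proof -
          have "(2 * real p - 1)^2 + (2 * real p - 1) + 2 * m * (2 * real p - 1) + m + 1 / 2 - real p * (m + real p)
             = 3 * (real p * real p) + 3 * (m * real p) - 2 * real p - m + 1 / 2"
            by (simp add: power2_eq_square algebra_simps)
          moreover have "0 \<le> real p" by simp
          ultimately show ?thesis using \<open>real p * 1 \<le> real p * real p\<close> \<open>m * 1 \<le> m * real p\<close> m by linarith
        qed
      qed
      then show "sqrt (real p * y) \<le> sqrt q0" by simp
    qed (use lpos y in auto)
    finally show ?thesis using e z by (simp add: mult_ac)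
  qed
qed

end

text \<open>With x = sin t, the factor cos^(m + 1/2) brings the equation to Liouville normal form.
  The condition \<open>1 / 2 < m\<close> makes \<open>M\<close> positive and lets
  \<open>v / cos\<close>, which carries cos^(m - 1/2), vanish at the pole.\<close>

lemma jacobi_potential_well:
  fixes Q :: "real poly" and n :: nat and m c l B :: real
  assumes m: "1 / 2 < m" and l: "l = m + real n + 1 / 2" and B: "l^2 \<le> B * (m^2 - 1 / 4)"
    and ode: "\<And>t. t \<in> {-1<..<1} \<Longrightarrow> (1 - t^2) * poly (pderiv (pderiv Q)) t - (2 * m + 2) * t * poly (pderiv Q) t
    + real n * (real n + 2 * m + 1) * poly Q t = 0"
  shows "potential_well (\<lambda>t. c * (cos t powr (m + 1 / 2) * poly Q (sin t)))
     (\<lambda>t. c * (- (m + 1 / 2) * cos t powr (m - 1 / 2) * sin t * poly Q (sin t) + cos t powr (m + 3 / 2) * poly (pderiv Q) (sin t)))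
     l (m^2 - 1 / 4) B"
proof
  show M: "0 < m^2 - 1 / 4"
    using power_strict_mono[of "1 / 2" m 2] m by (simp add: power2_eq_square)
  show "1 \<le> l" using m l by simp
  show "l^2 \<le> B * (m^2 - 1 / 4)" by (rule B)
  have "l^2 - (m^2 - 1 / 4) - l / 2 = real n * (real n + 1 / 2 + 2 * m) + m / 2 + 1 / 4"
    unfolding l by (simp add: power2_eq_square field_simps)
  also have "\<dots> \<ge> 0" using m by simp
  finally show "l / 2 \<le> l^2 - (m^2 - 1 / 4)" by simp
next
  fix t :: real assume t: "0 \<le> t" "t < pi / 2"
  have cp: "0 < cos t" using t by (intro cos_gt_zero_pi) auto
  define E where "E = cos t powr (m - 3 / 2)"
  have pw: "cos t powr (m - 1 / 2) = E * cos t" "cos t powr (m + 1 / 2) = E * (cos t)^2"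
    "cos t powr (m + 3 / 2) = E * (cos t)^3"
    using powr_add[of "cos t" "m - 3 / 2" 1] powr_add[of "cos t" "m - 3 / 2" 2]
      powr_add[of "cos t" "m - 3 / 2" 3] cp by (simp_all add: E_def add.commute[of m])
  have ev: "cos t powr (m + 1 / 2 - 1) = E * cos t" "cos t powr (m - 1 / 2 - 1) = E"
    "cos t powr (m + 3 / 2 - 1) = E * (cos t)^2"
    using pw by (simp_all add: E_def add.commute[of m])
  have s2: "(sin t)^2 = 1 - (cos t)^2" by (simp add: sin_squared_eq)
  let ?P = "poly Q (sin t)" let ?P1 = "poly (pderiv Q) (sin t)" let ?P2 = "poly (pderiv (pderiv Q)) (sin t)"
  have dpw: "((\<lambda>t. cos t powr a) has_real_derivative - a * cos t powr (a - 1) * sin t) (at t)" for a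
    using cp by (auto intro!: derivative_eq_intros)
  have dQ: "((\<lambda>t. poly R (sin t)) has_real_derivative poly (pderiv R) (sin t) * cos t) (at t)" for R
    by (auto intro!: derivative_eq_intros)
  show "((\<lambda>t. c * (cos t powr (m + 1 / 2) * poly Q (sin t))) has_real_derivative
     c * (- (m + 1 / 2) * cos t powr (m - 1 / 2) * sin t * ?P + cos t powr (m + 3 / 2) * ?P1)) (at t)"
    by (rule DERIV_cong, (rule dpw dQ DERIV_sin DERIV_const DERIV_cmult DERIV_add DERIV_mult)+)
      (simp add: ev pw algebra_simps power2_eq_square power3_eq_cube)
  have "((\<lambda>t. c * (- (m + 1 / 2) * cos t powr (m - 1 / 2) * sin t * poly Q (sin t) + cos t powr (m + 3 / 2) * poly (pderiv Q) (sin t)))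
     has_real_derivative c * E * ((m + 1 / 2) * (m - 1 / 2) * (sin t)^2 * ?P - (m + 1 / 2) * (cos t)^2 * ?P
        + (cos t)^2 * ((cos t)^2 * ?P2 - (2 * m + 2) * sin t * ?P1))) (at t)"
    by (rule DERIV_cong, (rule dpw dQ DERIV_sin DERIV_const DERIV_cmult DERIV_add DERIV_mult)+)
      (simp only: ev pw, simp add: field_simps power2_eq_square power3_eq_cube)
  moreover have "(cos t)^2 * ?P2 - (2 * m + 2) * sin t * ?P1 = - (real n * (real n + 2 * m + 1) * ?P)"
  proof -
    have "(sin t)^2 < 1" using cp s2 by simp
    then have "sin t \<in> {-1<..<1}" using abs_square_less_1[of "sin t"] by auto
    from ode[OF this] show ?thesis using cos_squared_eq[of t] by simp
  qed
  moreover have "c * E * ((m + 1 / 2) * (m - 1 / 2) * (sin t)^2 * ?P - (m + 1 / 2) * (cos t)^2 * ?P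
        + (cos t)^2 * (- (real n * (real n + 2 * m + 1) * ?P)))
     = - (l^2 - (m^2 - 1 / 4) * (1 + (tan t)^2)) * (c * (cos t powr (m + 1 / 2) * ?P))"
  proof -
    have "(cos t)^2 * (1 + (tan t)^2) = 1" using cp by (simp add: tan_sec power_inverse)
    then have e: "(m^2 - 1 / 4) * ((cos t)^2 * (1 + (tan t)^2)) = m^2 - 1 / 4" by simp
    have "- (l^2 - (m^2 - 1 / 4) * (1 + (tan t)^2)) * (c * (cos t powr (m + 1 / 2) * ?P))
       = c * E * ?P * ((m^2 - 1 / 4) * ((cos t)^2 * (1 + (tan t)^2)) - l^2 * (cos t)^2)"
      unfolding pw by (simp add: algebra_simps)
    also have "\<dots> = c * E * ?P * ((m^2 - 1 / 4) - l^2 * (cos t)^2)" unfolding e ..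
    also have "\<dots> = c * E * ((m + 1 / 2) * (m - 1 / 2) * (sin t)^2 * ?P - (m + 1 / 2) * (cos t)^2 * ?P
        + (cos t)^2 * (- (real n * (real n + 2 * m + 1) * ?P)))"
      unfolding l s2 by (simp add: power2_eq_square field_simps)
    finally show ?thesis by (rule sym)
  qed
  ultimately show "((\<lambda>t. c * (- (m + 1 / 2) * cos t powr (m - 1 / 2) * sin t * poly Q (sin t) + cos t powr (m + 3 / 2) * poly (pderiv Q) (sin t)))
     has_real_derivative - (l^2 - (m^2 - 1 / 4) * (1 + (tan t)^2)) * (c * (cos t powr (m + 1 / 2) * ?P))) (at t)"
    by (simp only:)
next
  have ev: "eventually (\<lambda>t. t \<in> {0<..<pi / 2}) (at_left (pi / 2))"
    by (rule eventually_at_left_real) simp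
  then have evc: "eventually (\<lambda>t. 0 \<le> cos t) (at_left (pi / 2))"
    by eventually_elim (auto intro!: cos_ge_zero)
  have c0: "(cos \<longlongrightarrow> 0) (at_left (pi / 2))"
    using tendsto_cos[of "\<lambda>t. t" "pi / 2" "at_left (pi / 2)"] tendsto_ident_at by auto
  have pw: "((\<lambda>t. cos t powr a) \<longlongrightarrow> 0) (at_left (pi / 2))" if "0 < a" for a
    using tendsto_powr'[OF c0 tendsto_const, of a] that evc by simp
  have Q0: "((\<lambda>t. poly R (sin t)) \<longlongrightarrow> poly R (sin (pi / 2))) (at_left (pi / 2))" for R :: "real poly"
    by (intro tendsto_intros)
  have s0: "(sin \<longlongrightarrow> sin (pi / 2)) (at_left (pi / 2))" by (intro tendsto_intros)
  have "((\<lambda>t. c * (cos t powr (m - 1 / 2) * poly Q (sin t))) \<longlongrightarrow> c * (0 * poly Q (sin (pi / 2)))) (at_left (pi / 2))"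
    using m by (intro tendsto_mult tendsto_const pw Q0) auto
  then have "((\<lambda>t. c * (cos t powr (m - 1 / 2) * poly Q (sin t))) \<longlongrightarrow> 0) (at_left (pi / 2))" by simp
  then show "((\<lambda>t. c * (cos t powr (m + 1 / 2) * poly Q (sin t)) / cos t) \<longlongrightarrow> 0) (at_left (pi / 2))"
  proof (rule Lim_transform_eventually)
    show "eventually (\<lambda>t. c * (cos t powr (m - 1 / 2) * poly Q (sin t)) = c * (cos t powr (m + 1 / 2) * poly Q (sin t)) / cos t) (at_left (pi / 2))"
      using ev
    proof eventually_elim
      case (elim t)
      then have "0 < cos t" by (intro cos_gt_zero_pi) auto
      then have "cos t powr (m + 1 / 2) = cos t powr (m - 1 / 2) * cos t"
        using powr_add[of "cos t" "m - 1 / 2" 1] by (simp add: add.commute[of m])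
      then show ?case using \<open>0 < cos t\<close> by simp
    qed
  qed
  have "((\<lambda>t. c * (- (m + 1 / 2) * cos t powr (m - 1 / 2) * sin t * poly Q (sin t) + cos t powr (m + 3 / 2) * poly (pderiv Q) (sin t)))
     \<longlongrightarrow> c * (- (m + 1 / 2) * 0 * sin (pi / 2) * poly Q (sin (pi / 2)) + 0 * poly (pderiv Q) (sin (pi / 2)))) (at_left (pi / 2))"
    using m by (intro tendsto_mult tendsto_add tendsto_const pw Q0 s0) auto
  then show "((\<lambda>t. c * (- (m + 1 / 2) * cos t powr (m - 1 / 2) * sin t * poly Q (sin t) + cos t powr (m + 3 / 2) * poly (pderiv Q) (sin t)))
     \<longlongrightarrow> 0) (at_left (pi / 2))" by simp
qed


subsection \<open>Pointwise bounds\<close>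

text \<open>Up to 1/4, the quantity \<open>l^2 * (1 - x^2) - m^2\<close> is cos^2 times the
  potential of the well. The turning point is near x^2 = (l^2 - m^2) / l^2, so the last factor
  expresses decay of order \<open>K\<close> past it.\<close>

definition X_bound :: "nat \<Rightarrow> real \<Rightarrow> real \<Rightarrow> real \<Rightarrow> real" where
  "X_bound K l m x = l / (sqrt (l + \<bar>l^2 * (1 - x^2) - m^2\<bar>) * (1 + l^2 * x^2 / (l^2 - m\<^sup>2)) ^ K)"

lemma power_le_exp:
  fixes a y :: real
  assumes "0 < a" "a \<le> 1" "1 \<le> y"
  shows "y ^ Suc K \<le> (real (Suc K) / a) ^ Suc K * exp (a * (y - 1))"
proof -
  define j where "j = real (Suc K)"
  have j: "1 \<le> j" by (simp add: j_def)
  have "a / j \<le> 1" using assms j by (simp add: divide_le_eq)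
  have "a * y / j = a * (y - 1) / j + a / j" by (simp add: right_diff_distrib diff_divide_distrib)
  also have "\<dots> \<le> 1 + a * (y - 1) / j" using \<open>a / j \<le> 1\<close> by simp
  also have "\<dots> \<le> exp (a * (y - 1) / j)" by (rule exp_ge_add_one_self)
  finally have "(a * y / j) ^ Suc K \<le> exp (a * (y - 1) / j) ^ Suc K"
    using assms j by (intro power_mono) auto
  also have "\<dots> = exp (a * (y - 1))"
    using j by (simp only: exp_of_nat_mult[symmetric]) (simp add: j_def)
  finally have "(j / a) ^ Suc K * (a * y / j) ^ Suc K \<le> (j / a) ^ Suc K * exp (a * (y - 1))"
    using assms j by (intro mult_left_mono) auto
  moreover have "(j / a) ^ Suc K * (a * y / j) ^ Suc K = y ^ Suc K"
    using assms j by (simp only: power_mult_distrib[symmetric]) simp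
  ultimately show ?thesis by (simp add: j_def)
qed

text \<open>The 8 combines the 4 of the well bounds with \<open>S \<le> 2 * l\<close>;
  \<open>4 * B\<close> bounds 1 / cos, and thus the cost of the weight, up to the start of the fast
  decay. \<open>Cn\<close> and \<open>Cf\<close> then serve the near and the far range.\<close>

definition Ca :: "real \<Rightarrow> nat \<Rightarrow> real" where
  "Ca B r = 8 * (2 * 10 ^ 6 * B ^ 5) * (4 * B) ^ (r - 1)"

definition Cn :: "real \<Rightarrow> nat \<Rightarrow> nat \<Rightarrow> real" where
  "Cn B r K = Ca B r * (1 + 8 * B) ^ K"

definition Cf :: "real \<Rightarrow> nat \<Rightarrow> nat \<Rightarrow> real" where
  "Cf B r K = Ca B r * (4 * B * real (Suc K)) ^ Suc K * (9 * B) ^ K * (11 * B)"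

context
  fixes m c l B :: real and Q :: "real poly" and n r K :: nat
  assumes m: "1 \<le> m" and l: "l = m + real n + 1 / 2" and B: "l^2 \<le> B * (m^2 - 1 / 4)"
    and r: "1 \<le> r" and mr: "(real r - 1) + sqrt (m^2 - 1 / 4) \<le> sqrt (2 * (m^2 - 1 / 4))"
    and ode: "\<And>t. t \<in> {-1<..<1} \<Longrightarrow> (1 - t^2) * poly (pderiv (pderiv Q)) t - (2 * m + 2) * t * poly (pderiv Q) t
    + real n * (real n + 2 * m + 1) * poly Q t = 0"
    and energy: "(l^2 - (m^2 - 1 / 4)) * (c * poly Q 0)^2 + (c * poly (pderiv Q) 0)^2 \<le> 2 * l * sqrt (l^2 - (m^2 - 1 / 4))"
begin

text \<open>The well bounds are multiplied by cos^(-(r - 1)). Near the well this power is bounded.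
  In the far range assumption \<open>mr\<close> pays for it out of the decay exponent
  \<open>sqrt (2 * M)\<close> and leaves \<open>sqrt M\<close>, which is still enough for any fixed
  power.\<close>

lemma polar_bound:
  assumes x: "0 \<le> x" "x < 1"
  shows "(c * ((1 - x\<^sup>2) powr (m / 2 - (real r - 2) / 4) * poly Q x))^2 \<le> (Cn B r K + Cf B r K) * X_bound K l m x"
proof -
  define M where "M = m^2 - 1 / 4"
  define v where "v = (\<lambda>t. c * (cos t powr (m + 1 / 2) * poly Q (sin t)))"
  define p where "p = (\<lambda>t. c * (- (m + 1 / 2) * cos t powr (m - 1 / 2) * sin t * poly Q (sin t) + cos t powr (m + 3 / 2) * poly (pderiv Q) (sin t)))"
  interpret W: potential_well v p l M B
    unfolding v_def p_def M_def by (rule jacobi_potential_well) (use m l B ode in auto)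
  define t where "t = arcsin x"
  have t: "0 \<le> t" "t < pi / 2" "sin t = x"
    using x arcsin_lt_bounded[of x] by (auto simp: t_def arcsin_nonneg)
  define k where "k = cos t"
  have k: "0 < k" "k \<le> 1" "k^2 = 1 - x^2" using W.cos_pos[OF t(1,2)] t by (auto simp: k_def cos_squared_eq)
  define q0 where "q0 = l^2 - M"
  have q0: "0 < q0" "l / 2 \<le> q0" "W.q0 = q0" using W.q0_pos W.q0_ge by (auto simp: q0_def W.q0_def)
  have l1: "1 \<le> l" by (rule W.l_ge)
  have B1: "1 \<le> B" by (rule W.B_ge)
  have Mp: "0 < M" by (rule W.M_pos)
  have lM: "l^2 \<le> B * M" by (rule W.l_M)
  define lam where "lam = l^2 - m^2"
  have lam: "1 / 2 \<le> lam" "q0 = lam + 1 / 4" "q0 \<le> 2 * lam"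
  proof -
    have "lam = (real n + 1 / 2) * (2 * m + real n + 1 / 2)"
      by (simp add: lam_def l power2_eq_square field_simps)
    also have "\<dots> \<ge> 1 / 2 * 1" using m by (intro mult_mono) auto
    finally show a: "1 / 2 \<le> lam" by simp
    show b: "q0 = lam + 1 / 4" by (simp add: q0_def M_def lam_def)
    show "q0 \<le> 2 * lam" using a b by simp
  qed
  have tan: "(tan t)^2 = x^2 / k^2" by (simp add: tan_def k_def t power_divide)
  have ktan: "k^2 * (1 + (tan t)^2) = 1" using k by (simp add: tan field_simps)
  have lhs: "(c * ((1 - x\<^sup>2) powr (m / 2 - (real r - 2) / 4) * poly Q x))^2 = (v t)^2 * (1 / k) ^ (r - 1)"
  proof -
    have "k\<^sup>2 powr (m / 2 - (real r - 2) / 4) = k powr (m - (real r - 2) / 2)"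
    proof -
      have "2 * (m / 2 - (real r - 2) / 4) = m - (real r - 2) / 2" by (simp add: field_simps)
      moreover have "k^2 = k powr 2" using k(1) by simp
      ultimately show ?thesis by (simp only: powr_powr)
    qed
    then have "((1 - x\<^sup>2) powr (m / 2 - (real r - 2) / 4))^2 = k powr (2 * m - (real r - 2))"
    proof -
      assume a: "k\<^sup>2 powr (m / 2 - (real r - 2) / 4) = k powr (m - (real r - 2) / 2)"
      have "(m - (real r - 2) / 2) + (m - (real r - 2) / 2) = 2 * m - (real r - 2)" by (simp add: field_simps)
      then show ?thesis unfolding k(3)[symmetric] a by (simp only: power2_eq_square powr_add[symmetric])
    qed
    also have "\<dots> = k powr (2 * m + 1) * k powr (- real (r - 1))"
      using r by (simp add: powr_add[symmetric] of_nat_diff algebra_simps)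
    also have "k powr (- real (r - 1)) = (1 / k) ^ (r - 1)"
      using k(1) by (simp add: powr_minus powr_realpow power_one_over inverse_eq_divide)
    also have "k powr (2 * m + 1) = (k powr (m + 1 / 2))^2"
      using k(1) by (simp add: power2_eq_square powr_add[symmetric])
    finally show ?thesis by (simp add: v_def t(3) k_def power_mult_distrib)
  qed
  have S: "W.S \<le> 2 * l"
  proof -
    have v0: "v 0 = c * poly Q 0" "p 0 = c * poly (pderiv Q) 0" by (simp_all add: v_def p_def)
    have "W.energy 0 = q0 * (c * poly Q 0)^2 + (c * poly (pderiv Q) 0)^2"
      by (simp add: W.energy_def W.q_def v0 q0_def)
    also have "\<dots> \<le> 2 * l * sqrt q0" using energy by (simp add: q0_def M_def)
    finally show ?thesis using q0 by (simp add: W.S_def field_simps)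
  qed
  have C1: "0 \<le> W.C1" using W.C1_ge by simp
  have C1': "W.C1 = 2 * 10 ^ 6 * B ^ 5" by (simp add: W.C1_def)
  define s where "s = sqrt (1 + 4 * q0 / M)"
  have s2: "s^2 = 1 + 4 * q0 / M" using q0 Mp by (simp add: s_def)
  have s1: "1 \<le> s" using q0 Mp by (simp add: s_def)
  have sB: "s \<le> 4 * B"
  proof -
    have "M + 4 * q0 \<le> 4 * l^2" using Mp by (simp add: q0_def)
    also have "\<dots> \<le> 4 * B * M" using lM by simp
    finally have "s^2 \<le> 4 * B" unfolding s2 using Mp by (simp add: field_simps)
    moreover have "s * 1 \<le> s * s" using s1 by (intro mult_left_mono) auto
    ultimately show ?thesis by (simp add: power2_eq_square)
  qed
  define g where "g = l^2 * (1 - x^2) - m^2"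
  define Y where "Y = 1 + l^2 * x^2 / lam"
  have X_bound: "X_bound K l m x = l / (sqrt (l + \<bar>g\<bar>) * Y ^ K)"
    by (simp add: X_bound_def g_def Y_def lam_def)
  have Y1: "1 \<le> Y" using lam by (simp add: Y_def)
  have lg: "0 < l + \<bar>g\<bar>" using l1 by simp
  have Ca0: "0 \<le> Ca B r" using B1 by (simp add: Ca_def)
  have bnd0: "0 \<le> X_bound K l m x" using l1 Y1 by (simp add: X_bound)
  show ?thesis
  proof (cases "M * (tan t)^2 \<le> 4 * q0")
    case True
    have "1 / k \<le> s"
    proof (rule power2_le_imp_le)
      have "(1 / k)^2 = k^2 * (1 + (tan t)^2) / k^2" unfolding ktan by (simp add: power_divide)
      also have "\<dots> = 1 + (tan t)^2" using k(1) by simp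
      also have "\<dots> \<le> 1 + 4 * q0 / M" using True Mp by (simp add: field_simps)
      finally show "(1 / k)^2 \<le> s^2" by (simp add: s2)
    qed (use s1 in auto)
    then have kr: "(1 / k) ^ (r - 1) \<le> (4 * B) ^ (r - 1)"
      using sB k by (intro power_mono) auto
    \<comment> \<open>The 1/4 is the difference of m^2 and \<open>M\<close>; the shift
      \<open>W.A\<close> has room for it next to \<open>l\<close>.\<close>
    have "\<bar>g\<bar> \<le> \<bar>W.q t\<bar> + 1 / 4"
    proof -
      have "k^2 * W.q t = l^2 * k^2 - M * (k^2 * (1 + (tan t)^2))"
        unfolding W.q_def by (simp add: algebra_simps)
      then have "k^2 * W.q t = l^2 * k^2 - M" unfolding ktan by simp
      then have "g = k^2 * W.q t - 1 / 4" unfolding g_def k(3)[symmetric] by (simp add: M_def)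
      moreover have "k^2 * \<bar>W.q t\<bar> \<le> 1 * \<bar>W.q t\<bar>" using k by (intro mult_right_mono) (auto simp: power_le_one)
      moreover have "\<bar>k^2 * W.q t\<bar> = k^2 * \<bar>W.q t\<bar>" by (simp add: abs_mult)
      ultimately show ?thesis by linarith
    qed
    moreover have "l + 1 / 4 \<le> W.A"
    proof -
      have "12 * 1 * l \<le> 12 * B * l" using B1 l1 by (intro mult_right_mono) auto
      then show ?thesis using W.A_ge l1 by linarith
    qed
    ultimately have Ag: "l + \<bar>g\<bar> \<le> W.A + \<bar>W.q t\<bar>" by linarith
    have "(v t)^2 \<le> 4 * W.C1 * W.S / sqrt (W.A + \<bar>W.q t\<bar>)"
      using W.v_sq_near[OF t(1,2)] True q0 by simp
    also have "\<dots> \<le> 4 * W.C1 * (2 * l) / sqrt (l + \<bar>g\<bar>)"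
      using S C1 W.S_nonneg Ag lg l1 by (intro frac_le mult_left_mono mult_nonneg_nonneg) auto
    finally have vt: "(v t)^2 \<le> 8 * W.C1 * (l / sqrt (l + \<bar>g\<bar>))" by simp
    have Yle: "Y \<le> 1 + 8 * B"
    proof -
      have "x^2 \<le> (tan t)^2" using k by (simp add: tan field_simps power_le_one mult_left_le_one_le)
      also have "\<dots> \<le> 4 * q0 / M" using True Mp by (simp add: field_simps)
      also have "\<dots> \<le> 8 * lam / M" using lam Mp by (intro divide_right_mono) auto
      finally have "l^2 * x^2 \<le> (B * M) * (8 * lam / M)" using lM B1 Mp by (intro mult_mono) auto
      also have "\<dots> = 8 * B * lam" using Mp by simp
      finally have "l^2 * x^2 / lam \<le> 8 * B" using lam by (simp add: divide_le_eq)
      then show ?thesis by (simp add: Y_def)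
    qed
    have "(v t)^2 * (1 / k) ^ (r - 1) \<le> 8 * W.C1 * (l / sqrt (l + \<bar>g\<bar>)) * (4 * B) ^ (r - 1)"
      using vt kr k C1 l1 by (intro mult_mono) auto
    also have "\<dots> = Ca B r * (l / sqrt (l + \<bar>g\<bar>))" by (simp add: Ca_def C1')
    also have "\<dots> = Ca B r * Y ^ K * X_bound K l m x" using Y1 by (simp add: X_bound)
    also have "\<dots> \<le> Ca B r * (1 + 8 * B) ^ K * X_bound K l m x"
      using Yle Y1 Ca0 bnd0 by (intro mult_right_mono mult_left_mono power_mono) auto
    also have "\<dots> \<le> (Cn B r K + Cf B r K) * X_bound K l m x"
      using bnd0 Ca0 B1 by (intro mult_right_mono) (auto simp: Cn_def Cf_def)
    finally show ?thesis unfolding lhs .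
  next
    case False
    define N where "N = sqrt (2 * M)"
    have "(v t)^2 \<le> 4 * W.C1 * W.S / sqrt q0 * (k * s) powr N"
      using W.v_sq_far[OF t(1,2)] False q0 by (simp add: k_def s_def N_def)
    also have "\<dots> \<le> 4 * W.C1 * (2 * l) / sqrt q0 * (k * s) powr N"
      using S C1 q0 by (intro mult_right_mono divide_right_mono mult_left_mono) auto
    finally have vt: "(v t)^2 \<le> 8 * W.C1 * (l / sqrt q0) * (k * s) powr N" by simp
    \<comment> \<open>The value of sin^2 where the far range begins, so that
      \<open>s^2 = 1 / (1 - x2)\<close> and \<open>(k * s)^2 = (1 - x^2) / (1 - x2)\<close>.\<close>
    define x2 where "x2 = 4 * q0 / (M + 4 * q0)"
    have x2p: "0 < x2" using q0 Mp by (simp add: x2_def)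
    have sx: "s^2 * (1 - x2) = 1"
    proof -
      have "M + 4 * q0 \<noteq> 0" using q0 Mp by simp
      then have "1 + 4 * q0 / M = (M + 4 * q0) / M" "1 - x2 = M / (M + 4 * q0)"
        using Mp by (auto simp: x2_def divide_simps)
      then show ?thesis using \<open>M + 4 * q0 \<noteq> 0\<close> Mp by (simp add: s2)
    qed
    have xx2: "x2 \<le> x^2"
    proof -
      have "4 * q0 < M * x^2 / k^2" using False by (simp add: tan)
      moreover have "0 < k^2" using k(1) by simp
      ultimately have "4 * q0 * k^2 < M * x^2" by (simp only: pos_less_divide_eq)
      then have "4 * q0 \<le> x^2 * (M + 4 * q0)" unfolding k(3) by (simp add: algebra_simps)
      then show ?thesis unfolding x2_def using q0 Mp by (simp add: divide_le_eq)
    qed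
    have ks1: "(k * s)^2 \<le> exp (- (x^2 - x2))"
    proof -
      have "1 - x^2 \<le> (1 - x2) * (1 - (x^2 - x2))"
      proof -
        have "(1 - x2) * (1 - (x^2 - x2)) = (1 - x^2) + x2 * (x^2 - x2)" by (simp add: algebra_simps)
        then show ?thesis using x2p xx2 by simp
      qed
      then have "k^2 * s^2 \<le> (1 - x2) * (1 - (x^2 - x2)) * s^2" using k by (intro mult_right_mono) auto
      also have "\<dots> = 1 - (x^2 - x2)" using sx by (simp add: mult_ac)
      also have "\<dots> \<le> exp (- (x^2 - x2))" using exp_ge_add_one_self[of "- (x^2 - x2)"] by linarith
      finally show ?thesis by (simp add: power_mult_distrib)
    qed
    have ksp: "0 < k * s" using k s1 by simp
    have ksle: "k * s \<le> 1"
    proof (rule power2_le_imp_le)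
      show "(k * s)^2 \<le> 1^2" using ks1 xx2 by (auto intro: order_trans)
    qed simp
    have e1: "(k * s) powr N * (1 / k) ^ (r - 1) \<le> (k * s) powr sqrt M * (4 * B) ^ (r - 1)"
    proof -
      have "(1 / k) ^ (r - 1) = (k * s) powr (- real (r - 1)) * s ^ (r - 1)"
        using k s1 by (simp add: powr_minus powr_realpow power_mult_distrib power_one_over field_simps)
      then have "(k * s) powr N * (1 / k) ^ (r - 1) = (k * s) powr (N - real (r - 1)) * s ^ (r - 1)"
        using ksp by (simp add: powr_add[symmetric])
      also have "\<dots> \<le> (k * s) powr sqrt M * (4 * B) ^ (r - 1)"
        using ksp ksle mr r sB s1 by (intro mult_mono powr_mono' power_mono) (auto simp: N_def M_def of_nat_diff)
      finally show ?thesis .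
    qed
    define y where "y = x^2 / x2"
    have y1: "1 \<le> y" using xx2 x2p by (simp add: y_def)
    define a where "a = 1 / (4 * B)"
    have a: "0 < a" "a \<le> 1" using B1 by (auto simp: a_def)
    \<comment> \<open>The decay in \<open>y = x^2 / x2\<close> has a rate independent of
      \<open>l\<close> and \<open>m\<close>: \<open>x2\<close> is comparable to
      \<open>q0 / M\<close>, and \<open>2 * q0 \<ge> l \<ge> sqrt M\<close>.\<close>
    have aM: "a \<le> sqrt M * x2 / 2"
    proof -
      have "M \<le> l^2" using q0 by (simp add: q0_def)
      then have "sqrt M \<le> l" using l1 by (simp add: real_le_lsqrt)
      then have "sqrt M \<le> 2 * q0" using q0 by simp
      then have "sqrt M * sqrt M \<le> sqrt M * (2 * q0)" using Mp by (intro mult_left_mono) auto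
      then have "M \<le> 2 * (sqrt M * q0)" using Mp by simp
      moreover have "M + 4 * q0 \<le> 4 * B * M" using lM Mp by (simp add: q0_def)
      ultimately have "M + 4 * q0 \<le> 4 * B * (2 * (sqrt M * q0))"
        using B1 mult_left_mono[of M "2 * (sqrt M * q0)" "4 * B"] by linarith
      then show ?thesis unfolding a_def x2_def using B1 q0 Mp by (simp add: field_simps)
    qed
    have e2: "(k * s) powr sqrt M \<le> exp (- (a * (y - 1)))"
    proof -
      have "(k * s) powr sqrt M = ((k * s)\<^sup>2) powr (sqrt M / 2)"
        using ksp by (simp add: powr_powr flip: powr_numeral)
      also have "\<dots> \<le> exp (- (x^2 - x2)) powr (sqrt M / 2)"
        using ks1 ksp Mp by (intro powr_mono2) auto
      also have "\<dots> = exp (- (sqrt M * x2 / 2 * (y - 1)))"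
        using x2p by (simp add: powr_def y_def field_simps)
      also have "\<dots> \<le> exp (- (a * (y - 1)))" using mult_right_mono[OF aM, of "y - 1"] y1 by simp
      finally show ?thesis .
    qed
    \<comment> \<open>Of the \<open>Suc K\<close> powers of \<open>y\<close> won here,
      \<open>K\<close> are turned into \<open>Y ^ K\<close>, and one replaces
      \<open>1 / sqrt q0\<close> by \<open>1 / sqrt (l + \<bar>g\<bar>)\<close>.\<close>
    define D where "D = (4 * B * real (Suc K)) ^ Suc K"
    have D0: "0 \<le> D" using B1 by (simp add: D_def)
    have e3: "exp (- (a * (y - 1))) \<le> D / y ^ Suc K"
    proof -
      define E where "E = exp (a * (y - 1))"
      have "y ^ Suc K \<le> D * E"
        using power_le_exp[OF a y1, of K] by (simp add: E_def D_def a_def mult_ac)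
      moreover have "0 < E" "0 < y ^ Suc K" using y1 by (simp_all add: E_def)
      ultimately have "1 / E \<le> D / y ^ Suc K" by (simp add: divide_simps mult_ac del: power_Suc)
      then show ?thesis by (simp only: exp_minus inverse_eq_divide E_def)
    qed
    have Yy: "Y \<le> 9 * B * y" and lx: "l^2 * x^2 \<le> 8 * B * y * lam"
    proof -
      have "x2 \<le> 4 * q0 / M" unfolding x2_def using q0 Mp by (intro divide_left_mono) auto
      also have "\<dots> \<le> 8 * lam / M" using lam Mp by (intro divide_right_mono) auto
      finally have "x^2 \<le> y * (8 * lam / M)" using x2p y1 mult_left_mono[of x2 "8 * lam / M" y] by (simp add: y_def)
      then have "l^2 * x^2 \<le> (B * M) * (y * (8 * lam / M))" using lM B1 Mp by (intro mult_mono) auto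
      also have "\<dots> = 8 * B * y * lam" using Mp by simp
      finally show lx: "l^2 * x^2 \<le> 8 * B * y * lam" .
      then have "l^2 * x^2 / lam \<le> 8 * B * y" using lam by (simp add: divide_le_eq)
      moreover have "1 * 1 \<le> B * y" using B1 y1 by (intro mult_mono) auto
      ultimately show "Y \<le> 9 * B * y" by (simp add: Y_def)
    qed
    have e4: "1 / sqrt q0 \<le> 11 * B * y / sqrt (l + \<bar>g\<bar>)"
    proof -
      have "\<bar>g\<bar> \<le> lam + l^2 * x^2"
      proof -
        have "g = lam - l^2 * x^2" by (simp add: g_def lam_def algebra_simps)
        moreover have "0 \<le> l^2 * x^2" by simp
        ultimately show ?thesis using lam by linarith
      qed
      also have "\<dots> \<le> 1 * q0 + 8 * B * y * q0" using lx lam B1 y1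
        by (intro add_mono order_trans[OF lx] mult_left_mono) auto
      finally have "l + \<bar>g\<bar> \<le> 3 * 1 * q0 + 8 * B * y * q0" using q0 by simp
      also have "\<dots> \<le> 3 * (B * y) * q0 + 8 * B * y * q0"
        using q0 B1 y1 mult_mono[of 1 B 1 y] by (intro add_mono mult_right_mono mult_left_mono) auto
      also have "\<dots> = 11 * B * y * 1 * q0" by simp
      also have "\<dots> \<le> 11 * B * y * (11 * B * y) * q0"
        using q0 B1 y1 mult_mono[of 1 B 1 y] by (intro mult_right_mono mult_left_mono) auto
      finally have "sqrt (l + \<bar>g\<bar>) \<le> sqrt ((11 * B * y)^2 * q0)" by (simp add: power2_eq_square)
      also have "\<dots> = 11 * B * y * sqrt q0" using B1 y1 by (simp add: real_sqrt_mult)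
      finally show ?thesis using q0 lg by (simp add: field_simps)
    qed
    have yK: "1 / y ^ K \<le> (9 * B) ^ K / Y ^ K"
    proof -
      have "Y ^ K \<le> (9 * B * y) ^ K" using Yy Y1 by (intro power_mono) auto
      then show ?thesis using y1 Y1 by (simp add: power_mult_distrib field_simps)
    qed
    have "(v t)^2 * (1 / k) ^ (r - 1) \<le> 8 * W.C1 * (l / sqrt q0) * (k * s) powr N * (1 / k) ^ (r - 1)"
      using vt k by (intro mult_right_mono) auto
    also have "\<dots> = 8 * W.C1 * (l / sqrt q0) * ((k * s) powr N * (1 / k) ^ (r - 1))" by simp
    also have "\<dots> \<le> 8 * W.C1 * (l / sqrt q0) * ((D / y ^ Suc K) * (4 * B) ^ (r - 1))"
      using order_trans[OF e1 mult_right_mono[OF order_trans[OF e2 e3], of "(4 * B) ^ (r - 1)"]] C1 l1 q0 B1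
      by (intro mult_left_mono) auto
    also have "\<dots> = Ca B r * D * l * (1 / y ^ K) * (1 / sqrt q0) / y"
      by (simp add: Ca_def C1' mult_ac)
    also have "\<dots> \<le> Ca B r * D * l * ((9 * B) ^ K / Y ^ K) * (11 * B * y / sqrt (l + \<bar>g\<bar>)) / y"
      using yK e4 Ca0 D0 l1 y1 q0 B1 Y1
      by (intro divide_right_mono mult_mono mult_nonneg_nonneg) auto
    also have "\<dots> = Cf B r K * X_bound K l m x"
      using y1 by (simp add: X_bound Cf_def D_def mult_ac)
    also have "\<dots> \<le> (Cn B r K + Cf B r K) * X_bound K l m x"
      using bnd0 Ca0 B1 by (intro mult_right_mono) (auto simp: Cn_def Cf_def)
    finally show ?thesis unfolding lhs .
  qed
qed

end


section \<open>Uniformity over all indices and over the whole interval\<close>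

lemma finite_uniform_bound:
  fixes f g :: "'a \<Rightarrow> 'b \<Rightarrow> real"
  assumes "finite S" "\<And>s. s \<in> S \<Longrightarrow> \<exists>C>0. \<forall>x\<in>A. f s x \<le> C * g s x"
    and "\<And>s x. s \<in> S \<Longrightarrow> x \<in> A \<Longrightarrow> 0 \<le> g s x"
  shows "\<exists>C>0. \<forall>s\<in>S. \<forall>x\<in>A. f s x \<le> C * g s x"
  using assms
proof (induction S rule: finite_induct)
  case empty
  show ?case by (intro exI[of _ 1]) auto
next
  case (insert s S)
  obtain C where C: "C > 0" "\<forall>s\<in>S. \<forall>x\<in>A. f s x \<le> C * g s x" using insert by auto
  obtain D where D: "D > 0" "\<forall>x\<in>A. f s x \<le> D * g s x" using insert.prems(1)[of s] by blast
  have "f u x \<le> (C + D) * g u x" if "u \<in> insert s S" "x \<in> A" for u x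
  proof -
    have g: "0 \<le> C * g u x" "0 \<le> D * g u x" using insert.prems(2)[of u x] that C(1) D(1) by auto
    show ?thesis using that C D g by (fastforce simp: distrib_right)
  qed
  then show ?case using C(1) D(1) by (intro exI[of _ "C + D"]) auto
qed

lemma X_bound_nonneg:
  assumes "0 \<le> m" "m < l"
  shows "0 \<le> X_bound K l m x"
proof -
  have "0 < l^2 - m^2" using power_strict_mono[OF assms(2,1), of 2] by simp
  then have "0 \<le> l^2 * x^2 / (l^2 - m^2)" by simp
  then show ?thesis unfolding X_bound_def using assms
    by (intro divide_nonneg_nonneg mult_nonneg_nonneg zero_le_power) auto
qed

lemma X_bound_ge:
  assumes "0 \<le> m" "m < l" "x \<in> {-1..1}"
  shows "l / (sqrt (l + (l^2 + m^2)) * (1 + l^2 / (l^2 - m\<^sup>2)) ^ K) \<le> X_bound K l m x"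
    and "0 < l / (sqrt (l + (l^2 + m^2)) * (1 + l^2 / (l^2 - m\<^sup>2)) ^ K)"
proof -
  have lm: "0 < l^2 - m^2" using power_strict_mono[OF assms(2,1), of 2] by simp
  have x: "x^2 \<le> 1" using assms by (simp add: abs_square_le_1 abs_le_iff)
  have "l^2 * x^2 \<le> l^2 * 1" using x by (intro mult_left_mono) auto
  then have a: "l^2 * x^2 / (l^2 - m^2) \<le> l^2 / (l^2 - m^2)" using lm by (intro divide_right_mono) auto
  have "0 \<le> l^2 * (1 - x^2)" "l^2 * (1 - x^2) \<le> l^2 * 1" using x by (auto intro!: mult_left_mono simp del: mult_1_right)
  then have b: "\<bar>l^2 * (1 - x^2) - m^2\<bar> \<le> l^2 + m^2" using zero_le_power2[of m] by linarith
  have c: "0 < 1 + l^2 * x^2 / (l^2 - m^2)" using lm by (intro add_pos_nonneg) auto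
  show "l / (sqrt (l + (l^2 + m^2)) * (1 + l^2 / (l^2 - m\<^sup>2)) ^ K) \<le> X_bound K l m x"
    unfolding X_bound_def using a b c assms
    by (intro divide_left_mono mult_mono power_mono mult_pos_pos zero_less_power) (auto intro!: add_pos_nonneg)
  show "0 < l / (sqrt (l + (l^2 + m^2)) * (1 + l^2 / (l^2 - m\<^sup>2)) ^ K)"
    using assms lm by (intro divide_pos_pos mult_pos_pos zero_less_power) (auto intro!: add_pos_nonneg)
qed

lemma NN_pair:
  assumes "2 \<le> r" "l \<in> NN r" "m \<in> NN (r - 1)" "m < l"
  obtains n where "l = m + real n + 1 / 2" "nat \<lfloor>l - m - 1 / 2\<rfloor> = n" "(real r - 2) / 2 \<le> m" "0 \<le> m"
proof -
  obtain a b where a: "l = real a + (real r - 1) / 2" and b: "m = real b + (real (r - 1) - 1) / 2"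
    using assms by (auto simp: NN_def)
  have r: "real (r - 1) = real r - 1" using assms by (simp add: of_nat_diff)
  have d: "l - m - 1 / 2 = real a - real b" unfolding a b r by (simp add: field_simps)
  then have "real a - real b > - 1" using assms by simp
  then have ab: "b \<le> a" by linarith
  then have "l - m - 1 / 2 = real (a - b)" using d by (simp add: of_nat_diff)
  then show ?thesis
    using assms by (intro that[of "a - b"]) (auto simp: b r)
qed

lemma X_tilde_bounded:
  assumes "(real r - 2) / 2 \<le> m"
  shows "\<exists>D>0. \<forall>x\<in>{-1..1}. (X_tilde r l m x)^2 \<le> D"
proof -
  let ?P = "jacobi_poly (nat \<lfloor>l - m - 1 / 2\<rfloor>) m m"
  have "bounded (poly ?P ` {-1..1})"
    by (intro compact_imp_bounded compact_continuous_image continuous_intros compact_Icc)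
  then obtain b where b: "\<And>x. x \<in> {-1..1} \<Longrightarrow> \<bar>poly ?P x\<bar> \<le> b"
    unfolding bounded_iff by (metis imageI real_norm_def)
  have "(X_tilde r l m x)^2 \<le> (c_coeff l m)^2 * b^2 + 1" if x: "x \<in> {-1..1}" for x
  proof -
    have "x^2 \<le> 1" using x by (simp add: abs_square_le_1 abs_le_iff)
    then have rp: "0 \<le> rpow (1 - x^2) (m / 2 - (real r - 2) / 4)" "rpow (1 - x^2) (m / 2 - (real r - 2) / 4) \<le> 1"
      using assms by (auto simp: rpow_def intro!: powr_le1)
    have "(X_tilde r l m x)^2 = (c_coeff l m)^2 * ((rpow (1 - x^2) (m / 2 - (real r - 2) / 4))^2 * \<bar>poly ?P x\<bar>^2)"
      by (simp add: X_tilde_def power_mult_distrib)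
    also have "\<dots> \<le> (c_coeff l m)^2 * (1^2 * b^2)"
      using b[OF x] rp by (intro mult_left_mono mult_mono power_mono) auto
    finally show ?thesis by simp
  qed
  then show ?thesis by (intro exI[of _ "(c_coeff l m)^2 * b^2 + 1"]) (auto intro: add_nonneg_pos)
qed

text \<open>The size of \<open>m\<close> yields \<open>real r \<le> (2 / 5) * sqrt M\<close>, and
  sqrt 2 >= 7/5 then leaves the exponent that \<open>polar_bound\<close> demands. The value
  \<open>B = 2 / \<epsilon>^2\<close> comes from \<open>m^2 \<le> 2 * M\<close>. Negative
  \<open>x\<close> is reached through the reflected polynomial, which solves the same equation with
  the same energy at 0.\<close>

lemma X_tilde_large:
  assumes r: "2 \<le> r" and l: "l \<in> NN r" and m: "m \<in> NN (r - 1)" "5 * real r \<le> m" and lm: "m < l"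
    and e: "0 < \<epsilon>" "\<epsilon> * l \<le> m" and x: "x \<in> {-1..1}"
  shows "(X_tilde r l m x)^2 \<le> (Cn (2 / \<epsilon>^2) r K + Cf (2 / \<epsilon>^2) r K) * X_bound K l m x"
proof -
  obtain n where n: "l = m + real n + 1 / 2" "nat \<lfloor>l - m - 1 / 2\<rfloor> = n" "(real r - 2) / 2 \<le> m" "0 \<le> m"
    using NN_pair[OF r l m(1) lm] by metis
  define c where "c = c_coeff l m"
  define P where "P = jacobi_poly n m m"
  define M where "M = m^2 - 1 / 4"
  define B where "B = 2 / \<epsilon>^2"
  have m10: "10 \<le> m" using m(2) r by simp
  have "10 * 10 \<le> m * m" using m10 by (intro mult_mono) auto
  then have M: "m^2 / 2 \<le> M" "(m / 2)^2 \<le> M" "0 < M" by (auto simp: M_def power2_eq_square)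
  have lB: "l^2 \<le> B * M"
  proof -
    have "(\<epsilon> * l)^2 \<le> m^2" using e n m10 by (intro power_mono) auto
    also have "\<dots> \<le> 2 * M" using M by simp
    finally show ?thesis using e by (simp add: B_def field_simps power_mult_distrib)
  qed
  have mr: "(real r - 1) + sqrt M \<le> sqrt (2 * M)"
  proof -
    have "m / 2 \<le> sqrt M" using real_sqrt_le_mono[OF M(2)] m10 by simp
    then have a: "real r \<le> (2 / 5) * sqrt M" using m(2) by simp
    have "7 / 5 \<le> sqrt 2" by (rule real_le_rsqrt) (simp add: power2_eq_square)
    then have "7 / 5 * sqrt M \<le> sqrt 2 * sqrt M" using M by (intro mult_right_mono) auto
    then show ?thesis using a by (simp add: real_sqrt_mult)
  qed
  have energy: "(l^2 - M) * (c * poly P 0)^2 + (c * poly (pderiv P) 0)^2 \<le> 2 * l * sqrt (l^2 - M)"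
    using energy_at_0[of m n] m10 n(1) by (simp add: c_def P_def M_def)
  have ode: "(1 - t^2) * poly (pderiv (pderiv P)) t - (2 * m + 2) * t * poly (pderiv P) t
    + real n * (real n + 2 * m + 1) * poly P t = 0" if "t \<in> {-1<..<1}" for t
    unfolding P_def by (rule jacobi_ode[OF that])
  define R where "R = pcompose P [:0, -1:]"
  have R: "poly R t = poly P (- t)" "poly (pderiv R) t = - poly (pderiv P) (- t)"
    "poly (pderiv (pderiv R)) t = poly (pderiv (pderiv P)) (- t)" for t
    by (simp_all add: R_def poly_pcompose pderiv_pcompose pderiv_pCons pderiv_minus pderiv_mult pderiv_smult)
  have Xt: "X_tilde r l m x = c * (rpow (1 - x^2) (m / 2 - (real r - 2) / 4) * poly P x)"
    unfolding X_tilde_def n(2) by (simp add: c_def P_def)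
  have ex: "m / 2 - (real r - 2) / 4 > 0" using m(2) r by simp
  have B0: "0 < B" using e by (simp add: B_def)
  have r1: "1 \<le> r" and m1: "1 \<le> m" using r m10 by auto
  show ?thesis
  proof (cases "\<bar>x\<bar> = 1")
    case True
    then have "X_tilde r l m x = 0" unfolding Xt using ex by (auto simp: rpow_def abs_if split: if_splits)
    moreover have "0 \<le> Ca B r" using B0 by (simp add: Ca_def)
    then have "0 \<le> (Cn B r K + Cf B r K) * X_bound K l m x"
      using X_bound_nonneg[OF n(4) lm, of K x] B0
      by (intro mult_nonneg_nonneg add_nonneg_nonneg) (auto simp: Cn_def Cf_def)
    ultimately show ?thesis by (simp add: B_def)
  next
    case False
    then have x1: "\<bar>x\<bar> < 1" using x by auto
    have "(c * ((1 - \<bar>x\<bar>\<^sup>2) powr (m / 2 - (real r - 2) / 4) * poly P x))^2 \<le> (Cn B r K + Cf B r K) * X_bound K l m \<bar>x\<bar>"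
    proof (cases "0 \<le> x")
      case True
      have "(c * ((1 - \<bar>x\<bar>\<^sup>2) powr (m / 2 - (real r - 2) / 4) * poly P \<bar>x\<bar>))^2 \<le> (Cn B r K + Cf B r K) * X_bound K l m \<bar>x\<bar>"
        by (rule polar_bound[OF m1 n(1) lB[unfolded M_def] r1 mr[unfolded M_def] ode energy[unfolded M_def]]) (use x1 in auto)
      with True show ?thesis by simp
    next
      case neg: False
      have ode': "(1 - t^2) * poly (pderiv (pderiv R)) t - (2 * m + 2) * t * poly (pderiv R) t
        + real n * (real n + 2 * m + 1) * poly R t = 0" if "t \<in> {-1<..<1}" for t
        unfolding R using ode[of "- t"] that by simp
      have en': "(l^2 - M) * (c * poly R 0)^2 + (c * poly (pderiv R) 0)^2 \<le> 2 * l * sqrt (l^2 - M)"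
        using energy by (simp add: R)
      have "(c * ((1 - \<bar>x\<bar>\<^sup>2) powr (m / 2 - (real r - 2) / 4) * poly R \<bar>x\<bar>))^2 \<le> (Cn B r K + Cf B r K) * X_bound K l m \<bar>x\<bar>"
        by (rule polar_bound[OF m1 n(1) lB[unfolded M_def] r1 mr[unfolded M_def] ode' en'[unfolded M_def]]) (use x1 in auto)
      with neg show ?thesis by (simp add: R)
    qed
    moreover have "X_bound K l m \<bar>x\<bar> = X_bound K l m x" by (simp add: X_bound_def)
    moreover have "rpow (1 - x^2) (m / 2 - (real r - 2) / 4) = (1 - \<bar>x\<bar>\<^sup>2) powr (m / 2 - (real r - 2) / 4)"
      using ex by (simp add: rpow_def)
    ultimately show ?thesis by (simp add: Xt B_def)
  qed
qed

text \<open>Under \<open>\<epsilon> * l \<le> m\<close> only finitely many pairs have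
  \<open>m < 5 * real r\<close>. For each of them the function is bounded on [-1,1] and
  \<open>X_bound\<close> is bounded below by a positive number.\<close>

lemma X_tilde_le:
  assumes r: "2 \<le> r" and e: "0 < \<epsilon>"
  shows "\<exists>C>0. \<forall>l\<in>NN r. \<forall>m\<in>NN (r - 1). \<forall>x\<in>{-1..1}. m < l \<longrightarrow> \<epsilon> * l \<le> m \<longrightarrow>
    (X_tilde r l m x)^2 \<le> C * X_bound K l m x"
proof -
  define S where "S = {(l, m). l \<in> NN r \<and> m \<in> NN (r - 1) \<and> m < l \<and> \<epsilon> * l \<le> m \<and> m < 5 * real r}"
  have "S \<subseteq> (NN r \<inter> {..5 * real r / \<epsilon>}) \<times> (NN (r - 1) \<inter> {..5 * real r})"
    using e by (auto simp: S_def field_simps)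
  then have fS: "finite S" by (rule finite_subset) (intro finite_cartesian_product finite_NN_le)
  have "\<exists>C>0. \<forall>s\<in>S. \<forall>x\<in>{-1..1}. (X_tilde r (fst s) (snd s) x)^2 \<le> C * X_bound K (fst s) (snd s) x"
  proof (rule finite_uniform_bound[OF fS])
    fix s assume "s \<in> S"
    then obtain l m where s: "s = (l, m)" and lm: "l \<in> NN r" "m \<in> NN (r - 1)" "m < l" by (auto simp: S_def)
    obtain n where n: "(real r - 2) / 2 \<le> m" "0 \<le> m" using NN_pair[OF r lm] by metis
    obtain D where D: "D > 0" "\<forall>x\<in>{-1..1}. (X_tilde r l m x)^2 \<le> D" using X_tilde_bounded[OF n(1)] by blast
    define b where "b = l / (sqrt (l + (l^2 + m^2)) * (1 + l^2 / (l^2 - m\<^sup>2)) ^ K)"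
    have b: "0 < b" "\<And>x. x \<in> {-1..1} \<Longrightarrow> b \<le> X_bound K l m x"
      using X_bound_ge(2)[OF n(2) lm(3), of 0 K] X_bound_ge(1)[OF n(2) lm(3), of _ K] unfolding b_def by auto
    have "(X_tilde r l m x)^2 \<le> D / b * X_bound K l m x" if "x \<in> {-1..1}" for x
    proof -
      have "D / b * b \<le> D / b * X_bound K l m x" using b(2)[OF that] b(1) D(1) by (intro mult_left_mono) auto
      then show ?thesis using D(2) that b(1) by fastforce
    qed
    then show "\<exists>C>0. \<forall>x\<in>{-1..1}. (X_tilde r (fst s) (snd s) x)^2 \<le> C * X_bound K (fst s) (snd s) x"
      using D(1) b(1) by (intro exI[of _ "D / b"]) (auto simp: s)
    show "0 \<le> X_bound K (fst s) (snd s) x" for x using X_bound_nonneg[OF n(2) lm(3)] by (simp add: s)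
  qed
  then obtain C where C: "C > 0" "\<And>l m x. (l, m) \<in> S \<Longrightarrow> x \<in> {-1..1} \<Longrightarrow> (X_tilde r l m x)^2 \<le> C * X_bound K l m x"
    by fastforce
  define D where "D = Cn (2 / \<epsilon>^2) r K + Cf (2 / \<epsilon>^2) r K"
  have D0: "0 \<le> D" using e by (simp add: D_def Cn_def Cf_def Ca_def)
  have "(X_tilde r l m x)^2 \<le> (C + D) * X_bound K l m x"
    if a: "l \<in> NN r" "m \<in> NN (r - 1)" "x \<in> {-1..1}" "m < l" "\<epsilon> * l \<le> m" for l m x
  proof -
    have "0 \<le> m" using NN_pair[OF r a(1,2,4)] by metis
    then have b: "0 \<le> X_bound K l m x" using X_bound_nonneg a by blast
    have "(X_tilde r l m x)^2 \<le> C * X_bound K l m x \<or> (X_tilde r l m x)^2 \<le> D * X_bound K l m x"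
      using C(2)[of l m x] X_tilde_large[OF r a(1,2) _ a(4) e a(5,3), of K] a
      unfolding S_def D_def by fastforce
    moreover have "0 \<le> C * X_bound K l m x" "0 \<le> D * X_bound K l m x" using b C(1) D0 by auto
    ultimately show ?thesis by (auto simp: distrib_right)
  qed
  then show ?thesis using C(1) D0 by (intro exI[of _ "C + D"]) auto
qed

subsection \<open>Summation over chains of indices\<close>

lemma sum_inverse_sqrt_le: "(\<Sum>j\<le>J. 1 / sqrt (1 + real j)) \<le> 2 * sqrt (1 + real J)"
proof (induction J)
  case (Suc J)
  define a where "a = sqrt (1 + real J)"
  define b where "b = sqrt (2 + real J)"
  have ab: "0 < a" "a \<le> b" "b^2 - a^2 = 1" by (auto simp: a_def b_def)
  have "(b - a) * (b + a) = 1" using ab(3) by (simp add: power2_eq_square algebra_simps)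
  moreover have "(b - a) * (b + a) \<le> (b - a) * (2 * b)" using ab by (intro mult_left_mono) auto
  ultimately have "1 / b \<le> 2 * (b - a)" using ab by (subst pos_divide_le_eq) (auto simp: algebra_simps)
  then show ?case using Suc by (simp add: a_def b_def add.commute)
qed simp

lemma NN_diff_int: "a \<in> NN r \<Longrightarrow> b \<in> NN r \<Longrightarrow> a - b \<in> \<int>"
  by (auto simp: NN_def)

text \<open>Points of \<open>NN r\<close> differ by integers, so on either side of \<open>c\<close>
  the integer parts of the distances are distinct, and each side is dominated by the sum of
  \<open>1 / sqrt (1 + j)\<close>.\<close>

lemma sum_spaced_le:
  assumes "finite T" "T \<subseteq> NN r" "\<And>u. u \<in> T \<Longrightarrow> \<bar>u - c\<bar> \<le> H" "0 \<le> H"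
  shows "(\<Sum>u\<in>T. 1 / sqrt (1 + \<bar>u - c\<bar>)) \<le> 4 * sqrt (1 + H)"
proof -
  have side: "(\<Sum>u\<in>U. 1 / sqrt (1 + \<bar>u - c\<bar>)) \<le> 2 * sqrt (1 + H)"
    if U: "U \<subseteq> T" and inj: "inj_on (\<lambda>u. nat \<lfloor>\<bar>u - c\<bar>\<rfloor>) U" for U
  proof -
    have fU: "finite U" using U assms(1) by (rule finite_subset)
    have "(\<Sum>u\<in>U. 1 / sqrt (1 + \<bar>u - c\<bar>)) \<le> (\<Sum>u\<in>U. 1 / sqrt (1 + real (nat \<lfloor>\<bar>u - c\<bar>\<rfloor>)))"
      by (intro sum_mono divide_left_mono) (auto simp: add_pos_nonneg)
    also have "\<dots> = (\<Sum>j\<in>(\<lambda>u. nat \<lfloor>\<bar>u - c\<bar>\<rfloor>) ` U. 1 / sqrt (1 + real j))"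
      by (simp add: sum.reindex[OF inj])
    also have "\<dots> \<le> (\<Sum>j\<le>nat \<lfloor>H\<rfloor>. 1 / sqrt (1 + real j))"
      using assms(3) U by (intro sum_mono2) (auto intro!: nat_mono floor_mono)
    also have "\<dots> \<le> 2 * sqrt (1 + real (nat \<lfloor>H\<rfloor>))" by (rule sum_inverse_sqrt_le)
    also have "\<dots> \<le> 2 * sqrt (1 + H)" using assms(4) by auto
    finally show ?thesis .
  qed
  have inj1: "inj_on (\<lambda>u. nat \<lfloor>\<bar>u - c\<bar>\<rfloor>) {u \<in> T. c \<le> u}"
  proof (rule inj_onI)
    fix u v assume u: "u \<in> {u \<in> T. c \<le> u}" and v: "v \<in> {u \<in> T. c \<le> u}" and eq: "nat \<lfloor>\<bar>u - c\<bar>\<rfloor> = nat \<lfloor>\<bar>v - c\<bar>\<rfloor>"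
    obtain z where z: "u - v = of_int z" using NN_diff_int u v assms(2) by (metis (no_types, lifting) Ints_cases mem_Collect_eq subsetD)
    have "0 \<le> \<lfloor>u - c\<rfloor>" "0 \<le> \<lfloor>v - c\<rfloor>" using u v by auto
    then have "\<lfloor>u - c\<rfloor> = \<lfloor>v - c\<rfloor>" using eq u v by (auto simp: eq_nat_nat_iff)
    moreover have "u - c = (v - c) + of_int z" using z by simp
    ultimately have "z = 0" by (metis add_cancel_right_right floor_add_int)
    then show "u = v" using z by simp
  qed
  have inj2: "inj_on (\<lambda>u. nat \<lfloor>\<bar>u - c\<bar>\<rfloor>) {u \<in> T. u < c}"
  proof (rule inj_onI)
    fix u v assume u: "u \<in> {u \<in> T. u < c}" and v: "v \<in> {u \<in> T. u < c}" and eq: "nat \<lfloor>\<bar>u - c\<bar>\<rfloor> = nat \<lfloor>\<bar>v - c\<bar>\<rfloor>"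
    obtain z where z: "v - u = of_int z" using NN_diff_int u v assms(2) by (metis (no_types, lifting) Ints_cases mem_Collect_eq subsetD)
    have "0 \<le> \<lfloor>c - u\<rfloor>" "0 \<le> \<lfloor>c - v\<rfloor>" using u v by auto
    then have "\<lfloor>c - u\<rfloor> = \<lfloor>c - v\<rfloor>" using eq u v by (auto simp: eq_nat_nat_iff)
    moreover have "c - u = (c - v) + of_int z" using z by simp
    ultimately have "z = 0" by (metis add_cancel_right_right floor_add_int)
    then show "u = v" using z by simp
  qed
  have "(\<Sum>u\<in>T. 1 / sqrt (1 + \<bar>u - c\<bar>)) = (\<Sum>u\<in>{u \<in> T. c \<le> u} \<union> {u \<in> T. u < c}. 1 / sqrt (1 + \<bar>u - c\<bar>))"
    by (intro sum.cong) auto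
  also have "\<dots> = (\<Sum>u\<in>{u \<in> T. c \<le> u}. 1 / sqrt (1 + \<bar>u - c\<bar>)) + (\<Sum>u\<in>{u \<in> T. u < c}. 1 / sqrt (1 + \<bar>u - c\<bar>))"
    using assms(1) by (intro sum.union_disjoint) auto
  also have "\<dots> \<le> 2 * sqrt (1 + H) + 2 * sqrt (1 + H)"
    by (intro add_mono side inj1 inj2) auto
  finally show ?thesis by simp
qed

text \<open>Let \<open>c\<close> be sqrt b, moved into \<open>{m..l}\<close> if it lies outside.
  Then \<open>\<bar>b - u^2\<bar>\<close> is at least \<open>\<bar>u - c\<bar> * (u + c)\<close>,
  and \<open>u + c\<close> is at least \<open>\<epsilon> * l\<close>, so the gap is linear in the
  distance to \<open>c\<close>.\<close>

lemma sum_gap_le: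
  assumes T: "finite T" "T \<subseteq> NN r" "T \<subseteq> {m..l}" and e: "0 < \<epsilon>" "\<epsilon> \<le> 1" "\<epsilon> * l \<le> m"
    and lm: "1 / 2 \<le> l - m" "1 \<le> l"
  shows "(\<Sum>u\<in>T. 1 / sqrt (l + \<bar>b - u^2\<bar>)) \<le> 8 / sqrt \<epsilon> * (sqrt (l^2 - m^2) / l)"
proof -
  have m0: "0 < m" using e lm by (smt (verit) mult_pos_pos)
  define c where "c = (if b \<le> m^2 then m else if l^2 \<le> b then l else sqrt b)"
  have c: "m \<le> c" "c \<le> l" unfolding c_def
    using lm m0 by (auto intro!: real_le_rsqrt real_le_lsqrt)
  have pr: "\<bar>c^2 - u^2\<bar> \<le> \<bar>b - u^2\<bar>" if "u \<in> T" for u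
  proof -
    have "m^2 \<le> u^2" "u^2 \<le> l^2" using that T(3) m0 by (auto intro!: power_mono)
    moreover have "0 \<le> b" if "\<not> b \<le> m^2" using that zero_le_power2[of m] by linarith
    ultimately show ?thesis unfolding c_def by auto
  qed
  have t: "1 / sqrt (l + \<bar>b - u^2\<bar>) \<le> 1 / sqrt (\<epsilon> * l) * (1 / sqrt (1 + \<bar>u - c\<bar>))" if "u \<in> T" for u
  proof -
    have u: "m \<le> u" "u \<le> l" using that T(3) by auto
    have "\<bar>c^2 - u^2\<bar> = \<bar>u - c\<bar> * (u + c)"
      using u c m0 by (simp add: power2_eq_square square_diff_square_factored abs_mult abs_minus_commute add.commute mult.commute)
    moreover have "\<bar>u - c\<bar> * (\<epsilon> * l) \<le> \<bar>u - c\<bar> * (u + c)"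
      using u c e m0 by (intro mult_left_mono) auto
    moreover have "\<epsilon> * l \<le> 1 * l" using e lm by (intro mult_right_mono) auto
    ultimately have "\<epsilon> * l * (1 + \<bar>u - c\<bar>) \<le> l + \<bar>b - u^2\<bar>"
      using pr[OF that] by (simp add: algebra_simps)
    moreover have "0 < \<epsilon> * l * (1 + \<bar>u - c\<bar>)" using e lm by (intro mult_pos_pos) auto
    ultimately have "1 / sqrt (l + \<bar>b - u^2\<bar>) \<le> 1 / sqrt (\<epsilon> * l * (1 + \<bar>u - c\<bar>))"
      by (intro divide_left_mono) auto
    then show ?thesis by (simp add: real_sqrt_mult)
  qed
  have "(\<Sum>u\<in>T. 1 / sqrt (l + \<bar>b - u^2\<bar>)) \<le> (\<Sum>u\<in>T. 1 / sqrt (\<epsilon> * l) * (1 / sqrt (1 + \<bar>u - c\<bar>)))"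
    by (intro sum_mono t)
  also have "\<dots> = 1 / sqrt (\<epsilon> * l) * (\<Sum>u\<in>T. 1 / sqrt (1 + \<bar>u - c\<bar>))" by (simp add: sum_distrib_left)
  also have "\<dots> \<le> 1 / sqrt (\<epsilon> * l) * (4 * sqrt (1 + (l - m)))"
    using T c lm e by (intro mult_left_mono sum_spaced_le[where r = r]) (auto simp: abs_le_iff)
  also have "\<dots> \<le> 1 / sqrt (\<epsilon> * l) * (8 * sqrt (l - m))"
  proof -
    have "sqrt (1 + (l - m)) \<le> sqrt (2^2 * (l - m))" using lm by (intro real_sqrt_le_mono) auto
    then have "sqrt (1 + (l - m)) \<le> 2 * sqrt (l - m)" by (simp only: real_sqrt_mult real_sqrt_abs abs_numeral)
    then show ?thesis using e lm by (intro mult_left_mono) auto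
  qed
  also have "\<dots> = 8 / sqrt \<epsilon> * (sqrt (l - m) / sqrt l)" by (simp add: real_sqrt_mult)
  also have "\<dots> \<le> 8 / sqrt \<epsilon> * (sqrt (l^2 - m^2) / l)"
  proof -
    have "(l - m) * l \<le> (l - m) * (l + m)" using lm m0 by (intro mult_left_mono) auto
    then have "(l - m) * l \<le> l^2 - m^2" by (simp add: power2_eq_square algebra_simps)
    then have "sqrt ((l - m) * l) \<le> sqrt (l^2 - m^2)" by (rule real_sqrt_le_mono)
    then have "sqrt (l - m) * sqrt l \<le> sqrt (l^2 - m^2)" by (simp add: real_sqrt_mult)
    then have "sqrt (l - m) * sqrt l / l \<le> sqrt (l^2 - m^2) / l" using lm by (intro divide_right_mono) auto
    moreover have "sqrt (l - m) * sqrt l / l = sqrt (l - m) / sqrt l"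
      using lm by (simp add: field_simps)
    ultimately show ?thesis using e by (intro mult_left_mono) auto
  qed
  finally show ?thesis .
qed

text \<open>Since \<open>a w l\<^sup>2 - m\<^sup>2 = w (a l\<^sup>2 - u\<^sup>2) + (w u\<^sup>2 - m\<^sup>2)\<close>, one of the two gaps is at least half of the
  gap on the right, and the other one is summed.\<close>

lemma sum_two_gaps_le:
  assumes T: "finite T" "T \<subseteq> NN r" "T \<subseteq> {m..l}" and e: "0 < \<epsilon>" "\<epsilon> \<le> 1" "\<epsilon> * l \<le> m"
    and lm: "1 / 2 \<le> l - m" "1 \<le> l" and w: "0 \<le> w" "w \<le> 1"
  shows "(\<Sum>u\<in>T. 1 / (sqrt (l + \<bar>a * l^2 - u^2\<bar>) * sqrt (l + \<bar>w * u^2 - m^2\<bar>)))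
    \<le> 48 / (\<epsilon> * sqrt \<epsilon>) * (sqrt (l^2 - m^2) / (l * sqrt (l + \<bar>a * w * l^2 - m^2\<bar>)))"
proof -
  have m0: "0 < m" using e lm by (smt (verit) mult_pos_pos)
  define Z where "Z = sqrt (l^2 - m^2) / l"
  have Z0: "0 \<le> Z" using lm m0 by (auto simp: Z_def intro!: divide_nonneg_nonneg power_mono)
  define g where "g = a * w * l^2 - m^2"
  have s2: "(\<Sum>u\<in>T. 1 / sqrt (l + \<bar>w * u^2 - m^2\<bar>)) \<le> 2 / \<epsilon> * (8 / sqrt \<epsilon> * Z)"
  \<comment> \<open>If \<open>w\<close> is bounded below, it is factored out and the gap is the one
    to \<open>m^2 / w\<close>. Otherwise \<open>w * u^2\<close> is at most half of m^2, and the gap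
    is of order l^2 for every \<open>u\<close>, hence dominates a multiple of
    \<open>\<bar>m^2 - u^2\<bar>\<close>.\<close>
  proof (cases "\<epsilon>^2 / 2 \<le> w")
    case True
    have w0: "0 < w" using True e by (smt (verit) zero_less_power half_gt_zero)
    have "1 / sqrt (l + \<bar>w * u^2 - m^2\<bar>) \<le> 2 / \<epsilon> * (1 / sqrt (l + \<bar>m^2 / w - u^2\<bar>))" if "u \<in> T" for u
    proof -
      have "w * u^2 - m^2 = - (w * (m^2 / w - u^2))" using w0 by (simp add: algebra_simps)
      then have "\<bar>w * u^2 - m^2\<bar> = w * \<bar>m^2 / w - u^2\<bar>" using w0 by (simp add: abs_mult)
      moreover have "(\<epsilon> / 2)^2 * \<bar>m^2 / w - u^2\<bar> \<le> w * \<bar>m^2 / w - u^2\<bar>"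
        using True e w by (intro mult_right_mono) (auto simp: power_divide)
      moreover have "(\<epsilon> / 2)^2 * l \<le> 1 * l" using e lm by (intro mult_right_mono power_le_one) auto
      ultimately have "(\<epsilon> / 2)^2 * (l + \<bar>m^2 / w - u^2\<bar>) \<le> l + \<bar>w * u^2 - m^2\<bar>"
        by (simp add: distrib_left)
      moreover have "0 < (\<epsilon> / 2)^2 * (l + \<bar>m^2 / w - u^2\<bar>)" using e lm by (intro mult_pos_pos) auto
      ultimately have "1 / sqrt (l + \<bar>w * u^2 - m^2\<bar>) \<le> 1 / sqrt ((\<epsilon> / 2)^2 * (l + \<bar>m^2 / w - u^2\<bar>))"
        by (intro divide_left_mono) auto
      also have "\<dots> = 2 / \<epsilon> * (1 / sqrt (l + \<bar>m^2 / w - u^2\<bar>))"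
        using e by (simp only: real_sqrt_mult real_sqrt_abs) simp
      finally show ?thesis .
    qed
    then have "(\<Sum>u\<in>T. 1 / sqrt (l + \<bar>w * u^2 - m^2\<bar>)) \<le> 2 / \<epsilon> * (\<Sum>u\<in>T. 1 / sqrt (l + \<bar>m^2 / w - u^2\<bar>))"
      unfolding sum_distrib_left by (rule sum_mono)
    also have "\<dots> \<le> 2 / \<epsilon> * (8 / sqrt \<epsilon> * Z)"
      using e sum_gap_le[OF T e lm, of "m^2 / w"] unfolding Z_def by (intro mult_left_mono) auto
    finally show ?thesis .
  next
    case False
    have "1 / sqrt (l + \<bar>w * u^2 - m^2\<bar>) \<le> 2 / \<epsilon> * (1 / sqrt (l + \<bar>m^2 - u^2\<bar>))" if "u \<in> T" for u
    proof -
      have u: "m \<le> u" "u \<le> l" using that T(3) by auto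
      have u2: "u^2 \<le> l^2" "m^2 \<le> u^2" "(\<epsilon> * l)^2 \<le> m^2" using u m0 e lm by (auto intro!: power_mono)
      have "w * u^2 \<le> \<epsilon>^2 / 2 * l^2" using False u2 w by (intro mult_mono) auto
      then have "\<epsilon>^2 * l^2 / 2 \<le> \<bar>w * u^2 - m^2\<bar>" using u2(3) abs_ge_minus_self[of "w * u^2 - m^2"]
        unfolding power_mult_distrib by linarith
      moreover have "\<bar>m^2 - u^2\<bar> \<le> l^2" using u2 zero_le_power2[of m] by linarith
      moreover have "(\<epsilon> / 2)^2 * l \<le> 1 * l" using e lm by (intro mult_right_mono power_le_one) auto
      moreover have "(\<epsilon> / 2)^2 * \<bar>m^2 - u^2\<bar> \<le> (\<epsilon> / 2)^2 * l^2" using calculation by (intro mult_left_mono) auto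
      note * = calculation this
      have "(\<epsilon> / 2)^2 * (l + \<bar>m^2 - u^2\<bar>) \<le> l + \<bar>w * u^2 - m^2\<bar>"
      proof -
        have "\<epsilon>^2 * l^2 / 2 \<le> \<bar>w * u^2 - m^2\<bar>" "(\<epsilon> / 2)^2 * l \<le> 1 * l"
          "(\<epsilon> / 2)^2 * \<bar>m^2 - u^2\<bar> \<le> (\<epsilon> / 2)^2 * l^2" by (rule *)+
        note * = this
        have "(\<epsilon> / 2)^2 * l^2 = \<epsilon>^2 * l^2 / 4" by (simp add: power_divide)
        moreover have "(\<epsilon> / 2)^2 * (l + \<bar>m^2 - u^2\<bar>) = (\<epsilon> / 2)^2 * l + (\<epsilon> / 2)^2 * \<bar>m^2 - u^2\<bar>"
          by (rule distrib_left)
        moreover have "0 \<le> \<bar>w * u^2 - m^2\<bar>" by simp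
        ultimately show ?thesis using * by linarith
      qed
      moreover have "0 < (\<epsilon> / 2)^2 * (l + \<bar>m^2 - u^2\<bar>)" using e lm by (intro mult_pos_pos) auto
      ultimately have "1 / sqrt (l + \<bar>w * u^2 - m^2\<bar>) \<le> 1 / sqrt ((\<epsilon> / 2)^2 * (l + \<bar>m^2 - u^2\<bar>))"
        by (intro divide_left_mono) auto
      also have "\<dots> = 2 / \<epsilon> * (1 / sqrt (l + \<bar>m^2 - u^2\<bar>))"
        using e by (simp only: real_sqrt_mult real_sqrt_abs) simp
      finally show ?thesis .
    qed
    then have "(\<Sum>u\<in>T. 1 / sqrt (l + \<bar>w * u^2 - m^2\<bar>)) \<le> 2 / \<epsilon> * (\<Sum>u\<in>T. 1 / sqrt (l + \<bar>m^2 - u^2\<bar>))"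
      unfolding sum_distrib_left by (rule sum_mono)
    also have "\<dots> \<le> 2 / \<epsilon> * (8 / sqrt \<epsilon> * Z)"
      using e sum_gap_le[OF T e lm, of "m^2"] unfolding Z_def by (intro mult_left_mono) auto
    finally show ?thesis .
  qed
  have s1: "(\<Sum>u\<in>T. 1 / sqrt (l + \<bar>a * l^2 - u^2\<bar>)) \<le> 1 / \<epsilon> * (8 / sqrt \<epsilon> * Z)"
  proof -
    have "1 * (8 / sqrt \<epsilon> * Z) \<le> 1 / \<epsilon> * (8 / sqrt \<epsilon> * Z)"
      using e Z0 by (intro mult_right_mono) auto
    then show ?thesis using sum_gap_le[OF T e lm, of "a * l^2"] unfolding Z_def by simp
  qed
  have lg: "0 < l + \<bar>g\<bar>" using lm by simp
  have t: "1 / (sqrt (l + \<bar>a * l^2 - u^2\<bar>) * sqrt (l + \<bar>w * u^2 - m^2\<bar>))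
     \<le> 2 / sqrt (l + \<bar>g\<bar>) * (1 / sqrt (l + \<bar>a * l^2 - u^2\<bar>) + 1 / sqrt (l + \<bar>w * u^2 - m^2\<bar>))" for u
  proof -
    define P where "P = l + \<bar>a * l^2 - u^2\<bar>"
    define Q where "Q = l + \<bar>w * u^2 - m^2\<bar>"
    have PQ: "0 < P" "0 < Q" using lm by (auto simp: P_def Q_def)
    have "g = w * (a * l^2 - u^2) + (w * u^2 - m^2)" by (simp add: g_def algebra_simps)
    then have g1: "\<bar>g\<bar> \<le> \<bar>w * (a * l^2 - u^2)\<bar> + \<bar>w * u^2 - m^2\<bar>" by (metis abs_triangle_ineq)
    have g2: "\<bar>w * (a * l^2 - u^2)\<bar> \<le> 1 * \<bar>a * l^2 - u^2\<bar>"
      unfolding abs_mult using w by (intro mult_right_mono) auto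
    have sum: "l + \<bar>g\<bar> \<le> P + Q"
      unfolding P_def Q_def using order_trans[OF g1 add_right_mono[OF g2]] lm by simp
    have half: "1 / sqrt R \<le> 2 / sqrt (l + \<bar>g\<bar>)" if "l + \<bar>g\<bar> \<le> 2 * R" "0 < R" for R
    proof -
      have "sqrt (l + \<bar>g\<bar>) \<le> sqrt (2^2 * R)" using that by (intro real_sqrt_le_mono) auto
      then have "sqrt (l + \<bar>g\<bar>) \<le> 2 * sqrt R" by (simp only: real_sqrt_mult real_sqrt_abs abs_numeral)
      then show ?thesis using that lg by (simp add: field_simps)
    qed
    have "1 / (sqrt P * sqrt Q) \<le> 2 / sqrt (l + \<bar>g\<bar>) * (1 / sqrt P + 1 / sqrt Q)"
    proof (cases "P \<le> Q")
      case True
      then have "1 / sqrt Q \<le> 2 / sqrt (l + \<bar>g\<bar>)" using sum PQ by (intro half) auto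
      then have "1 / sqrt Q * (1 / sqrt P) \<le> 2 / sqrt (l + \<bar>g\<bar>) * (1 / sqrt P + 1 / sqrt Q)"
        using PQ lg by (intro mult_mono) auto
      then show ?thesis by (simp add: mult.commute)
    next
      case False
      then have "1 / sqrt P \<le> 2 / sqrt (l + \<bar>g\<bar>)" using sum PQ by (intro half) auto
      then have "1 / sqrt P * (1 / sqrt Q) \<le> 2 / sqrt (l + \<bar>g\<bar>) * (1 / sqrt P + 1 / sqrt Q)"
        using PQ lg by (intro mult_mono) auto
      then show ?thesis by simp
    qed
    then show ?thesis by (simp add: P_def Q_def)
  qed
  have "(\<Sum>u\<in>T. 1 / (sqrt (l + \<bar>a * l^2 - u^2\<bar>) * sqrt (l + \<bar>w * u^2 - m^2\<bar>)))
    \<le> (\<Sum>u\<in>T. 2 / sqrt (l + \<bar>g\<bar>) * (1 / sqrt (l + \<bar>a * l^2 - u^2\<bar>) + 1 / sqrt (l + \<bar>w * u^2 - m^2\<bar>)))"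
    by (intro sum_mono t)
  also have "\<dots> = 2 / sqrt (l + \<bar>g\<bar>) * ((\<Sum>u\<in>T. 1 / sqrt (l + \<bar>a * l^2 - u^2\<bar>)) + (\<Sum>u\<in>T. 1 / sqrt (l + \<bar>w * u^2 - m^2\<bar>)))"
    by (simp only: sum_distrib_left[symmetric] sum.distrib)
  also have "\<dots> \<le> 2 / sqrt (l + \<bar>g\<bar>) * (1 / \<epsilon> * (8 / sqrt \<epsilon> * Z) + 2 / \<epsilon> * (8 / sqrt \<epsilon> * Z))"
    using s1 s2 lg by (intro mult_left_mono add_mono) auto
  also have "\<dots> = 48 / (\<epsilon> * sqrt \<epsilon>) * (sqrt (l^2 - m^2) / (l * sqrt (l + \<bar>g\<bar>)))"
    unfolding Z_def by (simp add: field_simps)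
  finally show ?thesis by (simp add: g_def)
qed


section \<open>Recursion and bound for the sums over chains\<close>

lemma NN_step:
  assumes "a \<in> NN j" "b \<in> NN (Suc j)" "a \<le> b"
  shows "a + 1 / 2 \<le> b"
proof -
  obtain x y where x: "a = real x + (real j - 1) / 2" "b = real y + (real (Suc j) - 1) / 2"
    using assms by (auto simp: NN_def)
  have "real x < real y + 1" using assms(3) x by (simp add: field_simps)
  then have "x \<le> y" by linarith
  then show ?thesis using x by (simp add: field_simps)
qed

text \<open>Each step of a chain gains at least 1/2, since \<open>NN (Suc j)\<close> is
  \<open>NN j\<close> shifted by 1/2 and equality of neighbours is impossible.\<close>

lemma J_set_gap:
  assumes "k \<le> d" "L \<in> J_set d k"
  shows "L k + (real d - real k) / 2 \<le> L d"
  using assms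
proof (induction d arbitrary: L rule: dec_induct)
  case base
  then show ?case by simp
next
  case (step d)
  have L: "\<And>j. j \<in> {k..Suc d} \<Longrightarrow> L j \<in> NN j" "\<And>j. j \<in> {k..<Suc d} \<Longrightarrow> L j \<le> L (Suc j)"
    using step.prems by (auto simp: J_set_def)
  have "restrict L {k..d} \<in> J_set d k"
    using L by (auto simp: J_set_def PiE_iff)
  from step.IH[OF this] have "L k + (real d - real k) / 2 \<le> L d" using step by simp
  moreover have "L d + 1 / 2 \<le> L (Suc d)" using step by (intro NN_step[of _ d] L) auto
  ultimately show ?case by (simp add: field_simps)
qed

lemma X_scr_nonneg: "0 \<le> X_scr d k l m x"
  unfolding X_scr_def by (intro sum_nonneg prod_nonneg) auto

lemma X_scr_diag:
  assumes "m \<in> NN k"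
  shows "X_scr k k m m x = 1"
proof -
  have "{L. L \<in> J_set k k \<and> L k = m \<and> L k = m} = {\<lambda>j\<in>{k}. m}"
    using assms by (auto simp: J_set_def PiE_iff extensional_def fun_eq_iff restrict_def)
  then show ?thesis by (simp add: X_scr_def)
qed

text \<open>A chain corresponds to its entry at \<open>d\<close> together with its restriction to
  \<open>{k..d}\<close>. By \<open>J_set_gap\<close> the sum may start at
  \<open>m + (real d - real k) / 2\<close>, which keeps every term within the range of the induction
  in \<open>X_scr_le\<close>.\<close>

lemma X_scr_Suc:
  assumes "k \<le> d" "l \<in> NN (Suc d)"
  shows "X_scr (Suc d) k l m x =
    (\<Sum>u\<in>NN d \<inter> {m + (real d - real k) / 2..l}. \<bar>X_tilde (Suc d) l u (x (Suc d))\<bar>^2 * X_scr d k u m x)"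
proof -
  define A where "A = {L. L \<in> J_set (Suc d) k \<and> L (Suc d) = l \<and> L k = m}"
  define B where "B u = {L. L \<in> J_set d k \<and> L d = u \<and> L k = m}" for u
  define T where "T = NN d \<inter> {m + (real d - real k) / 2..l}"
  define f where "f L = (\<Prod>j\<in>{k+1..d}. \<bar>X_tilde j (L j) (L (j - 1)) (x j)\<bar>^2)" for L
  have fT: "finite T" unfolding T_def by (rule finite_subset[OF _ finite_NN_le[of d l]]) auto
  have fB: "finite (B u)" for u unfolding B_def by (rule finite_J_slice)
  have ins: "{k + 1..Suc d} = insert (Suc d) {k + 1..d}" using assms(1) by auto
  have "X_scr (Suc d) k l m x = (\<Sum>L\<in>A. \<bar>X_tilde (Suc d) l (L d) (x (Suc d))\<bar>^2 * f L)"
    unfolding X_scr_def A_def[symmetric] ins f_def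
    by (intro sum.cong refl) (auto simp: A_def)
  also have "\<dots> = (\<Sum>(u, L)\<in>Sigma T B. \<bar>X_tilde (Suc d) l u (x (Suc d))\<bar>^2 * f L)"
  proof (rule sum.reindex_bij_witness[where j = "\<lambda>L. (L d, restrict L {k..d})" and i = "\<lambda>(u, L). L(Suc d := l)"])
    fix L assume L: "L \<in> A"
    then have LJ: "\<And>j. j \<in> {k..Suc d} \<Longrightarrow> L j \<in> NN j" "\<And>j. j \<in> {k..<Suc d} \<Longrightarrow> L j \<le> L (Suc j)"
      "L (Suc d) = l" "L k = m" "\<And>j. j \<notin> {k..Suc d} \<Longrightarrow> L j = undefined"
      by (auto simp: A_def J_set_def PiE_iff extensional_def)
    have r: "restrict L {k..d} \<in> J_set d k" using LJ by (auto simp: J_set_def PiE_iff)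
    show "(case (L d, restrict L {k..d}) of (u, L) \<Rightarrow> L(Suc d := l)) = L"
      using LJ by (auto simp: fun_eq_iff restrict_def)
    have "m + (real d - real k) / 2 \<le> L d" using J_set_gap[OF assms(1) r] assms(1) LJ by simp
    then show "(L d, restrict L {k..d}) \<in> Sigma T B"
      using LJ r assms(1) LJ(2)[of d] by (auto simp: T_def B_def)
    show "(case (L d, restrict L {k..d}) of (u, L) \<Rightarrow> \<bar>X_tilde (Suc d) l u (x (Suc d))\<bar>^2 * f L)
      = \<bar>X_tilde (Suc d) l (L d) (x (Suc d))\<bar>^2 * f L"
      unfolding f_def by (auto intro!: prod.cong)
  next
    fix b assume "b \<in> Sigma T B"
    then obtain u L where b: "b = (u, L)" "u \<in> T" "L \<in> B u" by auto
    have LJ: "\<And>j. j \<in> {k..d} \<Longrightarrow> L j \<in> NN j" "\<And>j. j \<in> {k..<d} \<Longrightarrow> L j \<le> L (Suc j)"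
      "L d = u" "L k = m" "\<And>j. j \<notin> {k..d} \<Longrightarrow> L j = undefined"
      using b(3) by (auto simp: B_def J_set_def PiE_iff extensional_def)
    show "(case b of (u, L) \<Rightarrow> L(Suc d := l)) \<in> A"
      using b(2) LJ assms by (auto simp: b(1) A_def J_set_def PiE_iff extensional_def T_def less_Suc_eq)
    show "(\<lambda>L. (L d, restrict L {k..d})) (case b of (u, L) \<Rightarrow> L(Suc d := l)) = b"
      using LJ by (auto simp: b(1) fun_eq_iff restrict_def)
  qed
  also have "\<dots> = (\<Sum>u\<in>T. \<Sum>L\<in>B u. \<bar>X_tilde (Suc d) l u (x (Suc d))\<bar>^2 * f L)"
    using fT fB by (intro sum.Sigma[symmetric]) auto
  also have "\<dots> = (\<Sum>u\<in>T. \<bar>X_tilde (Suc d) l u (x (Suc d))\<bar>^2 * X_scr d k u m x)"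
    unfolding X_scr_def f_def B_def by (simp only: sum_distrib_left)
  finally show ?thesis by (simp add: T_def)
qed

text \<open>The product of the cos^2 of all the angles takes the place of \<open>1 - x^2\<close> in
  \<open>X_bound\<close>, and each of the \<open>d - k - 1\<close> intermediate summations
  contributes a factor \<open>sqrt (l^2 - m\<^sup>2)\<close>. For \<open>d = Suc k\<close> it is
  \<open>X_bound\<close>.\<close>

definition X_scr_bound :: "nat \<Rightarrow> nat \<Rightarrow> nat \<Rightarrow> real \<Rightarrow> real \<Rightarrow> (nat \<Rightarrow> real) \<Rightarrow> real" where
  "X_scr_bound K d k l m x = l * sqrt (l^2 - m\<^sup>2) ^ (d - k - 1) /
     (sqrt (l + \<bar>(\<Prod>j\<in>{k+1..d}. 1 - (x j)^2) * l^2 - m^2\<bar>) * (1 + l^2 * (\<Sum>j\<in>{k+1..d}. (x j)^2) / (l^2 - m\<^sup>2)) ^ K)"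

text \<open>The shape of the bound is preserved by one more summation:
  \<open>sum_two_gaps_le\<close> with \<open>a = 1 - y^2\<close> multiplies the new cosine into the
  product and adds a factor \<open>sqrt lam / l\<close>, while the decay factors are compared term
  by term.\<close>

lemma X_scr_le:
  assumes "1 \<le> k" "k < d" "0 < \<epsilon>" "\<epsilon> \<le> 1"
  shows "\<exists>C>0. \<forall>l\<in>NN d. \<forall>m\<in>NN k. \<forall>x\<in>{k+1..d} \<rightarrow> {-1..1}. m + (real d - real k) / 2 \<le> l \<longrightarrow> \<epsilon> * l \<le> m \<longrightarrow>
    X_scr d k l m x \<le> C * X_scr_bound K d k l m x"
  using Suc_leI[OF assms(2)]
proof (induction d rule: dec_induct)
  case base
  obtain C where C: "C > 0" "\<And>l m x. l \<in> NN (Suc k) \<Longrightarrow> m \<in> NN k \<Longrightarrow> x \<in> {-1..1} \<Longrightarrow> m < l \<Longrightarrow> \<epsilon> * l \<le> m \<Longrightarrow>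
    (X_tilde (Suc k) l m x)^2 \<le> C * X_bound K l m x"
    using X_tilde_le[of "Suc k" \<epsilon> K] assms by auto
  have "X_scr (Suc k) k l m x \<le> C * X_scr_bound K (Suc k) k l m x"
    if a: "l \<in> NN (Suc k)" "m \<in> NN k" "x \<in> {k+1..Suc k} \<rightarrow> {-1..1}" "m + (real (Suc k) - real k) / 2 \<le> l" "\<epsilon> * l \<le> m" for l m x
  proof -
    have fin: "finite (NN k \<inter> {m..l})" by (rule finite_subset[OF _ finite_NN_le[of k l]]) auto
    have ml: "m < l" using a(4) by simp
    have "X_scr (Suc k) k l m x = (\<Sum>u\<in>NN k \<inter> {m..l}. \<bar>X_tilde (Suc k) l u (x (Suc k))\<bar>^2 * X_scr k k u m x)"
      using X_scr_Suc[of k k l m x] a by simp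
    also have "\<dots> = (\<Sum>u\<in>{m}. \<bar>X_tilde (Suc k) l u (x (Suc k))\<bar>^2 * X_scr k k u m x)"
    proof (rule sum.mono_neutral_right[OF fin])
      show "{m} \<subseteq> NN k \<inter> {m..l}" using a ml by simp
      show "\<forall>u\<in>NN k \<inter> {m..l} - {m}. \<bar>X_tilde (Suc k) l u (x (Suc k))\<bar>^2 * X_scr k k u m x = 0"
      proof
        fix u assume "u \<in> NN k \<inter> {m..l} - {m}"
        then have e: "{L. L \<in> J_set k k \<and> L k = u \<and> L k = m} = {}" by auto
        show "\<bar>X_tilde (Suc k) l u (x (Suc k))\<bar>^2 * X_scr k k u m x = 0" unfolding X_scr_def e by simp
      qed
    qed
    also have "\<dots> = (X_tilde (Suc k) l m (x (Suc k)))^2" using X_scr_diag[OF a(2)] by simp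
    also have "\<dots> \<le> C * X_bound K l m (x (Suc k))" using a ml by (intro C(2)) auto
    also have "X_bound K l m (x (Suc k)) = X_scr_bound K (Suc k) k l m x"
      by (simp add: X_bound_def X_scr_bound_def mult.commute)
    finally show ?thesis .
  qed
  then show ?case using C(1) by blast
next
  case (step d)
  have kd: "k < d" using step.hyps by simp
  obtain C2 where C2: "C2 > 0" "\<And>l m x. l \<in> NN d \<Longrightarrow> m \<in> NN k \<Longrightarrow> x \<in> {k+1..d} \<rightarrow> {-1..1} \<Longrightarrow>
     m + (real d - real k) / 2 \<le> l \<Longrightarrow> \<epsilon> * l \<le> m \<Longrightarrow> X_scr d k l m x \<le> C2 * X_scr_bound K d k l m x"
    using step.IH by auto
  obtain C1 where C1: "C1 > 0" "\<And>l m x. l \<in> NN (Suc d) \<Longrightarrow> m \<in> NN d \<Longrightarrow> x \<in> {-1..1} \<Longrightarrow> m < l \<Longrightarrow> \<epsilon> * l \<le> m \<Longrightarrow>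
    (X_tilde (Suc d) l m x)^2 \<le> C1 * X_bound K l m x"
    using X_tilde_le[of "Suc d" \<epsilon> K] assms kd by auto
  define C where "C = C1 * C2 * (1 / (\<epsilon>\<^sup>2) ^ K) * (1 / sqrt \<epsilon>) * (48 / (\<epsilon> * sqrt \<epsilon>))"
  have C0: "0 < C" using C1 C2 assms by (simp add: C_def)
  have "X_scr (Suc d) k l m x \<le> C * X_scr_bound K (Suc d) k l m x"
    if a: "l \<in> NN (Suc d)" "m \<in> NN k" "x \<in> {k+1..Suc d} \<rightarrow> {-1..1}" "m + (real (Suc d) - real k) / 2 \<le> l" "\<epsilon> * l \<le> m" for l m x
  proof -
    define T where "T = NN d \<inter> {m + (real d - real k) / 2..l}"
    define y where "y = x (Suc d)"
    define w where "w = (\<Prod>j\<in>{k+1..d}. 1 - (x j)^2)"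
    define n where "n = (\<Sum>j\<in>{k+1..d}. (x j)^2)"
    define lam where "lam = l^2 - m^2"
    have ins: "{k + 1..Suc d} = insert (Suc d) {k + 1..d}" using kd by auto
    have x1: "x j \<in> {-1..1}" if "j \<in> {k+1..Suc d}" for j using a(3) that by auto
    have y1: "y^2 \<le> 1" using x1[of "Suc d"] kd by (simp add: y_def abs_square_le_1 abs_le_iff)
    have xj: "(x j)^2 \<le> 1" if "j \<in> {k+1..d}" for j using x1[of j] that by (simp add: abs_square_le_1 abs_le_iff)
    have w: "0 \<le> w" "w \<le> 1" unfolding w_def using xj by (auto intro!: prod_nonneg prod_le_1)
    have n0: "0 \<le> n" unfolding n_def by (intro sum_nonneg) auto
    have m0: "0 \<le> m" using a(2) assms by (auto simp: NN_def)
    have "real k + 1 \<le> real d" using kd by linarith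
    then have "1 \<le> (real (Suc d) - real k) / 2" by simp
    then have lm: "1 / 2 \<le> l - m" using a(4) by linarith
    \<comment> \<open>A smaller \<open>l\<close> would force \<open>m = 0\<close>, which contradicts
      \<open>\<epsilon> * l \<le> m\<close>.\<close>
    have l1: "1 \<le> l"
    proof (rule ccontr)
      assume "\<not> 1 \<le> l"
      then have "m < 1 / 2" using lm by simp
      obtain j where j: "m = real j + (real k - 1) / 2" using a(2) by (auto simp: NN_def)
      have "2 * real j + real k < 2" using \<open>m < 1 / 2\<close> unfolding j by (simp add: field_simps)
      then have "real (2 * j + k) < real 2" by simp
      then have "2 * j + k < 2" by (simp only: of_nat_less_iff)
      then have "j = 0" "k = 1" using assms by auto
      then have "m = 0" by (simp add: j)
      then show False using a(5) assms lm by (simp add: mult_le_0_iff)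
    qed
    have e: "0 < \<epsilon>" "\<epsilon> \<le> 1" by fact+
    have em: "\<epsilon> * l \<le> m" by fact
    have "0 < \<epsilon> * l" using e l1 by simp
    then have mp: "0 < m" using em by linarith
    have lamp: "0 < lam" using power_strict_mono[of m l 2] lm m0 by (simp add: lam_def)
    define N where "N = 1 + l^2 * (y^2 + n) / lam"
    define g where "g = w * (1 - y^2) * l^2 - m^2"
    have bX: "X_scr_bound K (Suc d) k l m x = l * sqrt lam ^ (d - k) / (sqrt (l + \<bar>g\<bar>) * N ^ K)"
    proof -
      have "(\<Prod>j\<in>insert (Suc d) {k + 1..d}. 1 - (x j)^2) = w * (1 - y^2)"
        "(\<Sum>j\<in>insert (Suc d) {k + 1..d}. (x j)^2) = y^2 + n"
        by (simp_all add: w_def y_def n_def mult.commute)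
      then show ?thesis unfolding X_scr_bound_def ins by (simp add: lam_def g_def N_def)
    qed
    have N1: "1 \<le> N" using lamp n0 by (simp add: N_def)
    have fT: "finite T" unfolding T_def by (rule finite_subset[OF _ finite_NN_le[of d l]]) auto
    have dk: "0 < (real d - real k) / 2" using kd by simp
    have TN: "T \<subseteq> NN d" "T \<subseteq> {m..l}"
      unfolding T_def using dk by (blast, intro subsetI, simp only: Int_iff atLeastAtMost_iff, linarith)
    have tm: "\<bar>X_tilde (Suc d) l u y\<bar>^2 * X_scr d k u m x
       \<le> C1 * C2 * (1 / (\<epsilon>\<^sup>2) ^ K) * (1 / sqrt \<epsilon>) * (l * l * sqrt lam ^ (d - k - 1) / N ^ K)
          * (1 / (sqrt (l + \<bar>(1 - y^2) * l^2 - u^2\<bar>) * sqrt (l + \<bar>w * u^2 - m^2\<bar>)))" if u: "u \<in> T" for u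
    proof -
      have u1: "u \<in> NN d" "m \<le> u" "u \<le> l" "m + (real d - real k) / 2 \<le> u" "m < u" 
        using u dk unfolding T_def Int_iff atLeastAtMost_iff by (blast | linarith)+
      have ul: "u < l" using NN_step[OF u1(1) a(1) u1(3)] by simp
      have eu: "\<epsilon> * l \<le> u" "\<epsilon> * u \<le> m"
        using em u1(2) order_trans[OF mult_left_mono[OF u1(3), of \<epsilon>] em] e by auto
      have eu2: "\<epsilon>^2 * l^2 \<le> u^2" using power_mono[OF eu(1), of 2] e l1 by (simp add: power_mult_distrib)
      have s: "m^2 < u^2" "u^2 < l^2" using u1 ul m0 by (auto intro!: power_strict_mono)
      define P where "P = sqrt (l + \<bar>(1 - y^2) * l^2 - u^2\<bar>)"
      define Q where "Q = sqrt (u + \<bar>w * u^2 - m^2\<bar>)"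
      define Q' where "Q' = sqrt (l + \<bar>w * u^2 - m^2\<bar>)"
      define E where "E = 1 + l^2 * y^2 / (l^2 - u^2)"
      define F where "F = 1 + u^2 * n / (u^2 - m^2)"
      have P: "0 < P" and Q: "0 < Q" and Q': "0 < Q'" using l1 u1 m0 by (auto simp: P_def Q_def Q'_def)
      have E1: "1 \<le> E" and F1: "1 \<le> F" using s n0 by (auto simp: E_def F_def)
      \<comment> \<open>The inner bound carries \<open>u\<close> where the summation lemma expects
        \<open>l\<close>; they are comparable because \<open>\<epsilon> * l \<le> u\<close>.\<close>
      have QQ: "1 / Q \<le> 1 / sqrt \<epsilon> * (1 / Q')"
      proof -
        have "\<epsilon> * \<bar>w * u^2 - m^2\<bar> \<le> 1 * \<bar>w * u^2 - m^2\<bar>" using e by (intro mult_right_mono) auto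
        then have "\<epsilon> * (l + \<bar>w * u^2 - m^2\<bar>) \<le> u + \<bar>w * u^2 - m^2\<bar>"
          using eu by (simp add: distrib_left)
        then have "sqrt (\<epsilon> * (l + \<bar>w * u^2 - m^2\<bar>)) \<le> Q" unfolding Q_def by (rule real_sqrt_le_mono)
        then have "sqrt \<epsilon> * Q' \<le> Q" by (simp add: real_sqrt_mult Q'_def)
        moreover have "0 < sqrt \<epsilon> * Q'" using e Q' by simp
        ultimately have "1 / Q \<le> 1 / (sqrt \<epsilon> * Q')" using Q by (intro divide_left_mono) auto
        then show ?thesis by simp
      qed
      \<comment> \<open>Both \<open>l^2 - u^2\<close> and \<open>u^2 - m^2\<close> are at most
        \<open>lam\<close>, so \<open>E\<close> supplies the \<open>y^2\<close> part of
        \<open>N\<close>, and \<open>F\<close> the part with \<open>n\<close> at the price of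
        \<open>u^2 \<ge> \<epsilon>^2 * l^2\<close>.\<close>
      have EF: "\<epsilon>^2 * N \<le> E * F"
      proof -
        have e2: "\<epsilon>^2 \<le> 1" using e by (simp add: power_le_one)
        have "\<epsilon>^2 * (l^2 * y^2 / lam) \<le> 1 * (l^2 * y^2 / lam)" using e2 lamp by (intro mult_right_mono) auto
        also have "\<dots> \<le> l^2 * y^2 / (l^2 - u^2)"
          unfolding mult_1 using s lamp by (intro divide_left_mono) (auto simp: lam_def)
        finally have a1: "\<epsilon>^2 * (l^2 * y^2 / lam) \<le> l^2 * y^2 / (l^2 - u^2)" .
        have "\<epsilon>^2 * (l^2 * n / lam) = (\<epsilon>^2 * l^2) * n / lam" by simp
        also have "\<dots> \<le> u^2 * n / lam" using eu2 n0 lamp by (intro divide_right_mono mult_right_mono) auto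
        also have "\<dots> \<le> u^2 * n / (u^2 - m^2)"
          using s lamp n0 by (intro divide_left_mono) (auto simp: lam_def)
        finally have a2: "\<epsilon>^2 * (l^2 * n / lam) \<le> u^2 * n / (u^2 - m^2)" .
        have "0 \<le> (l^2 * y^2 / (l^2 - u^2)) * (u^2 * n / (u^2 - m^2))"
          using s n0 by (intro mult_nonneg_nonneg divide_nonneg_nonneg) auto
        then have "1 + l^2 * y^2 / (l^2 - u^2) + u^2 * n / (u^2 - m^2) \<le> E * F"
          unfolding E_def F_def distrib_left distrib_right mult_1 mult_1_right by linarith
        moreover have "\<epsilon>^2 * N = \<epsilon>^2 + \<epsilon>^2 * (l^2 * y^2 / lam) + \<epsilon>^2 * (l^2 * n / lam)"
          by (simp add: N_def distrib_left add_divide_distrib)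
        ultimately show ?thesis using a1 a2 e2 by linarith
      qed
      have EFK: "1 / (E ^ K * F ^ K) \<le> 1 / (\<epsilon>\<^sup>2) ^ K * (1 / N ^ K)"
      proof -
        have "(\<epsilon>^2 * N) ^ K \<le> (E * F) ^ K" using EF N1 by (intro power_mono) auto
        moreover have "0 < (\<epsilon>^2 * N) ^ K" "0 < (E * F) ^ K" using e N1 E1 F1 by auto
        ultimately have "1 / (E * F) ^ K \<le> 1 / (\<epsilon>^2 * N) ^ K" by (intro divide_left_mono) auto
        then show ?thesis by (simp add: power_mult_distrib)
      qed
      have b1: "X_bound K l u y = l / (P * E ^ K)" by (simp add: X_bound_def P_def E_def mult.commute)
      have b2: "X_scr_bound K d k u m x = u * sqrt (u^2 - m\<^sup>2) ^ (d - k - 1) / (Q * F ^ K)"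
        by (simp add: X_scr_bound_def Q_def F_def w_def n_def)
      have sq: "sqrt (u^2 - m\<^sup>2) ^ (d - k - 1) \<le> sqrt lam ^ (d - k - 1)"
        using s by (intro power_mono) (auto simp: lam_def)
      have "\<bar>X_tilde (Suc d) l u y\<bar>^2 * X_scr d k u m x \<le> (C1 * X_bound K l u y) * (C2 * X_scr_bound K d k u m x)"
      proof (rule mult_mono)
        show "\<bar>X_tilde (Suc d) l u y\<bar>^2 \<le> C1 * X_bound K l u y"
          using C1(2)[of l u y] a(1) u1 ul eu e em x1[of "Suc d"] kd by (simp add: y_def)
        show "X_scr d k u m x \<le> C2 * X_scr_bound K d k u m x"
          using u1 eu a(2) x1 by (intro C2(2)) auto
        show "0 \<le> C1 * X_bound K l u y" using C1(1) X_bound_nonneg[of u l K y] u1 ul m0 by simp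
      qed (rule X_scr_nonneg)
      also have "\<dots> = C1 * C2 * (l * u * sqrt (u^2 - m\<^sup>2) ^ (d - k - 1)) * (1 / P) * (1 / Q) * (1 / (E ^ K * F ^ K))"
        unfolding b1 b2 by (simp add: mult_ac)
      also have "\<dots> \<le> C1 * C2 * (l * l * sqrt lam ^ (d - k - 1)) * (1 / P) * (1 / sqrt \<epsilon> * (1 / Q')) * (1 / (\<epsilon>\<^sup>2) ^ K * (1 / N ^ K))"
        using C1(1) C2(1) sq QQ EFK u1 l1 m0 P Q Q' E1 F1 N1 e lamp s
        by (intro mult_mono mult_nonneg_nonneg) auto
      also have "\<dots> = C1 * C2 * (1 / (\<epsilon>\<^sup>2) ^ K) * (1 / sqrt \<epsilon>) * (l * l * sqrt lam ^ (d - k - 1) / N ^ K) * (1 / (P * Q'))"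
        by (simp add: mult_ac)
      finally show ?thesis by (simp only: P_def Q'_def)
    qed
    have "X_scr (Suc d) k l m x = (\<Sum>u\<in>T. \<bar>X_tilde (Suc d) l u y\<bar>^2 * X_scr d k u m x)"
      using X_scr_Suc[of k d l m x] kd a(1) by (simp add: T_def y_def)
    also have "\<dots> \<le> (\<Sum>u\<in>T. C1 * C2 * (1 / (\<epsilon>\<^sup>2) ^ K) * (1 / sqrt \<epsilon>) * (l * l * sqrt lam ^ (d - k - 1) / N ^ K)
          * (1 / (sqrt (l + \<bar>(1 - y^2) * l^2 - u^2\<bar>) * sqrt (l + \<bar>w * u^2 - m^2\<bar>))))"
      by (intro sum_mono tm)
    also have "\<dots> = C1 * C2 * (1 / (\<epsilon>\<^sup>2) ^ K) * (1 / sqrt \<epsilon>) * (l * l * sqrt lam ^ (d - k - 1) / N ^ K) *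
        (\<Sum>u\<in>T. 1 / (sqrt (l + \<bar>(1 - y^2) * l^2 - u^2\<bar>) * sqrt (l + \<bar>w * u^2 - m^2\<bar>)))"
      by (rule sum_distrib_left[symmetric])
    also have "\<dots> \<le> C1 * C2 * (1 / (\<epsilon>\<^sup>2) ^ K) * (1 / sqrt \<epsilon>) * (l * l * sqrt lam ^ (d - k - 1) / N ^ K) *
        (48 / (\<epsilon> * sqrt \<epsilon>) * (sqrt lam / (l * sqrt (l + \<bar>g\<bar>))))"
      using sum_two_gaps_le[OF fT TN e em lm l1 w, of "1 - y^2"] C1(1) C2(1) e l1 lamp N1
      by (intro mult_left_mono mult_nonneg_nonneg) (auto simp: lam_def g_def mult_ac)
    also have "\<dots> = C * (l * (sqrt lam * sqrt lam ^ (d - k - 1)) / (sqrt (l + \<bar>g\<bar>) * N ^ K))"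
      using l1 by (simp add: C_def mult_ac)
    also have "sqrt lam * sqrt lam ^ (d - k - 1) = sqrt lam ^ (d - k)"
      using kd by (simp add: power_Suc[symmetric] Suc_diff_Suc del: power_Suc)
    finally show ?thesis by (simp only: bX)
  qed
  then show ?case using C0 by blast
qed

subsection \<open>The dimension of the spaces of spherical harmonics\<close>

definition mono_fun :: "nat \<Rightarrow> (nat \<Rightarrow> nat) \<Rightarrow> (nat \<Rightarrow> real) \<Rightarrow> real" where
  "mono_fun k e = (\<lambda>x. \<Prod>i\<le>k. x i ^ e i)"

lemma homogeneous_polys_mono: "homogeneous_polys k n = fun_space.span {mono_fun k e | e. (\<Sum>i\<le>k. e i) = n}"
  by (simp add: homogeneous_polys_def mono_fun_def)

text \<open>Polynomial along every line parallel to a coordinate axis. \<open>laplacian\<close> and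
  the normal derivative differentiate only along such lines, so on this class they are
  linear.\<close>

definition polyfun :: "((nat \<Rightarrow> real) \<Rightarrow> real) \<Rightarrow> bool" where
  "polyfun f \<longleftrightarrow> (\<forall>x i. \<exists>q. \<forall>s. f (x(i := s)) = poly q s)"

lemma polyfun_0: "polyfun 0" unfolding polyfun_def by (auto intro!: exI[of _ 0])

lemma polyfun_add: "polyfun f \<Longrightarrow> polyfun g \<Longrightarrow> polyfun (f + g)"
  unfolding polyfun_def by (metis plus_fun_apply poly_add)

lemma polyfun_scale: "polyfun f \<Longrightarrow> polyfun (fscale c f)"
  unfolding polyfun_def fscale_def by (metis poly_smult)

lemma polyfun_mult: "polyfun f \<Longrightarrow> polyfun g \<Longrightarrow> polyfun (\<lambda>x. f x * g x)"
  unfolding polyfun_def by (metis poly_mult)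

lemma polyfun_coord_pow: "polyfun (\<lambda>x. x j ^ e)"
  unfolding polyfun_def
proof (intro allI)
  fix x :: "nat \<Rightarrow> real" and i
  show "\<exists>q. \<forall>s. ((x(i := s)) j) ^ e = poly q s"
  proof (cases "i = j")
    case True
    then show ?thesis by (intro exI[of _ "[:0, 1:] ^ e"]) simp
  next
    case False
    then show ?thesis by (intro exI[of _ "[:x j ^ e:]"]) simp
  qed
qed

lemma polyfun_prod: "finite I \<Longrightarrow> polyfun (\<lambda>x. \<Prod>i\<in>I. x i ^ e i)"
proof (induction I rule: finite_induct)
  case empty
  show ?case unfolding polyfun_def by (auto intro!: exI[of _ 1])
next
  case (insert a I)
  then show ?case using polyfun_mult[OF polyfun_coord_pow[of a "e a"] insert.IH] by simp
qed

lemma poly_deriv_fun: "deriv (poly q) = poly (pderiv (q :: real poly))"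
  by (rule ext) (simp add: DERIV_imp_deriv)

lemma poly_deriv2: "(deriv ^^ 2) (poly q) = poly (pderiv (pderiv (q :: real poly)))"
  by (simp add: numeral_2_eq_2 poly_deriv_fun)

lemma pderiv_sum: "pderiv (\<Sum>i\<in>I. f i) = (\<Sum>i\<in>I. pderiv (f i))"
  by (induction I rule: infinite_finite_induct) (auto simp: pderiv_add)

lemma polyfunE:
  assumes "polyfun f"
  obtains q where "(\<lambda>s. f (x(i := s))) = poly q"
  using assms unfolding polyfun_def by (metis ext)

lemma deriv2_add:
  assumes "polyfun f" "polyfun g"
  shows "(deriv ^^ 2) (\<lambda>s. (f + g) (x(i := s))) t = (deriv ^^ 2) (\<lambda>s. f (x(i := s))) t + (deriv ^^ 2) (\<lambda>s. g (x(i := s))) t"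
proof -
  obtain q where q: "(\<lambda>s. f (x(i := s))) = poly q" by (rule polyfunE[OF assms(1)])
  obtain r where r: "(\<lambda>s. g (x(i := s))) = poly r" by (rule polyfunE[OF assms(2)])
  have "(\<lambda>s. (f + g) (x(i := s))) = poly (q + r)" using q r by (auto simp: fun_eq_iff)
  then show ?thesis unfolding q r by (simp add: poly_deriv2 pderiv_add)
qed

lemma deriv2_scale:
  assumes "polyfun f"
  shows "(deriv ^^ 2) (\<lambda>s. fscale c f (x(i := s))) t = c * (deriv ^^ 2) (\<lambda>s. f (x(i := s))) t"
proof -
  obtain q where q: "(\<lambda>s. f (x(i := s))) = poly q" by (rule polyfunE[OF assms(1)])
  have "(\<lambda>s. fscale c f (x(i := s))) = poly (smult c q)" using q by (auto simp: fun_eq_iff fscale_def)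
  then show ?thesis unfolding q by (simp add: poly_deriv2 pderiv_smult)
qed

lemma laplacian_add: "polyfun f \<Longrightarrow> polyfun g \<Longrightarrow> laplacian k (f + g) x = laplacian k f x + laplacian k g x"
  unfolding laplacian_def by (simp only: deriv2_add sum.distrib)

lemma laplacian_scale: "polyfun f \<Longrightarrow> laplacian k (fscale c f) x = c * laplacian k f x"
  unfolding laplacian_def by (simp only: deriv2_scale sum_distrib_left)

lemma polyfun_homogeneous: "p \<in> homogeneous_polys k n \<Longrightarrow> polyfun p"
  unfolding homogeneous_polys_mono
proof (induction rule: fun_space.span_induct_alt)
  case base
  show ?case by (rule polyfun_0)
next
  case (step c x y)
  then have "polyfun (fscale c x + y)"
    by (intro polyfun_add polyfun_scale) (auto intro!: polyfun_prod simp: mono_fun_def)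
  then show ?case .
qed

section \<open>Harmonic polynomials and their Cauchy data\<close>

definition harm :: "nat \<Rightarrow> nat \<Rightarrow> ((nat \<Rightarrow> real) \<Rightarrow> real) set" where
  "harm k n = {p \<in> homogeneous_polys k n. \<forall>x. laplacian k p x = 0}"

lemma harm_subspace: "fun_space.subspace (harm k n)"
proof (rule fun_space.subspaceI)
  have "polyfun (0 :: (nat \<Rightarrow> real) \<Rightarrow> real)" by (rule polyfun_0)
  then have "laplacian k (fscale 0 0) x = 0 * laplacian k 0 x" for x by (rule laplacian_scale)
  moreover have "fscale 0 (0 :: (nat \<Rightarrow> real) \<Rightarrow> real) = 0" by (auto simp: fscale_def)
  ultimately show "0 \<in> harm k n"
    by (simp add: harm_def homogeneous_polys_def fun_space.span_zero)
next
  fix f g assume "f \<in> harm k n" "g \<in> harm k n"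
  then show "f + g \<in> harm k n"
    using polyfun_homogeneous by (auto simp: harm_def laplacian_add homogeneous_polys_def intro: fun_space.span_add)
next
  fix c f assume "f \<in> harm k n"
  then show "fscale c f \<in> harm k n"
    using polyfun_homogeneous by (auto simp: harm_def laplacian_scale homogeneous_polys_def intro: fun_space.span_scale)
qed

text \<open>Value and normal derivative on the hyperplane x_0 = 0, packed into a single function. On
  polynomials this is truncation to degree at most 1 in x_0, hence a linear map into a small space
  of the same kind.\<close>

definition cauchy_data :: "((nat \<Rightarrow> real) \<Rightarrow> real) \<Rightarrow> (nat \<Rightarrow> real) \<Rightarrow> real" where
  "cauchy_data p = (\<lambda>x. p (x(0 := 0)) + x 0 * deriv (\<lambda>s. p (x(0 := s))) 0)"

lemma cauchy_data_add:
  assumes "polyfun f" "polyfun g"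
  shows "cauchy_data (f + g) = cauchy_data f + cauchy_data g"
proof
  fix x
  obtain q where q: "(\<lambda>s. f (x(0 := s))) = poly q" by (rule polyfunE[OF assms(1)])
  obtain r where r: "(\<lambda>s. g (x(0 := s))) = poly r" by (rule polyfunE[OF assms(2)])
  have "(\<lambda>s. (f + g) (x(0 := s))) = poly (q + r)" using q r by (auto simp: fun_eq_iff)
  then show "cauchy_data (f + g) x = (cauchy_data f + cauchy_data g) x"
    unfolding cauchy_data_def q r by (simp add: poly_deriv_fun pderiv_add algebra_simps q r)
qed

lemma cauchy_data_scale:
  assumes "polyfun f"
  shows "cauchy_data (fscale c f) = fscale c (cauchy_data f)"
proof
  fix x
  obtain q where q: "(\<lambda>s. f (x(0 := s))) = poly q" by (rule polyfunE[OF assms(1)])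
  have "(\<lambda>s. fscale c f (x(0 := s))) = poly (smult c q)" using q by (auto simp: fun_eq_iff fscale_def)
  then show "cauchy_data (fscale c f) x = fscale c (cauchy_data f) x"
    unfolding cauchy_data_def q by (simp add: poly_deriv_fun pderiv_smult fscale_def algebra_simps q)
qed

lemma cauchy_data_0: "cauchy_data 0 = 0"
proof -
  have "(\<lambda>s::real. 0::real) = poly 0" by auto
  then show ?thesis unfolding cauchy_data_def by (auto simp: fun_eq_iff poly_deriv_fun)
qed

lemma mono_fun_split: "mono_fun k e (x(0 := s)) = s ^ e 0 * (\<Prod>i\<in>{1..k}. x i ^ e i)"
proof -
  have "{..k} = insert 0 {1..k}" by auto
  then show ?thesis by (simp add: mono_fun_def)
qed

lemma cauchy_data_mono: "cauchy_data (mono_fun k e) = (if e 0 \<le> 1 then mono_fun k e else 0)"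
proof
  fix x :: "nat \<Rightarrow> real"
  define c where "c = (\<Prod>i\<in>{1..k}. x i ^ e i)"
  have "(\<lambda>s. mono_fun k e (x(0 := s))) = poly (smult c ([:0, 1:] ^ e 0))"
    by (auto simp: mono_fun_split c_def)
  moreover have "mono_fun k e x = x 0 ^ e 0 * c"
    using mono_fun_split[of k e x "x 0"] by (simp add: c_def)
  moreover have "mono_fun k e (x(0 := 0)) = 0 ^ e 0 * c" by (simp add: mono_fun_split c_def)
  moreover have "e 0 = 0 \<or> e 0 = 1 \<or> (\<exists>j. e 0 = Suc (Suc j))" by (metis One_nat_def not0_implies_Suc)
  ultimately show "cauchy_data (mono_fun k e) x = (if e 0 \<le> 1 then mono_fun k e else 0) x"
    unfolding cauchy_data_def
    by (auto simp: poly_deriv_fun pderiv_smult pderiv_pCons pderiv_power_Suc pderiv_mult)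
qed

definition low_monos :: "nat \<Rightarrow> nat \<Rightarrow> ((nat \<Rightarrow> real) \<Rightarrow> real) set" where
  "low_monos k n = {mono_fun k e | e. e 0 \<le> 1 \<and> (\<Sum>i\<le>k. e i) = n}"

lemma cauchy_data_in_span: "p \<in> homogeneous_polys k n \<Longrightarrow> cauchy_data p \<in> fun_space.span (low_monos k n)"
proof -
  assume p: "p \<in> homogeneous_polys k n"
  have "polyfun p \<and> cauchy_data p \<in> fun_space.span (low_monos k n)"
    using p unfolding homogeneous_polys_mono
  proof (induction rule: fun_space.span_induct_alt)
    case base
    have "polyfun 0 \<and> cauchy_data 0 \<in> fun_space.span (low_monos k n)"
      by (simp only: cauchy_data_0 fun_space.span_zero polyfun_0 simp_thms)
    then show ?case .
  next
    case (step c x y)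
    then obtain e where e: "x = mono_fun k e" "(\<Sum>i\<le>k. e i) = n" by auto
    have x: "polyfun x" unfolding e mono_fun_def by (rule polyfun_prod) simp
    have "cauchy_data x \<in> fun_space.span (low_monos k n)"
      unfolding e cauchy_data_mono using e(2)
      by (auto simp: low_monos_def fun_space.span_zero intro!: fun_space.span_base)
    then have "polyfun (fscale c x + y) \<and> cauchy_data (fscale c x + y) \<in> fun_space.span (low_monos k n)"
      using step x
      by (simp only: cauchy_data_add cauchy_data_scale polyfun_add polyfun_scale fun_space.span_add fun_space.span_scale simp_thms)
    then show ?case .
  qed
  then show ?thesis by simp
qed

text \<open>Besides the expansion in x_0, its coefficients are needed as functions of the other
  variables to which the Laplacian can be applied, hence the \<open>polyfun\<close> clause.\<close>

lemma expansion_in_x0: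
  assumes "p \<in> homogeneous_polys k n"
  shows "\<exists>c. (\<forall>x. p x = (\<Sum>j\<le>n. x 0 ^ j * c j x)) \<and> (\<forall>j x s. c j (x(0 := s)) = c j x) \<and> (\<forall>j. polyfun (c j))"
  using assms unfolding homogeneous_polys_mono
proof (induction rule: fun_space.span_induct_alt)
  case base
  show ?case using polyfun_0 by (intro exI[of _ "\<lambda>j x. 0"]) (auto simp: zero_fun_def)
next
  case (step a f g)
  then obtain e where e: "f = mono_fun k e" "(\<Sum>i\<le>k. e i) = n" by auto
  obtain c where c: "\<And>x. g x = (\<Sum>j\<le>n. x 0 ^ j * c j x)" "\<And>j x s. c j (x(0 := s)) = c j x" "\<And>j. polyfun (c j)"
    using step by blast
  have e0: "e 0 \<le> n" using member_le_sum[of 0 "{..k}" e] e(2) by auto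
  define h where "h x = (\<Prod>i\<in>{1..k}. x i ^ e i)" for x :: "nat \<Rightarrow> real"
  define c' where "c' j = (if j = e 0 then fscale a h + c j else c j)" for j
  have f: "f x = x 0 ^ e 0 * h x" for x
    using mono_fun_split[of k e x "x 0"] by (simp add: e h_def)
  have "(fscale a f + g) x = (\<Sum>j\<le>n. x 0 ^ j * c' j x)" for x
  proof -
    have "(\<Sum>j\<le>n. x 0 ^ j * c' j x) = (\<Sum>j\<le>n. x 0 ^ j * c j x + (if j = e 0 then x 0 ^ j * (a * h x) else 0))"
      by (intro sum.cong) (auto simp: c'_def fscale_def algebra_simps)
    also have "\<dots> = g x + x 0 ^ e 0 * (a * h x)"
      using e0 by (simp add: sum.distrib c(1))
    finally show ?thesis by (simp add: f fscale_def)
  qed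
  moreover have "c' j (x(0 := s)) = c' j x" for j x s
  proof -
    have "h (x(0 := s)) = h x" unfolding h_def by (intro prod.cong) auto
    then show ?thesis by (simp add: c'_def c(2) fscale_def)
  qed
  moreover have "polyfun h" unfolding h_def by (rule polyfun_prod) simp
  then have "polyfun (c' j)" for j
    using c(3) by (auto simp: c'_def intro!: polyfun_add polyfun_scale)
  ultimately show ?case by blast
qed

text \<open>Comparing coefficients of powers of \<open>x\<^sub>0\<close> in the Laplace equation expresses the coefficient
  of \<open>x\<^sub>0\<^bsup>j+2\<^esup>\<close> through the one of \<open>x\<^sub>0\<^bsup>j\<^esup>\<close>, as in the Cauchy--Kovalevskaya theorem.\<close>

lemma cauchy_data_inj:
  assumes p: "p \<in> harm k n" and T: "cauchy_data p = 0"
  shows "p = 0"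
proof -
  have ph: "p \<in> homogeneous_polys k n" and lap: "\<And>x. laplacian k p x = 0" using p by (auto simp: harm_def)
  obtain c where c: "\<And>x. p x = (\<Sum>j\<le>n. x 0 ^ j * c j x)" "\<And>j x s. c j (x(0 := s)) = c j x" "\<And>j. polyfun (c j)"
    using expansion_in_x0[OF ph] by blast
  define q where "q x = (\<Sum>j\<le>n. monom (c j x) j)" for x
  have q: "(\<lambda>s. p (x(0 := s))) = poly (q x)" for x
    by (rule ext) (simp add: c(1,2) q_def poly_sum poly_monom mult.commute)
  have qc: "coeff (q x) j = (if j \<le> n then c j x else 0)" for x j
    by (simp add: q_def coeff_sum)
  have T0: "cauchy_data p x = 0" for x using T by simp
  have z: "coeff (q x) 0 = 0" "coeff (q x) 1 = 0" for x
  proof -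
    have "cauchy_data p x = poly (q x) 0 + x 0 * poly (pderiv (q x)) 0" for x
      using fun_cong[OF q[of x], of 0] by (simp add: cauchy_data_def q poly_deriv_fun)
    then have h: "poly (q x) 0 + x 0 * poly (pderiv (q x)) 0 = 0" for x using T0 by simp
    have qx: "q (x(0 := s)) = q x" for s by (simp add: q_def c(2))
    \<comment> \<open>As \<open>q x\<close> does not depend on \<open>x 0\<close>, setting that
      coordinate to 0 and then to 1 separates the value from the derivative.\<close>
    have a: "poly (q x) 0 = 0" using h[of "x(0 := 0)"] qx by simp
    moreover have "poly (pderiv (q x)) 0 = 0" using h[of "x(0 := 1)"] a qx by simp
    ultimately show "coeff (q x) 0 = 0" "coeff (q x) 1 = 0"
      by (simp_all add: poly_0_coeff_0 coeff_pderiv)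
  qed
  have step: "coeff (q x) (Suc (Suc j)) = 0" if j: "j \<le> n" "\<And>x. c j x = 0" for j x
  proof -
    define D where "D j = (\<Sum>i\<in>{1..k}. (deriv ^^ 2) (\<lambda>r. c j (x(i := r))) (x i))" for j
    \<comment> \<open>The Laplacian of \<open>p\<close> on the line through \<open>x\<close> in
      direction x_0, as a polynomial in x_0; \<open>D j\<close> is the Laplacian of
      \<open>c j\<close> in the other variables.\<close>
    define R where "R = pderiv (pderiv (q x)) + (\<Sum>j\<le>n. monom (D j) j)"
    have "poly R s = 0" for s
    proof -
      define y where "y = x(0 := s)"
      have i: "(deriv ^^ 2) (\<lambda>r. p (y(i := r))) (y i) = (\<Sum>j\<le>n. s ^ j * (deriv ^^ 2) (\<lambda>r. c j (x(i := r))) (x i))"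
        if i: "i \<in> {1..k}" for i
      proof -
        have "\<exists>Q. \<forall>j. (\<lambda>r. c j (x(i := r))) = poly (Q j)"
          using c(3) by (intro choice allI) (metis polyfunE)
        then obtain Q where Q: "\<And>j. (\<lambda>r. c j (x(i := r))) = poly (Q j)" by blast
        have "c j (y(i := r)) = poly (Q j) r" for j r
        proof -
          have "y(i := r) = (x(i := r))(0 := s)" using i by (auto simp: y_def)
          then show ?thesis using fun_cong[OF Q[of j], of r] c(2) by simp
        qed
        then have E: "(\<lambda>r. p (y(i := r))) = poly (\<Sum>j\<le>n. smult (s ^ j) (Q j))"
          using i by (auto simp: fun_eq_iff c(1) poly_sum y_def)
        have "(deriv ^^ 2) (\<lambda>r. p (y(i := r))) (y i) = (\<Sum>j\<le>n. s ^ j * poly (pderiv (pderiv (Q j))) (y i))"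
          unfolding E poly_deriv2 pderiv_sum pderiv_smult poly_sum by simp
        moreover have "y i = x i" using i by (simp add: y_def)
        ultimately show ?thesis unfolding Q poly_deriv2 by (simp only:)
      qed
      have ins: "{..k} = insert 0 {1..k}" by auto
      have "0 = laplacian k p y" using lap by simp
      also have "\<dots> = (deriv ^^ 2) (\<lambda>r. p (y(0 := r))) (y 0) + (\<Sum>i\<in>{1..k}. (deriv ^^ 2) (\<lambda>r. p (y(i := r))) (y i))"
        unfolding laplacian_def ins by simp
      also have "(deriv ^^ 2) (\<lambda>r. p (y(0 := r))) (y 0) = poly (pderiv (pderiv (q x))) s"
        using q[of x] by (simp add: y_def poly_deriv2)
      also have "(\<Sum>i\<in>{1..k}. (deriv ^^ 2) (\<lambda>r. p (y(i := r))) (y i)) = (\<Sum>j\<le>n. s ^ j * D j)"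
        unfolding D_def by (simp add: i sum_distrib_left) (rule sum.swap)
      finally show ?thesis by (simp add: R_def poly_sum poly_monom mult.commute)
    qed
    then have "R = 0" using poly_all_0_iff_0[of R] by blast
    then have "coeff R j = 0" by simp
    moreover have "D j = 0"
    proof -
      have "(\<lambda>r::real. 0::real) = poly 0" by auto
      then show ?thesis unfolding D_def j(2) by (simp add: poly_deriv2)
    qed
    ultimately show ?thesis using j(1) by (simp add: R_def coeff_pderiv coeff_sum)
  qed
  have "coeff (q x) j = 0 \<and> coeff (q x) (Suc j) = 0" for x j
  proof (induction j arbitrary: x)
    case 0
    then show ?case using z by simp
  next
    case (Suc j)
    have "coeff (q x) (Suc (Suc j)) = 0"
    proof (cases "j \<le> n")
      case True
      then have "c j y = 0" for y using Suc.IH[of y] qc by simp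
      then show ?thesis by (rule step[OF True])
    qed (simp add: qc)
    then show ?case using Suc.IH by simp
  qed
  then have "q x = 0" for x by (simp add: poly_eq_iff)
  then have "p (x(0 := x 0)) = 0" for x using fun_cong[OF q[of x], of "x 0"] by (simp del: fun_upd_triv)
  then show ?thesis by auto
qed

text \<open>There are two choices for the exponent of x_0 and at most \<open>n + 1\<close> for each
  of x_1, ..., x_(k-1); the exponent of x_k is what remains of the degree.\<close>

lemma finite_card_low_monos:
  assumes "1 \<le> k"
  shows "finite (low_monos k n)" "card (low_monos k n) \<le> 2 * (n + 1) ^ (k - 1)"
proof -
  define F where "F = (\<lambda>(a :: nat, h :: nat \<Rightarrow> nat). mono_fun k (\<lambda>i. if i = 0 then a else if i < k then h i else n - a - (\<Sum>i\<in>{1..<k}. h i)))"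
  define S where "S = {..1::nat} \<times> (\<Pi>\<^sub>E i\<in>{1..<k}. {..n})"
  have fS: "finite S" unfolding S_def by (intro finite_cartesian_product finite_PiE) auto
  have cS: "card S = 2 * (n + 1) ^ (k - 1)"
    by (simp add: S_def card_cartesian_product card_PiE)
  have sub: "low_monos k n \<subseteq> F ` S"
  proof
    fix f assume "f \<in> low_monos k n"
    then obtain e where e: "f = mono_fun k e" "e 0 \<le> 1" "(\<Sum>i\<le>k. e i) = n" by (auto simp: low_monos_def)
    have "{..k} = insert 0 (insert k {1..<k})" using assms by auto
    then have s: "e 0 + (e k + (\<Sum>i\<in>{1..<k}. e i)) = n" using e(3) assms by simp
    have le: "e i \<le> n" if "i \<in> {1..<k}" for i
      using member_le_sum[of i "{1..<k}" e] that s by auto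
    have "F (e 0, restrict e {1..<k}) = f"
      unfolding F_def e(1) mono_fun_def using s assms by (auto simp: fun_eq_iff intro!: prod.cong)
    moreover have "(e 0, restrict e {1..<k}) \<in> S" using e(2) le by (auto simp: S_def)
    ultimately show "f \<in> F ` S" by (metis imageI)
  qed
  show "finite (low_monos k n)" using finite_subset[OF sub] fS by simp
  show "card (low_monos k n) \<le> 2 * (n + 1) ^ (k - 1)"
    using surj_card_le[OF fS sub] cS by simp
qed

lemma cauchy_data_sum:
  assumes "finite A" "A \<subseteq> harm k n"
  shows "cauchy_data (\<Sum>b\<in>A. fscale (u b) b) = (\<Sum>b\<in>A. fscale (u b) (cauchy_data b))"
  using assms
proof (induction A rule: finite_induct)
  case empty
  show ?case by (simp only: cauchy_data_0 sum.empty)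
next
  case (insert a A)
  have "(\<Sum>b\<in>A. fscale (u b) b) \<in> harm k n"
    using insert by (intro fun_space.subspace_sum[OF harm_subspace] fun_space.subspace_scale[OF harm_subspace]) auto
  then have "polyfun (\<Sum>b\<in>A. fscale (u b) b)" "polyfun a"
    using insert polyfun_homogeneous by (auto simp: harm_def)
  moreover have "cauchy_data (\<Sum>b\<in>A. fscale (u b) b) = (\<Sum>b\<in>A. fscale (u b) (cauchy_data b))"
    by (rule insert.IH) (use insert.prems in auto)
  ultimately show ?case
    by (simp only: sum.insert[OF insert.hyps] cauchy_data_add cauchy_data_scale polyfun_scale)
qed

text \<open>Being linear and injective on harmonic polynomials, \<open>cauchy_data\<close> maps a
  basis to an independent set in the span of \<open>low_monos k n\<close>, so the basis is no larger
  than that set of monomials.\<close>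

lemma harm_basis:
  assumes "1 \<le> k"
  obtains B where "finite B" "card B \<le> 2 * (n + 1) ^ (k - 1)" "harm k n \<subseteq> fun_space.span B"
proof -
  obtain B where B: "B \<subseteq> harm k n" "fun_space.independent B" "harm k n \<subseteq> fun_space.span B"
    by (rule fun_space.basis_exists[of "harm k n"])
  have inj: "inj_on cauchy_data B"
  proof (rule inj_onI)
    fix f g assume fg: "f \<in> B" "g \<in> B" "cauchy_data f = cauchy_data g"
    have pf: "polyfun f" "polyfun g" using fg B(1) polyfun_homogeneous by (auto simp: harm_def)
    have "cauchy_data (f + fscale (-1) g) = cauchy_data f + fscale (-1) (cauchy_data g)"
      using pf by (simp only: cauchy_data_add cauchy_data_scale polyfun_scale)
    also have "\<dots> = 0" unfolding fg(3) by (rule ext) (simp add: fscale_def)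
    finally have z: "cauchy_data (f + fscale (-1) g) = 0" .
    have "f + fscale (-1) g \<in> harm k n"
      using fg B(1) by (intro fun_space.subspace_add[OF harm_subspace] fun_space.subspace_scale[OF harm_subspace]) (simp_all only: subsetD)
    from cauchy_data_inj[OF this z] have "f + fscale (-1) g = 0" .
    then have "(f + fscale (-1) g) x = 0" for x by (simp only: zero_fun_apply)
    then show "f = g" by (intro ext) (simp add: fscale_def)
  qed
  have "fun_space.independent (cauchy_data ` B)"
  proof (rule ccontr)
    assume "\<not> fun_space.independent (cauchy_data ` B)"
    then have "fun_space.dependent (cauchy_data ` B)" by (rule notnotD)
    then have "\<exists>U u. finite U \<and> U \<subseteq> cauchy_data ` B \<and> (\<Sum>v\<in>U. fscale (u v) v) = 0 \<and> (\<exists>v\<in>U. u v \<noteq> 0)"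
      by (simp only: fun_space.dependent_explicit)
    then obtain U u where U: "finite U" "U \<subseteq> cauchy_data ` B" "(\<Sum>v\<in>U. fscale (u v) v) = 0" "\<exists>v\<in>U. u v \<noteq> 0"
      by (elim exE conjE)
    obtain A where A: "A \<subseteq> B" "finite A" "U = cauchy_data ` A"
      using finite_subset_image[OF U(1,2)] by (elim exE conjE)
    have injA: "inj_on cauchy_data A" using inj A(1) by (rule inj_on_subset)
    define s where "s = (\<Sum>b\<in>A. fscale (u (cauchy_data b)) b)"
    have "s \<in> harm k n" unfolding s_def
      using A B(1) by (intro fun_space.subspace_sum[OF harm_subspace] fun_space.subspace_scale[OF harm_subspace]) auto
    moreover have "cauchy_data s = 0"
    proof -
      have "A \<subseteq> harm k n" using A(1) B(1) by (rule subset_trans)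
      from cauchy_data_sum[OF A(2) this, of "\<lambda>b. u (cauchy_data b)"] show ?thesis
        using U(3) by (simp only: s_def A(3) sum.reindex[OF injA] o_def)
    qed
    ultimately have "s = 0" by (rule cauchy_data_inj)
    then have "(\<Sum>b\<in>A. fscale (u (cauchy_data b)) b) = 0" by (simp only: s_def)
    then have "u (cauchy_data b) = 0" if "b \<in> A" for b
      using fun_space.independentD[OF B(2) A(2,1), of "\<lambda>b. u (cauchy_data b)"] that by metis
    then show False using U(4) A(3) by auto
  qed
  moreover have "cauchy_data ` B \<subseteq> fun_space.span (low_monos k n)"
    using B(1) cauchy_data_in_span by (auto simp: harm_def)
  ultimately have fin: "finite (cauchy_data ` B) \<and> card (cauchy_data ` B) \<le> card (low_monos k n)"
    by (intro fun_space.independent_span_bound[OF finite_card_low_monos(1)[OF assms]])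
  have "finite B" by (rule finite_imageD[OF conjunct1[OF fin] inj])
  moreover have "card B \<le> card (low_monos k n)" using fin by (simp only: card_image[OF inj])
  then have "card B \<le> 2 * (n + 1) ^ (k - 1)" using finite_card_low_monos(2)[OF assms, of n] by (rule le_trans)
  ultimately show ?thesis using B(3) by (rule that)
qed

text \<open>Restriction to the sphere is linear, so the restrictions of a spanning set of harmonic
  polynomials span the spherical harmonics.\<close>

lemma sph_dim_le:
  assumes "1 \<le> k" "m \<in> NN k"
  shows "real (sph_dim k m) \<le> 2 * (m + 1) ^ (k - 1)"
proof -
  obtain n where n: "m = real n + (real k - 1) / 2" using assms by (auto simp: NN_def)
  then have fl: "nat \<lfloor>m - (real k - 1) / 2\<rfloor> = n" by simp
  obtain B where B: "finite B" "card B \<le> 2 * (n + 1) ^ (k - 1)" "harm k n \<subseteq> fun_space.span B"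
    using harm_basis[OF assms(1)] by metis
  define R where "R p = (\<lambda>x. if x \<in> unit_sphere k then p x else 0)" for p :: "(nat \<Rightarrow> real) \<Rightarrow> real"
  have R: "R (fscale c f + g) = fscale c (R f) + R g" "R 0 = 0" for c f g
    by (auto simp: R_def fscale_def fun_eq_iff)
  have "R p \<in> fun_space.span (R ` B)" if "p \<in> fun_space.span B" for p
    using that
  proof (induction rule: fun_space.span_induct_alt)
    case base
    have "R 0 \<in> fun_space.span (R ` B)" by (simp only: R fun_space.span_zero)
    then show ?case .
  next
    case (step c x y)
    have "R (fscale c x + y) \<in> fun_space.span (R ` B)"
      unfolding R using step
      by (intro fun_space.span_add fun_space.span_scale) (auto intro!: fun_space.span_base)
    then show ?case .
  qed
  then have "spherical_harmonics k n \<subseteq> fun_space.span (R ` B)"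
    using B(3) by (auto simp: spherical_harmonics_def harm_def R_def[symmetric])
  then have "sph_dim k m \<le> card (R ` B)"
    unfolding sph_dim_def fl using B(1) by (intro fun_space.dim_le_card) auto
  also have "\<dots> \<le> card B" using B(1) by (rule card_image_le)
  also have "\<dots> \<le> 2 * (n + 1) ^ (k - 1)" by (rule B(2))
  finally have "real (sph_dim k m) \<le> real (2 * (n + 1) ^ (k - 1))" by (simp only: of_nat_le_iff)
  also have "\<dots> = 2 * (real n + 1) ^ (k - 1)" by (simp add: add.commute)
  also have "\<dots> \<le> 2 * (m + 1) ^ (k - 1)"
    using n assms by (intro mult_left_mono power_mono) auto
  finally show ?thesis .
qed

subsection \<open>Summation over a spectral cluster\<close>

lemma quarter_bound: "y / 4 \<le> w \<Longrightarrow> x \<le> 2 + 2 * y \<Longrightarrow> x \<le> 8 * (1 + w)" for x y w :: real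
proof -
  assume "y / 4 \<le> w" "x \<le> 2 + 2 * y"
  moreover from this(1) have "y \<le> 4 * w" by simp
  ultimately show ?thesis by simp
qed

lemma card_spaced_le:
  assumes "finite T" "T \<subseteq> NN r" "T \<subseteq> {a..b}" "a \<le> b"
  shows "real (card T) \<le> b - a + 1"
proof -
  have inj: "inj_on (\<lambda>u. nat \<lfloor>u - a\<rfloor>) T"
  proof (rule inj_onI)
    fix u v assume u: "u \<in> T" and v: "v \<in> T" and eq: "nat \<lfloor>u - a\<rfloor> = nat \<lfloor>v - a\<rfloor>"
    obtain z where z: "u - v = of_int z" using NN_diff_int u v assms(2) by (metis (no_types, lifting) Ints_cases subsetD)
    have "0 \<le> \<lfloor>u - a\<rfloor>" "0 \<le> \<lfloor>v - a\<rfloor>" using u v assms(3) by auto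
    then have "\<lfloor>u - a\<rfloor> = \<lfloor>v - a\<rfloor>" using eq by (auto simp: eq_nat_nat_iff)
    moreover have "u - a = (v - a) + of_int z" using z by simp
    ultimately have "z = 0" by (metis add_cancel_right_right floor_add_int)
    then show "u = v" using z by simp
  qed
  have sub: "(\<lambda>u. nat \<lfloor>u - a\<rfloor>) ` T \<subseteq> {..nat \<lfloor>b - a\<rfloor>}"
    using assms(3) by (auto intro!: nat_mono floor_mono)
  have "card T \<le> Suc (nat \<lfloor>b - a\<rfloor>)"
    using card_mono[OF _ sub] card_image[OF inj] by simp
  moreover have "real (nat \<lfloor>b - a\<rfloor>) \<le> b - a" using assms(4) by simp
  ultimately show ?thesis by linarith
qed

text \<open>Mean value theorem for t^(-s) on [t, t + 1]; there z < 3 t because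
  \<open>t \<ge> 1 / 2\<close>. The right-hand side telescopes, which replaces an integral
  comparison.\<close>

lemma powr_diff_ge:
  fixes t s :: real
  assumes "1 / 2 \<le> t" "0 < s"
  shows "t powr (- (1 + s)) \<le> 3 powr (1 + s) / s * (t powr (- s) - (t + 1) powr (- s))"
proof -
  have "\<exists>z>t. z < t + 1 \<and> (t + 1) powr (- s) - t powr (- s) = (t + 1 - t) * (- s * z powr (- s - 1))"
    using assms by (intro MVT2) (auto intro!: derivative_eq_intros)
  then obtain z where z: "t < z" "z < t + 1" "t powr (- s) - (t + 1) powr (- s) = s * z powr (- s - 1)" by auto
  have "t powr (- (1 + s)) = 3 powr (1 + s) * (3 * t) powr (- (1 + s))"
  proof -
    have "3 powr (1 + s) * 3 powr (- (1 + s)) = (1::real)" by (simp only: powr_add[symmetric]) simp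
    moreover have "(3 * t) powr (- (1 + s)) = 3 powr (- (1 + s)) * t powr (- (1 + s))"
      using assms by (intro powr_mult)
    ultimately show ?thesis by (simp only: mult.assoc[symmetric] mult_1)
  qed
  also have "\<dots> \<le> 3 powr (1 + s) * z powr (- (1 + s))"
    using assms z by (intro mult_left_mono powr_mono2') auto
  also have "z powr (- (1 + s)) = (t powr (- s) - (t + 1) powr (- s)) / s"
  proof -
    have "- (1 + s) = - s - 1" by simp
    then show ?thesis using z(3) assms by (simp only:) simp
  qed
  finally show ?thesis by simp
qed

text \<open>Elements of \<open>NN r\<close> with \<open>2 \<le> r\<close> are at least 1/2, so the
  telescoping bound applies to every term. Its factor \<open>1 / s\<close> is where the constant
  degenerates as \<alpha> tends to k/2.\<close>

lemma sum_tail_le: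
  assumes "finite T" "T \<subseteq> NN r" "2 \<le> r" "0 \<le> Y" "0 < s"
  shows "(\<Sum>u\<in>T. (u + Y) powr (- (1 + s))) \<le> 3 powr (1 + s) / s * (1 / 2 + Y) powr (- s)"
proof -
  define h where "h = (real r - 1) / 2"
  have h: "1 / 2 \<le> h" using assms(3) by (simp add: h_def)
  define N where "N = {n. real n + h \<in> T}"
  have T: "T = (\<lambda>n. real n + h) ` N"
    using assms(2) by (auto simp: N_def h_def NN_def image_iff)
  have inj: "inj_on (\<lambda>n. real n + h) N" by (auto simp: inj_on_def)
  have fN: "finite N" using assms(1) inj unfolding T by (rule finite_imageD)
  then obtain J where J: "N \<subseteq> {..<J}" using finite_nat_iff_bounded by blast
  define f where "f n = (real n + h + Y) powr (- s)" for n
  have "(\<Sum>u\<in>T. (u + Y) powr (- (1 + s))) = (\<Sum>n\<in>N. (real n + h + Y) powr (- (1 + s)))"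
    unfolding T by (simp add: sum.reindex[OF inj])
  also have "\<dots> \<le> (\<Sum>n<J. (real n + h + Y) powr (- (1 + s)))"
    using J by (intro sum_mono2) auto
  also have "\<dots> \<le> (\<Sum>n<J. 3 powr (1 + s) / s * (f n - f (Suc n)))"
  proof (rule sum_mono)
    fix n
    show "(real n + h + Y) powr (- (1 + s)) \<le> 3 powr (1 + s) / s * (f n - f (Suc n))"
      using powr_diff_ge[of "real n + h + Y" s] h assms by (simp add: f_def algebra_simps)
  qed
  also have "\<dots> = 3 powr (1 + s) / s * (f 0 - f J)"
    by (simp only: sum_distrib_left[symmetric] sum_lessThan_telescope')
  also have "\<dots> \<le> 3 powr (1 + s) / s * (1 / 2 + Y) powr (- s)"
  proof (rule mult_left_mono)
    have "f 0 \<le> (1 / 2 + Y) powr (- s)" using h assms by (auto simp: f_def intro!: powr_mono2')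
    moreover have "0 \<le> f J" by (simp add: f_def)
    ultimately show "f 0 - f J \<le> (1 / 2 + Y) powr (- s)" by linarith
  qed (use assms in auto)
  finally show ?thesis .
qed

section \<open>Arithmetic of a spectral cluster\<close>

locale cluster =
  fixes \<epsilon> :: real and d k :: nat
  assumes eps: "0 < \<epsilon>" "\<epsilon> < 1" and k: "1 \<le> k" "k < d"
begin

definition "kap = ((real d - 1) / 2)^2 - ((real k - 1) / 2)^2"
definition "C0 = 4 + kap"
text \<open>Width of the middle range \<open>mid\<close>, chosen so that outside it the gap
  \<open>g\<close> stays at least \<open>i^2 / 4\<close> in absolute value.\<close>

definition "a = 4 * C0"

lemma kap_nonneg: "0 \<le> kap"
  using k unfolding kap_def by (simp add: power_mono)

lemma C0: "4 \<le> C0" and a: "16 \<le> a" using kap_nonneg by (auto simp: C0_def a_def)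

context
  fixes i :: nat
  assumes i: "1 \<le> i"
begin

abbreviation "cl \<equiv> cluster_set \<epsilon> d k i"

lemma i_real: "1 \<le> real i" using i by simp

lemma finite_cl: "finite cl" using finite_cluster_set k by auto

context
  fixes l m assumes lm: "(l, m) \<in> cl"
begin

lemma cl_index: "l \<in> NN d" "m \<in> NN k" "m + (real d - real k) / 2 \<le> l" "\<epsilon> * l \<le> m"
  "real i ^ 2 + kap \<le> l^2 - m^2" "l^2 - m^2 \<le> (real i + 1)^2 + kap"
  "eigval2 d k l m = l^2 - m^2 - kap"
  using lm by (auto simp: cluster_set_def I_set_def eigval2_def eigval_def kap_def)

lemma cl_basic: "0 < m" "1 / 2 \<le> l - m" "m < l" "1 \<le> l" "l - m \<in> NN (d - k + 1)"
proof -
  have m0: "0 \<le> m" using cl_index(2) k by (auto simp: NN_def)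
  have "real k + 1 \<le> real d" using k by linarith
  then have "1 / 2 \<le> (real d - real k) / 2" by simp
  then show h: "1 / 2 \<le> l - m" using cl_index(3) by linarith
  then show ml: "m < l" by linarith
  have "0 < \<epsilon> * l" using m0 ml eps by simp
  then show "0 < m" using cl_index(4) by linarith
  have "real i ^ 2 \<le> l^2 - m^2" using cl_index(5) kap_nonneg by simp
  moreover have "1 \<le> real i ^ 2" using i_real by simp
  ultimately have "1 \<le> l^2" using zero_le_power2[of m] by linarith
  then show "1 \<le> l" using m0 ml power2_le_imp_le[of 1 l] by simp
  obtain x y where x: "l = real x + (real d - 1) / 2" and y: "m = real y + (real k - 1) / 2"
    using cl_index(1,2) by (auto simp: NN_def)
  have "real y \<le> real x" using cl_index(3) unfolding x y by (simp add: field_simps)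
  then have "y \<le> x" by simp
  then have "real (x - y) = real x - real y" by (rule of_nat_diff)
  moreover have "real (d - k + 1) - 1 = real d - real k" using k by (simp add: of_nat_diff)
  ultimately have "l - m = real (x - y) + (real (d - k + 1) - 1) / 2"
    unfolding x y by (simp add: field_simps)
  then show "l - m \<in> NN (d - k + 1)" unfolding NN_def by blast
qed

lemma cl_size: "real i ^ 2 \<le> l^2 - m^2" "l^2 - m^2 \<le> C0 * real i ^ 2" "real i \<le> l"
  "real i ^ 2 \<le> 2 * (l - m) * l" "(l - m) * l \<le> C0 * real i ^ 2" "l - m \<le> C0 * real i"
proof -
  show 1: "real i ^ 2 \<le> l^2 - m^2" using cl_index(5) kap_nonneg by simp
  have "(real i + 1)^2 \<le> (2 * real i)^2" using i_real by (intro power_mono) auto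
  moreover have "kap * 1 \<le> kap * real i ^ 2" using kap_nonneg i_real by (intro mult_left_mono) auto
  ultimately show 2: "l^2 - m^2 \<le> C0 * real i ^ 2" using cl_index(6) by (simp add: C0_def distrib_right power_mult_distrib)
  have "real i ^ 2 \<le> l^2" using 1 zero_le_power2[of m] by linarith
  then show "real i \<le> l" using cl_basic(4) by (intro power2_le_imp_le[of "real i" l]) auto
  have e: "l^2 - m^2 = (l - m) * (l + m)" by (simp add: power2_eq_square algebra_simps)
  have "(l - m) * (l + m) \<le> (l - m) * (2 * l)" using cl_basic by (intro mult_left_mono) auto
  then show "real i ^ 2 \<le> 2 * (l - m) * l" using 1 e by linarith
  have "(l - m) * l \<le> (l - m) * (l + m)" using cl_basic by (intro mult_left_mono) auto
  then show "(l - m) * l \<le> C0 * real i ^ 2" using 2 e by linarith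
  have "(l - m) * (l - m) \<le> (l - m) * (l + m)" using cl_basic by (intro mult_left_mono) auto
  then have "(l - m)^2 \<le> C0 * real i ^ 2" using 2 e by (simp add: power2_eq_square)
  also have "\<dots> \<le> C0^2 * real i ^ 2" using C0 by (intro mult_right_mono) (auto simp: power2_eq_square)
  finally have "(l - m)^2 \<le> (C0 * real i)^2" by (simp add: power_mult_distrib)
  then show "l - m \<le> C0 * real i" using C0 i_real by (intro power2_le_imp_le[of "l - m"]) auto
qed

text \<open>This uses m >= \<epsilon> l. For fixed L = l^2 - m^2 and \<nu> = l - m one has 2 l =
  \<nu> + L / \<nu>, which is strictly decreasing in \<nu> once L / \<nu>^2 stays above 1; the
  factor \<open>1 + 2 * \<epsilon>\<close> makes this quantitative.\<close>

lemma cl_gap: "(1 + 2 * \<epsilon>) * (l - m)^2 \<le> l^2 - m^2"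
proof -
  have "2 * \<epsilon> * (l - m) \<le> 2 * m"
  proof -
    have "\<epsilon> * (l - m) \<le> \<epsilon> * l" using cl_basic eps by (intro mult_left_mono) auto
    then show ?thesis using cl_index(4) by simp
  qed
  then have "(l - m) * (2 * \<epsilon> * (l - m)) \<le> (l - m) * (2 * m)" using cl_basic by (intro mult_left_mono) auto
  then show ?thesis by (simp add: power2_eq_square algebra_simps)
qed

end

lemma nu_half: "p \<in> cl \<Longrightarrow> 1 / 2 \<le> fst p - snd p"
  using cl_basic(2)[of "fst p" "snd p"] by simp

lemma nu_NN: "p \<in> cl \<Longrightarrow> fst p - snd p \<in> NN (d - k + 1)"
  using cl_basic(5)[of "fst p" "snd p"] by simp

lemma nu_le: "p \<in> cl \<Longrightarrow> fst p - snd p \<le> C0 * real i"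
  using cl_size(6)[of "fst p" "snd p"] by simp

text \<open>For fixed \<nu> the difference l^2 - m^2 = 2 \<nu> l - \<nu>^2 is affine in l and
  confined to an interval of length \<open>2 * i + 1\<close>. The extra 1 in counting points is
  absorbed through \<open>\<nu> \<le> C0 * real i\<close>.\<close>

lemma card_fiber:
  assumes nu: "1 / 2 \<le> \<nu>" "\<nu> \<le> C0 * real i" and U: "U \<subseteq> cl"
  shows "real (card {p \<in> U. fst p - snd p = \<nu>}) \<le> (2 + C0) * (real i / \<nu>)"
proof -
  let ?S = "{p \<in> U. fst p - snd p = \<nu>}"
  have inj: "inj_on fst ?S" by (auto simp: inj_on_def)
  have fin: "finite ?S" using finite_subset[OF U finite_cl] by simp
  define A where "A = (real i ^ 2 + kap + \<nu>^2) / (2 * \<nu>)"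
  have sub: "fst ` ?S \<subseteq> {A..A + (2 * real i + 1) / (2 * \<nu>)}"
  proof
    fix l assume "l \<in> fst ` ?S"
    then obtain m where m: "(l, m) \<in> cl" "l - m = \<nu>" using U by auto
    have "l^2 - m^2 = 2 * \<nu> * l - \<nu>^2" unfolding m(2)[symmetric] by (simp add: power2_eq_square algebra_simps)
    then have "real i ^ 2 + kap + \<nu>^2 \<le> l * (2 * \<nu>)" "l * (2 * \<nu>) \<le> real i ^ 2 + kap + \<nu>^2 + (2 * real i + 1)"
      using cl_index(5,6)[OF m(1)] by (auto simp: power2_eq_square algebra_simps)
    then have "A \<le> l" "l \<le> (real i ^ 2 + kap + \<nu>^2 + (2 * real i + 1)) / (2 * \<nu>)"
      using nu by (auto simp: A_def pos_divide_le_eq pos_le_divide_eq)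
    then show "l \<in> {A..A + (2 * real i + 1) / (2 * \<nu>)}" by (simp add: A_def add_divide_distrib)
  qed
  have "real (card ?S) = real (card (fst ` ?S))" by (simp add: card_image[OF inj])
  also have "\<dots> \<le> (2 * real i + 1) / (2 * \<nu>) + 1"
  proof -
    have "fst ` ?S \<subseteq> NN d" using U cl_index(1) by force
    then show ?thesis using card_spaced_le[OF _ _ sub] fin nu by simp
  qed
  also have "\<dots> \<le> 2 * (real i / \<nu>) + C0 * (real i / \<nu>)"
  proof (rule add_mono)
    have "(2 * real i + 1) / (2 * \<nu>) \<le> (4 * real i) / (2 * \<nu>)"
      using nu i_real by (intro divide_right_mono) auto
    then show "(2 * real i + 1) / (2 * \<nu>) \<le> 2 * (real i / \<nu>)" by simp
    show "1 \<le> C0 * (real i / \<nu>)" using nu by (simp add: pos_le_divide_eq)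
  qed
  finally show ?thesis by (simp only: distrib_right)
qed

lemma sum_by_nu:
  assumes U: "U \<subseteq> cl" and F: "\<And>\<nu>. 0 \<le> F \<nu>"
  shows "(\<Sum>p\<in>U. F (fst p - snd p)) \<le> (\<Sum>\<nu>\<in>(\<lambda>p. fst p - snd p) ` U. (2 + C0) * (real i / \<nu>) * F \<nu>)"
proof -
  have fU: "finite U" using finite_subset[OF U finite_cl] .
  have "(\<Sum>p\<in>U. F (fst p - snd p)) = (\<Sum>\<nu>\<in>(\<lambda>p. fst p - snd p) ` U. \<Sum>p\<in>{p \<in> U. fst p - snd p = \<nu>}. F (fst p - snd p))"
    by (rule sum.image_gen[OF fU])
  also have "\<dots> = (\<Sum>\<nu>\<in>(\<lambda>p. fst p - snd p) ` U. real (card {p \<in> U. fst p - snd p = \<nu>}) * F \<nu>)"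
    by (intro sum.cong refl) simp
  also have "\<dots> \<le> (\<Sum>\<nu>\<in>(\<lambda>p. fst p - snd p) ` U. (2 + C0) * (real i / \<nu>) * F \<nu>)"
  proof (intro sum_mono mult_right_mono F)
    fix \<nu> assume "\<nu> \<in> (\<lambda>p. fst p - snd p) ` U"
    then obtain p where "p \<in> cl" "\<nu> = fst p - snd p" using U by blast
    then show "real (card {p \<in> U. fst p - snd p = \<nu>}) \<le> (2 + C0) * (real i / \<nu>)"
      using nu_half nu_le by (intro card_fiber U) simp_all
  qed
  finally show ?thesis .
qed

section \<open>The sum over a cluster, split according to the distance from the turning
  point\<close>

context
  fixes z s :: real and K :: nat
  assumes z: "0 \<le> z" "z \<le> 1" and s: "0 < s" and K: "1 + s \<le> 2 * real K"
begin

text \<open>In the cluster l is comparable to i^2 / \<nu>, so the turning point l z = sqrt(l^2 -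
  m^2), of order i, lies at \<nu> of order \<open>Y\<close>.\<close>

definition "Y = real i * z"

definition "g p = (fst p)^2 - (snd p)^2 - (fst p)^2 * z^2"

text \<open>The summand of the theorem after the powers of \<open>i\<close> are taken out:
  \<open>s\<close> collects all powers of \<open>l\<close>, and \<open>i^2\<close> replaces the
  comparable l^2 - m^2 in the decay factor.\<close>

definition "h p = fst p powr s / (sqrt (fst p + \<bar>g p\<bar>) * (1 + (fst p)^2 * z^2 / (real i)\<^sup>2) ^ K)"

lemma Y_nonneg: "0 \<le> Y" using z by (simp add: Y_def)

definition "mid = {p \<in> cl. Y \<le> a * (fst p - snd p) \<and> fst p - snd p \<le> a * Y}"

text \<open>Here l^s is at most of order (i^2 / \<nu>)^s, the square root is at least i / 2, and the
  decay factor is at most a multiple of (1 + Y / \<nu>)^(-2K). Since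
  \<open>1 + s \<le> 2 * K\<close>, this leaves \<nu> (\<nu> + Y)^(-1-s).\<close>

lemma h_out:
  assumes p: "(l, m) \<in> cl - mid"
  shows "h (l, m) \<le> 2 * C0 powr s * 8 ^ K * (real i powr (2 * s)) / real i * ((l - m) * (l - m + Y) powr (- (1 + s)))"
proof -
  have lm: "(l, m) \<in> cl" using p by simp
  define \<nu> where "\<nu> = l - m"
  have nu: "1 / 2 \<le> \<nu>" "0 < \<nu>" using cl_basic[OF lm] by (auto simp: \<nu>_def)
  have l0: "0 < l" using cl_basic[OF lm] by simp
  have i0: "0 < real i" using i_real by simp
  have z2: "real i ^ 2 * z^2 = Y^2" by (simp add: Y_def power_mult_distrib)
  have up: "l * \<nu> \<le> C0 * real i ^ 2" using cl_size(5)[OF lm] by (simp add: \<nu>_def mult.commute)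
  have lo: "real i ^ 2 \<le> 2 * \<nu> * l" using cl_size(4)[OF lm] by (simp add: \<nu>_def)
  have lo2: "real i ^ 2 * Y^2 \<le> 4 * \<nu>^2 * (l^2 * z^2)"
  proof -
    have "(real i ^ 2 * z)^2 \<le> (2 * \<nu> * l * z)^2" using lo z by (intro power_mono mult_right_mono) auto
    moreover have "(real i ^ 2 * z)^2 = real i ^ 2 * Y^2" by (simp add: Y_def power2_eq_square)
    ultimately show ?thesis by (simp add: power_mult_distrib)
  qed
  \<comment> \<open>If \<nu> is far below \<open>Y\<close>, then l is so large that
    \<open>l^2 * z^2\<close> exceeds l^2 - m^2 several times; if \<nu> is far above
    \<open>Y\<close>, that term is negligible.\<close>
  have gi: "real i ^ 2 / 4 \<le> l + \<bar>g (l, m)\<bar>"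
  proof (cases "a * \<nu> < Y")
    case True
    have "(a * \<nu>)^2 \<le> Y^2" using True a nu by (intro power_mono) auto
    then have "real i ^ 2 * (a * \<nu>)^2 \<le> real i ^ 2 * Y^2" by (intro mult_left_mono) auto
    then have "\<nu>^2 * (a^2 * real i ^ 2) \<le> \<nu>^2 * (4 * (l^2 * z^2))" using lo2 by (simp add: power_mult_distrib mult_ac)
    then have "a^2 * real i ^ 2 \<le> 4 * (l^2 * z^2)" using nu by simp
    then have b: "4 * C0^2 * real i ^ 2 \<le> l^2 * z^2" by (simp add: a_def power_mult_distrib mult_ac)
    have "2 * C0 * real i ^ 2 \<le> 4 * C0^2 * real i ^ 2"
      using C0 by (intro mult_right_mono) (auto simp: power2_eq_square)
    moreover have "4 * real i ^ 2 \<le> C0 * real i ^ 2" using C0 by (intro mult_right_mono) auto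
    moreover have "0 \<le> real i ^ 2" by simp
    ultimately have "real i ^ 2 \<le> - g (l, m)" 
      unfolding g_def fst_conv snd_conv using b cl_size(2)[OF lm] by linarith
    then show ?thesis using l0 zero_le_power2[of "real i"] by linarith
  next
    case False
    then have "a * Y < \<nu>" using p by (auto simp: mid_def \<nu>_def)
    then have "(4 * C0 * Y)^2 \<le> \<nu>^2" using C0 Y_nonneg by (intro power_mono) (auto simp: a_def)
    then have y: "16 * C0^2 * Y^2 \<le> \<nu>^2" by (simp add: power_mult_distrib)
    have "(l * \<nu>)^2 \<le> (C0 * real i ^ 2)^2" using up l0 nu by (intro power_mono) auto
    then have "z^2 * (l * \<nu>)^2 \<le> z^2 * (C0 * real i ^ 2)^2" by (intro mult_left_mono) auto
    also have "\<dots> = C0^2 * real i ^ 2 * (real i ^ 2 * z^2)" by (simp add: power2_eq_square)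
    also have "\<dots> = real i ^ 2 * (C0^2 * Y^2)" by (simp only: z2) simp
    also have "\<dots> \<le> real i ^ 2 * (\<nu>^2 / 16)" using y by (intro mult_left_mono) auto
    finally have "\<nu>^2 * (l^2 * z^2) \<le> \<nu>^2 * (real i ^ 2 / 16)" by (simp add: power_mult_distrib mult_ac)
    then have "l^2 * z^2 \<le> real i ^ 2 / 16" using nu by simp
    moreover have "0 \<le> real i ^ 2" by simp
    ultimately have "real i ^ 2 / 4 \<le> g (l, m)"
      unfolding g_def fst_conv snd_conv using cl_size(1)[OF lm] by linarith
    then show ?thesis using l0 by linarith
  qed
  have sq: "1 / sqrt (l + \<bar>g (l, m)\<bar>) \<le> 2 / real i"
  proof -
    have "sqrt ((real i / 2)^2) \<le> sqrt (l + \<bar>g (l, m)\<bar>)" using gi by (intro real_sqrt_le_mono) (simp add: power_divide)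
    then have "real i / 2 \<le> sqrt (l + \<bar>g (l, m)\<bar>)" by simp
    moreover have "0 < real i / 2" using i0 by simp
    ultimately have "1 / sqrt (l + \<bar>g (l, m)\<bar>) \<le> 1 / (real i / 2)" using l0 by (intro divide_left_mono) auto
    then show ?thesis by simp
  qed
  have ls: "l powr s \<le> C0 powr s * real i powr (2 * s) * \<nu> powr (- s)"
  proof -
    have "l \<le> C0 * real i ^ 2 / \<nu>" using up nu by (simp add: pos_le_divide_eq)
    then have "l powr s \<le> (C0 * real i ^ 2 / \<nu>) powr s" using l0 s by (intro powr_mono2) auto
    also have "\<dots> = (C0 * (real i)\<^sup>2) powr s / \<nu> powr s" using C0 nu by (simp add: powr_divide)
    also have "(C0 * (real i)\<^sup>2) powr s = C0 powr s * ((real i)\<^sup>2) powr s" using C0 by (simp add: powr_mult)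
    also have "C0 powr s * ((real i)\<^sup>2) powr s / \<nu> powr s = C0 powr s * ((real i)\<^sup>2) powr s * \<nu> powr (- s)"
      by (simp only: powr_minus divide_inverse)
    also have "((real i)\<^sup>2) powr s = real i powr (2 * s)"
    proof -
      have "real i ^ 2 = real i powr 2" using i0 by simp
      then show ?thesis by (simp only: powr_powr)
    qed
    finally show ?thesis .
  qed
  define E where "E = 1 + l^2 * z^2 / real i ^ 2"
  have E1: "1 \<le> E" by (simp add: E_def)
  have dec: "1 / E ^ K \<le> 8 ^ K * (\<nu> powr (1 + s) * (\<nu> + Y) powr (- (1 + s)))"
  proof -
    define q where "q = (\<nu> + Y) / \<nu>"
    have q1: "1 \<le> q" using nu Y_nonneg by (simp add: q_def)
    have "Y^2 / (4 * \<nu>^2) \<le> l^2 * z^2 / real i ^ 2"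
      using lo2 nu i0 by (simp add: divide_simps) (simp add: mult_ac)
    moreover have "(\<nu> + Y)^2 \<le> 2 * \<nu>^2 + 2 * Y^2" using zero_le_power2[of "\<nu> - Y"] by (simp add: power2_eq_square algebra_simps)
    then have "q^2 \<le> (2 * \<nu>^2 + 2 * Y^2) / \<nu>^2" unfolding q_def power_divide by (intro divide_right_mono) auto
    then have "q^2 \<le> 2 + 2 * (Y^2 / \<nu>^2)" using nu by (simp add: add_divide_distrib)
    moreover have "Y^2 / (4 * \<nu>^2) = (Y^2 / \<nu>^2) / 4" by simp
    ultimately have "Y^2 / \<nu>^2 / 4 \<le> l^2 * z^2 / real i ^ 2" "q^2 \<le> 2 + 2 * (Y^2 / \<nu>^2)" by (simp_all only:)
    then have "q^2 \<le> 8 * E" unfolding E_def by (rule quarter_bound)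
    then have "(q\<^sup>2) ^ K \<le> (8 * E) ^ K" by (intro power_mono) auto
    then have "q ^ (2 * K) \<le> 8 ^ K * E ^ K" by (simp add: power_mult power_mult_distrib)
    moreover have "q powr (1 + s) \<le> q powr (real (2 * K))" using q1 K by (intro powr_mono) auto
    moreover have "q powr (real (2 * K)) = q ^ (2 * K)" using q1 by (subst powr_realpow) auto
    ultimately have "q powr (1 + s) \<le> 8 ^ K * E ^ K" by simp
    then have "1 / E ^ K \<le> 8 ^ K * (1 / q powr (1 + s))"
      using E1 q1 by (simp add: divide_simps mult.commute)
    also have "1 / q powr (1 + s) = \<nu> powr (1 + s) * (\<nu> + Y) powr (- (1 + s))"
    proof -
      have "q powr (1 + s) = (\<nu> + Y) powr (1 + s) / \<nu> powr (1 + s)"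
        unfolding q_def using nu Y_nonneg by (simp add: powr_divide)
      moreover have "(\<nu> + Y) powr (- (1 + s)) = 1 / (\<nu> + Y) powr (1 + s)" by (simp only: powr_minus inverse_eq_divide)
      ultimately show ?thesis by (simp only: divide_divide_eq_right mult_1 times_divide_eq_right mult_1_right)
    qed
    finally show ?thesis .
  qed
  have "h (l, m) = l powr s * (1 / sqrt (l + \<bar>g (l, m)\<bar>)) * (1 / E ^ K)"
    by (simp add: h_def E_def)
  also have "\<dots> \<le> (C0 powr s * real i powr (2 * s) * \<nu> powr (- s)) * (2 / real i) * (8 ^ K * (\<nu> powr (1 + s) * (\<nu> + Y) powr (- (1 + s))))"
    using ls sq dec E1 l0 by (intro mult_mono mult_nonneg_nonneg) auto
  also have "\<dots> = 2 * C0 powr s * 8 ^ K * (real i powr (2 * s)) / real i * ((\<nu> powr (- s) * \<nu> powr (1 + s)) * (\<nu> + Y) powr (- (1 + s)))"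
    by (simp add: mult_ac)
  also have "\<nu> powr (- s) * \<nu> powr (1 + s) = \<nu>"
    using nu by (simp add: powr_add[symmetric])
  finally show ?thesis by (simp add: \<nu>_def)
qed

definition "Cout = 2 * C0 powr s * 8 ^ K * (2 + C0) * (3 powr (1 + s) / s) * 2 powr s"

text \<open>The multiplicity of order i / \<nu> cancels both the factor \<nu> and the 1 / i of
  \<open>h_out\<close>, so that a convergent tail sum remains.\<close>

lemma sum_out: "(\<Sum>p\<in>cl - mid. h p) \<le> Cout * (real i ^ 2 / (1 + Y)) powr s"
proof -
  define c where "c = 2 * C0 powr s * 8 ^ K * (real i powr (2 * s)) / real i"
  have i0: "0 < real i" using i_real by simp
  have c0: "0 \<le> c" using C0 by (simp add: c_def)
  define F where "F \<nu> = c * \<bar>\<nu> * (\<nu> + Y) powr (- (1 + s))\<bar>" for \<nu>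
  have "(\<Sum>p\<in>cl - mid. h p) \<le> (\<Sum>p\<in>cl - mid. F (fst p - snd p))"
  proof (rule sum_mono)
    fix p assume p: "p \<in> cl - mid"
    obtain l m where lm: "p = (l, m)" by (cases p)
    have "h p \<le> c * ((l - m) * (l - m + Y) powr (- (1 + s)))"
      using h_out[of l m] p unfolding lm c_def by blast
    also have "\<dots> \<le> F (l - m)" unfolding F_def using c0 by (intro mult_left_mono) auto
    finally show "h p \<le> F (fst p - snd p)" by (simp add: lm)
  qed
  also have "\<dots> \<le> (\<Sum>\<nu>\<in>(\<lambda>p. fst p - snd p) ` (cl - mid). (2 + C0) * (real i / \<nu>) * F \<nu>)"
    using c0 by (intro sum_by_nu) (auto simp: F_def)
  also have "\<dots> = (\<Sum>\<nu>\<in>(\<lambda>p. fst p - snd p) ` (cl - mid). (2 + C0) * real i * c * (\<nu> + Y) powr (- (1 + s)))"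
  proof (rule sum.cong[OF refl])
    fix \<nu> assume "\<nu> \<in> (\<lambda>p. fst p - snd p) ` (cl - mid)"
    then have "1 / 2 \<le> \<nu>" using nu_half by blast
    then show "(2 + C0) * (real i / \<nu>) * F \<nu> = (2 + C0) * real i * c * (\<nu> + Y) powr (- (1 + s))"
      by (simp add: F_def abs_mult)
  qed
  also have "\<dots> = (2 + C0) * real i * c * (\<Sum>\<nu>\<in>(\<lambda>p. fst p - snd p) ` (cl - mid). (\<nu> + Y) powr (- (1 + s)))"
    by (rule sum_distrib_left[symmetric])
  also have "\<dots> \<le> (2 + C0) * real i * c * (3 powr (1 + s) / s * (1 / 2 + Y) powr (- s))"
  proof (intro mult_left_mono sum_tail_le[where r = "d - k + 1"])
    show "(\<lambda>p. fst p - snd p) ` (cl - mid) \<subseteq> NN (d - k + 1)" using nu_NN by blast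
  qed (use finite_cl k Y_nonneg s c0 C0 in auto)
  also have "\<dots> \<le> (2 + C0) * real i * c * (3 powr (1 + s) / s * (2 powr s * (1 + Y) powr (- s)))"
  proof (intro mult_left_mono)
    have "(1 / 2 + Y) powr (- s) \<le> ((1 + Y) / 2) powr (- s)"
      using Y_nonneg s by (intro powr_mono2') auto
    also have "\<dots> = 2 powr s * (1 + Y) powr (- s)"
    proof -
      have "((1 + Y) / 2) powr (- s) = (1 + Y) powr (- s) / 2 powr (- s)" using Y_nonneg by (simp add: powr_divide)
      moreover have "(2::real) powr (- s) = inverse (2 powr s)" by (rule powr_minus)
      ultimately show ?thesis by (simp only: divide_inverse inverse_inverse_eq mult.commute)
    qed
    finally show "(1 / 2 + Y) powr (- s) \<le> 2 powr s * (1 + Y) powr (- s)" .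
  qed (use s c0 C0 in auto)
  also have "\<dots> = Cout * (real i powr (2 * s) * (1 + Y) powr (- s))"
    using i0 by (simp add: c_def Cout_def)
  also have "real i powr (2 * s) * (1 + Y) powr (- s) = (real i ^ 2 / (1 + Y)) powr s"
  proof -
    have "real i ^ 2 = real i powr 2" using i0 by simp
    then have "((real i)\<^sup>2) powr s = real i powr (2 * s)" by (simp only: powr_powr)
    moreover have "(real i ^ 2 / (1 + Y)) powr s = ((real i)\<^sup>2) powr s / (1 + Y) powr s"
      using Y_nonneg by (simp add: powr_divide)
    ultimately show ?thesis by (simp only: powr_minus divide_inverse)
  qed
  finally show ?thesis .
qed

text \<open>Loss in passing from \<open>t\<close> to \<open>t - 1\<close>:
  \<open>t \<ge> sqrt (1 + 2 * \<epsilon>)\<close> gives \<open>t - 1 \<ge> eta * t\<close>.\<close>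

definition "eta = 1 - 1 / sqrt (1 + 2 * \<epsilon>)"
definition "c1 = eta / (2 * a ^ 3)"
definition "c2 = 3 * a^2 * C0 + 3"
text \<open>The first entry serves \<open>i \<ge> 3 / (2 * \<epsilon>)\<close>, the second one the
  remaining small \<open>i\<close>.\<close>

definition "cm = min (c1 / (c2 + 2 + 2 * a * c1)) (1 / (2 * a * (1 + C0 * (3 / (2 * \<epsilon>)))))"

lemma eta_pos: "0 < eta"
proof -
  have "1 < sqrt (1 + 2 * \<epsilon>)" using eps by simp
  then show ?thesis by (simp add: eta_def)
qed

lemma const_pos: "0 < c1" "0 < c2" "0 < cm"
proof -
  show c1: "0 < c1" using eta_pos a by (simp add: c1_def)
  show c2: "0 < c2" using a C0 by (simp add: c2_def add_nonneg_pos)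
  have "0 < c2 + 2 + 2 * a * c1" using c1 c2 a by (intro add_pos_nonneg) auto
  moreover have "0 < 1 + C0 * (3 / (2 * \<epsilon>))" using C0 eps by (intro add_pos_nonneg) auto
  ultimately show "0 < cm" using c1 a by (simp add: cm_def)
qed

text \<open>Within the cluster \<open>g\<close> is, up to an error \<open>O(l)\<close>, a strictly monotone function of \<open>l - m\<close> with slope
  about \<open>i\<^sup>2/Y\<close>. Comparing with a minimizer of \<open>|g|\<close> avoids locating its zero.\<close>

lemma mid_gap:
  assumes p: "(l, m) \<in> mid" and p': "(l', m') \<in> mid" and least: "\<bar>g (l', m')\<bar> \<le> \<bar>g (l, m)\<bar>"
  shows "cm * (1 + \<bar>(l - m) - (l' - m')\<bar>) * (real i ^ 2 / Y) \<le> l + \<bar>g (l, m)\<bar>"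
proof -
  have lm: "(l, m) \<in> cl" and lm': "(l', m') \<in> cl" using p p' by (auto simp: mid_def)
  define \<nu> where "\<nu> = l - m"
  define \<nu>' where "\<nu>' = l' - m'"
  define D where "D = \<bar>\<nu> - \<nu>'\<bar>"
  define X where "X = real i ^ 2 / Y"
  have nu: "1 / 2 \<le> \<nu>" "0 < \<nu>" "Y \<le> a * \<nu>" "\<nu> \<le> a * Y" using cl_basic[OF lm] p by (auto simp: \<nu>_def mid_def)
  have nu': "1 / 2 \<le> \<nu>'" "0 < \<nu>'" "Y \<le> a * \<nu>'" "\<nu>' \<le> a * Y" using cl_basic[OF lm'] p' by (auto simp: \<nu>'_def mid_def)
  have a0: "0 < a" using a by simp
  have "0 < a * Y" using nu by linarith
  then have Y0: "0 < Y" using a0 by (simp add: zero_less_mult_iff)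
  have i0: "0 < real i" using i_real by simp
  have X0: "0 < X" using Y0 i0 by (simp add: X_def)
  have l0: "0 < l" "0 < l'" using cl_basic[OF lm] cl_basic[OF lm'] by auto
  define G where "G = l + \<bar>g (l, m)\<bar>"
  have lb: "X \<le> 2 * a * l" "X \<le> 2 * a * l'"
  proof -
    have "real i ^ 2 \<le> 2 * \<nu> * l" using cl_size(4)[OF lm] by (simp add: \<nu>_def)
    also have "\<dots> \<le> 2 * (a * Y) * l" using nu l0 by (intro mult_right_mono) auto
    finally show "X \<le> 2 * a * l" using Y0 by (simp add: X_def pos_divide_le_eq mult_ac)
    have "real i ^ 2 \<le> 2 * \<nu>' * l'" using cl_size(4)[OF lm'] by (simp add: \<nu>'_def)
    also have "\<dots> \<le> 2 * (a * Y) * l'" using nu' l0 by (intro mult_right_mono) auto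
    finally show "X \<le> 2 * a * l'" using Y0 by (simp add: X_def pos_divide_le_eq mult_ac)
  qed
  have ub: "l \<le> C0 * a * X" "l' \<le> C0 * a * X"
  proof -
    have "Y * l \<le> a * \<nu> * l" using nu l0 by (intro mult_right_mono) auto
    also have "\<dots> \<le> a * (C0 * real i ^ 2)" using cl_size(5)[OF lm] a0 by (simp add: \<nu>_def)
    finally show "l \<le> C0 * a * X" using Y0 by (simp add: X_def pos_le_divide_eq mult_ac)
    have "Y * l' \<le> a * \<nu>' * l'" using nu' l0 by (intro mult_right_mono) auto
    also have "\<dots> \<le> a * (C0 * real i ^ 2)" using cl_size(5)[OF lm'] a0 by (simp add: \<nu>'_def)
    finally show "l' \<le> C0 * a * X" using Y0 by (simp add: X_def pos_le_divide_eq mult_ac)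
  qed
  have D0: "0 \<le> D" by (simp add: D_def)
  have lG: "l \<le> G" by (simp add: G_def)
  have base: "X \<le> 2 * a * G" using lb(1) mult_left_mono[OF lG, of "2 * a"] a0 by linarith
  have "cm * (1 + D) * X \<le> G"
  \<comment> \<open>For small \<open>i\<close> the distance \<open>D\<close> is bounded and the
    summand \<open>l\<close> of \<open>G\<close> suffices. For large \<open>i\<close> the variation
    of l^2 - m^2 within the cluster, at most \<open>3 * i\<close>, is below
    \<open>2 * \<epsilon> * i^2\<close>, so that it cannot spoil the monotonicity.\<close>
  proof (cases "3 / (2 * \<epsilon>) \<le> real i")
    case False
    have "D \<le> C0 * (3 / (2 * \<epsilon>))"
    proof -
      have "\<nu> \<le> C0 * real i" "\<nu>' \<le> C0 * real i" using cl_size(6)[OF lm] cl_size(6)[OF lm'] by (auto simp: \<nu>_def \<nu>'_def)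
      then have "D \<le> C0 * real i" using nu nu' by (auto simp: D_def)
      also have "\<dots> \<le> C0 * (3 / (2 * \<epsilon>))" using False C0 by (intro mult_left_mono) auto
      finally show ?thesis .
    qed
    define R where "R = 1 + C0 * (3 / (2 * \<epsilon>))"
    have R: "1 + D \<le> R" "0 < R" using \<open>D \<le> _\<close> D0 by (auto simp: R_def)
    have "cm * (1 + D) * X \<le> 1 / (2 * a * R) * R * (2 * a * G)"
      using base R D0 X0 const_pos a0 by (intro mult_mono mult_nonneg_nonneg) (auto simp: cm_def R_def)
    also have "\<dots> = G" using R a0 by simp
    finally show ?thesis .
  next
    case True
    define L where "L = l^2 - m^2"
    define L' where "L' = l'^2 - m'^2"
    have L: "real i ^ 2 \<le> L" "(1 + 2 * \<epsilon>) * \<nu>^2 \<le> L" "L = \<nu> * (2 * l - \<nu>)"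
      using cl_size(1)[OF lm] cl_gap[OF lm] by (auto simp: L_def \<nu>_def power2_eq_square algebra_simps)
    have L': "real i ^ 2 \<le> L'" "(1 + 2 * \<epsilon>) * \<nu>'^2 \<le> L'" "L' = \<nu>' * (2 * l' - \<nu>')"
      using cl_size(1)[OF lm'] cl_gap[OF lm'] by (auto simp: L'_def \<nu>'_def power2_eq_square algebra_simps)
    have L0: "0 < L" using L(1) i0 by (smt (verit) zero_less_power)
    have dL: "\<bar>L - L'\<bar> \<le> 3 * real i"
    proof -
      have "(real i + 1)^2 = real i ^ 2 + 2 * real i + 1" by (simp add: power2_eq_square algebra_simps)
      then show ?thesis
        using cl_index(5,6)[OF lm] cl_index(5,6)[OF lm'] i_real unfolding L_def L'_def abs_le_iff by linarith
    qed
    \<comment> \<open>Minus the difference quotient of L / \<nu> in \<nu>. As 2 l = \<nu> + L /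
      \<nu>, the pairs separate in l at rate \<open>t - 1\<close>, up to the effect of
      \<open>L - L'\<close>.\<close>
    define t where "t = L / (\<nu> * \<nu>')"
    have t0: "0 < t" using L0 nu nu' by (simp add: t_def)
    have tl: "sqrt (1 + 2 * \<epsilon>) \<le> t"
    proof -
      have "L' \<le> L * (1 + 2 * \<epsilon>)"
      proof -
        have "3 * real i \<le> 2 * \<epsilon> * real i * real i"
          using True eps i0 by (intro mult_right_mono) (auto simp: pos_divide_le_eq mult.commute)
        also have "\<dots> \<le> 2 * \<epsilon> * L" using L(1) eps by (simp add: power2_eq_square)
        finally show ?thesis using dL by (simp add: algebra_simps abs_le_iff)
      qed
      then have "L * L' \<le> L * (L * (1 + 2 * \<epsilon>))" using L0 by (intro mult_left_mono) auto
      moreover have "((1 + 2 * \<epsilon>) * \<nu>^2) * ((1 + 2 * \<epsilon>) * \<nu>'^2) \<le> L * L'"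
        using L L' L0 eps by (intro mult_mono) auto
      ultimately have "(1 + 2 * \<epsilon>) * ((1 + 2 * \<epsilon>) * (\<nu> * \<nu>')^2) \<le> (1 + 2 * \<epsilon>) * L^2"
        by (simp add: power2_eq_square mult_ac)
      then have "(1 + 2 * \<epsilon>) * (\<nu> * \<nu>')^2 \<le> L^2" using eps by simp
      then have "1 + 2 * \<epsilon> \<le> t^2" using nu nu' by (simp add: t_def power_divide pos_le_divide_eq)
      then show ?thesis using t0 by (simp add: real_le_lsqrt)
    qed
    have t1: "eta * t \<le> t - 1"
    proof -
      have "1 < sqrt (1 + 2 * \<epsilon>)" using eps by simp
      then have "1 \<le> t / sqrt (1 + 2 * \<epsilon>)" using tl by (simp add: pos_le_divide_eq)
      then show ?thesis by (simp add: eta_def algebra_simps)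
    qed
    have tY: "X / (a^2 * Y) \<le> t"
    proof -
      have "\<nu> * \<nu>' \<le> (a * Y) * (a * Y)" using nu nu' by (intro mult_mono) auto
      then have "real i ^ 2 / ((a * Y) * (a * Y)) \<le> L / (\<nu> * \<nu>')"
        using L(1) L0 nu nu' by (intro frac_le) auto
      then show ?thesis by (simp add: t_def X_def power2_eq_square mult_ac)
    qed
    have id: "2 * (l - l') = (\<nu>' - \<nu>) * (t - 1) + (L - L') / \<nu>'"
    proof -
      have "2 * l = \<nu> + L / \<nu>" using nu L(3) by simp
      moreover have "2 * l' = \<nu>' + L' / \<nu>'" using nu' L'(3) by simp
      moreover have "L / \<nu> - L / \<nu>' = (\<nu>' - \<nu>) * t" using nu nu' by (simp add: t_def field_simps)
      ultimately show ?thesis by (simp add: algebra_simps diff_divide_distrib)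
    qed
    have dl: "D * (eta * (X / (a^2 * Y))) - 3 * a * (real i / Y) \<le> 2 * \<bar>l - l'\<bar>"
    proof -
      have "\<bar>(L - L') / \<nu>'\<bar> \<le> 3 * real i / (Y / a)"
        unfolding abs_divide using dL nu' Y0 a0 by (intro frac_le) (auto simp: pos_divide_le_eq mult.commute)
      then have r: "\<bar>(L - L') / \<nu>'\<bar> \<le> 3 * a * (real i / Y)" by (simp add: mult_ac)
      have "eta * (X / (a^2 * Y)) \<le> t - 1" using t1 mult_left_mono[OF tY, of eta] eta_pos by linarith
      then have "D * (eta * (X / (a^2 * Y))) \<le> D * (t - 1)" using D0 by (intro mult_left_mono)
      also have "\<dots> = \<bar>(\<nu>' - \<nu>) * (t - 1)\<bar>"
      proof -
        have "0 \<le> t - 1" using t1 mult_pos_pos[OF eta_pos t0] by linarith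
        then show ?thesis by (simp only: abs_mult D_def abs_minus_commute[of \<nu>] abs_of_nonneg)
      qed
      also have "\<dots> \<le> \<bar>2 * (l - l')\<bar> + \<bar>(L - L') / \<nu>'\<bar>" unfolding id by linarith
      also have "\<bar>2 * (l - l')\<bar> = 2 * \<bar>l - l'\<bar>" by (simp only: abs_mult abs_numeral)
      finally show ?thesis using r by linarith
    qed
    have q: "D * (eta * (X / (a^2 * Y))) * (X / a) - 3 * a * (real i / Y) * (2 * C0 * a * X) \<le> 2 * \<bar>l^2 - l'^2\<bar>"
    proof -
      have lo: "X / a \<le> l + l'" using lb a0 by (simp add: pos_divide_le_eq algebra_simps)
      have hi: "l + l' \<le> 2 * C0 * a * X" using ub by simp
      have "D * (eta * (X / (a^2 * Y))) * (X / a) \<le> D * (eta * (X / (a^2 * Y))) * (l + l')"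
        using lo D0 eta_pos X0 a0 Y0 by (intro mult_left_mono) auto
      moreover have "3 * a * (real i / Y) * (l + l') \<le> 3 * a * (real i / Y) * (2 * C0 * a * X)"
        using hi a0 Y0 by (intro mult_left_mono) auto
      moreover have "(D * (eta * (X / (a^2 * Y))) - 3 * a * (real i / Y)) * (l + l') \<le> 2 * \<bar>l - l'\<bar> * (l + l')"
        using dl l0 by (intro mult_right_mono) auto
      moreover have "\<bar>l^2 - l'^2\<bar> = \<bar>l - l'\<bar> * (l + l')"
        using l0 by (simp add: power2_eq_square square_diff_square_factored abs_mult mult.commute)
      ultimately show ?thesis by (simp add: left_diff_distrib)
    qed
    have z2: "z^2 = Y / X" using Y0 i0 by (simp add: X_def Y_def power2_eq_square)
    have "z^2 * (D * (eta * (X / (a^2 * Y))) * (X / a) - 3 * a * (real i / Y) * (2 * C0 * a * X)) \<le> z^2 * (2 * \<bar>l^2 - l'^2\<bar>)"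
      by (intro mult_left_mono q) auto
    also have "z^2 * (D * (eta * (X / (a^2 * Y))) * (X / a) - 3 * a * (real i / Y) * (2 * C0 * a * X))
        = 2 * (c1 * D * X) - 2 * (3 * a^2 * C0 * real i)"
      unfolding z2 c1_def using X0 Y0 a0 by (simp add: field_simps power2_eq_square power3_eq_cube)
    finally have "c1 * D * X - 3 * a^2 * C0 * real i \<le> z^2 * \<bar>l^2 - l'^2\<bar>" by simp
    also have "\<dots> \<le> \<bar>g (l, m)\<bar> + \<bar>g (l', m')\<bar> + \<bar>L - L'\<bar>"
    proof -
      have "z^2 * (l^2 - l'^2) = (L - L') - (g (l, m) - g (l', m'))"
        by (simp add: g_def L_def L'_def algebra_simps)
      moreover have "z^2 * \<bar>l^2 - l'^2\<bar> = \<bar>z^2 * (l^2 - l'^2)\<bar>" by (simp add: abs_mult)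
      ultimately show ?thesis by linarith
    qed
    finally have "c1 * D * X \<le> 2 * \<bar>g (l, m)\<bar> + c2 * real i" using least dL by (simp add: c2_def algebra_simps)
    \<comment> \<open>What is left of the error has order \<open>i\<close>, and
      \<open>i \<le> l\<close> lets \<open>G\<close> absorb it.\<close>
    also have "\<dots> \<le> 2 * \<bar>g (l, m)\<bar> + c2 * l" using cl_size(3)[OF lm] const_pos by (intro add_left_mono mult_left_mono) auto
    also have "\<dots> \<le> (c2 + 2) * G" using l0 const_pos by (simp add: G_def algebra_simps)
    finally have "c1 * D * X + c1 * X \<le> (c2 + 2) * G + c1 * (2 * a * G)"
      using base const_pos by (intro add_mono mult_left_mono) auto
    then have fin: "c1 * (1 + D) * X \<le> (c2 + 2 + 2 * a * c1) * G" by (simp add: algebra_simps)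
    have pos: "0 < c2 + 2 + 2 * a * c1" using const_pos a0 by (intro add_pos_nonneg) auto
    have "cm * (1 + D) * X \<le> c1 / (c2 + 2 + 2 * a * c1) * (1 + D) * X"
      using D0 X0 by (intro mult_right_mono) (auto simp: cm_def)
    also have "\<dots> = c1 * (1 + D) * X / (c2 + 2 + 2 * a * c1)" by simp
    also have "\<dots> \<le> G" using fin pos by (simp add: pos_divide_le_eq mult.commute)
    finally show ?thesis .
  qed
  then show ?thesis by (simp only: D_def \<nu>_def \<nu>'_def X_def G_def)
qed

definition "Cmid = (C0 * a * (2 * a + 1)) powr s * (1 / sqrt cm) * (2 + C0) * a * 4 * sqrt (3 * a)"

text \<open>With X = i^2 / Y, each l^s is at most \<open>Q\<close>, of order X^s. The multiplicity
  of order i / Y and the sum of (X (1 + |\<nu> - \<nu>'|))^(-1/2), of order sqrt(Y / X) = Y / i,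
  cancel, so the singular range costs no more than \<open>sum_out\<close>.\<close>

lemma sum_mid: "(\<Sum>p\<in>mid. h p) \<le> Cmid * (real i ^ 2 / (1 + Y)) powr s"
proof (cases "mid = {}")
  case True
  then show ?thesis using const_pos C0 a by (simp add: Cmid_def)
next
  case False
  have fm: "finite mid" by (rule finite_subset[OF _ finite_cl]) (auto simp: mid_def)
  obtain p' where p': "p' \<in> mid" "\<And>p. p \<in> mid \<Longrightarrow> \<bar>g p'\<bar> \<le> \<bar>g p\<bar>"
  proof -
    have "Min ((\<lambda>p. \<bar>g p\<bar>) ` mid) \<in> (\<lambda>p. \<bar>g p\<bar>) ` mid" using fm False by (intro Min_in) auto
    then obtain p' where "p' \<in> mid" "\<bar>g p'\<bar> = Min ((\<lambda>p. \<bar>g p\<bar>) ` mid)" by force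
    then show ?thesis using that[of p'] fm by auto
  qed
  obtain l' m' where lm': "p' = (l', m')" by (cases p')
  define \<nu>' where "\<nu>' = l' - m'"
  have a0: "0 < a" using a by simp
  have i0: "0 < real i" using i_real by simp
  have nu': "1 / 2 \<le> \<nu>'" "\<nu>' \<le> a * Y" using p'(1) cl_basic[of l' m'] by (auto simp: lm' \<nu>'_def mid_def)
  then have aY: "1 \<le> 2 * (a * Y)" by linarith
  then have "0 < a * Y" by linarith
  then have Y0: "0 < Y" using a0 by (simp add: zero_less_mult_iff)
  define X where "X = real i ^ 2 / Y"
  have X0: "0 < X" using Y0 i0 by (simp add: X_def)
  define Q where "Q = (C0 * a * X) powr s"
  have Q_le: "Q \<le> (C0 * a * (2 * a + 1)) powr s * (real i ^ 2 / (1 + Y)) powr s"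
  proof -
    have "X \<le> (2 * a + 1) * (real i ^ 2 / (1 + Y))"
    proof -
      have "real i ^ 2 * (1 + Y) \<le> real i ^ 2 * ((2 * a + 1) * Y)" using aY by (intro mult_left_mono) (auto simp: algebra_simps)
      then show ?thesis using Y0 by (simp add: X_def divide_simps mult_ac)
    qed
    then have "C0 * a * X \<le> C0 * a * ((2 * a + 1) * (real i ^ 2 / (1 + Y)))"
      using C0 a0 by (intro mult_left_mono) auto
    then have "Q \<le> (C0 * a * (2 * a + 1) * (real i ^ 2 / (1 + Y))) powr s"
      unfolding Q_def using s C0 a0 X0 by (intro powr_mono2) (auto simp: mult_ac)
    also have "\<dots> = (C0 * a * (2 * a + 1)) powr s * (real i ^ 2 / (1 + Y)) powr s"
      using C0 a0 Y0 by (intro powr_mult)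
    finally show ?thesis .
  qed
  define F where "F \<nu> = Q * (1 / (sqrt cm * sqrt X)) * (1 / sqrt (1 + \<bar>\<nu> - \<nu>'\<bar>))" for \<nu>
  have F0: "0 \<le> F \<nu>" for \<nu> using const_pos X0 by (simp add: F_def Q_def)
  have "(\<Sum>p\<in>mid. h p) \<le> (\<Sum>p\<in>mid. F (fst p - snd p))"
  proof (rule sum_mono)
    fix p assume p: "p \<in> mid"
    obtain l m where lm: "p = (l, m)" by (cases p)
    have cl: "(l, m) \<in> cl" using p by (simp add: lm mid_def)
    have l0: "0 < l" using cl_basic[OF cl] by simp
    have "Y * l \<le> a * (l - m) * l" using p l0 by (intro mult_right_mono) (auto simp: mid_def lm)
    also have "\<dots> \<le> a * (C0 * real i ^ 2)" using cl_size(5)[OF cl] a0 by simp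
    finally have "l \<le> C0 * a * X" using Y0 by (simp add: X_def pos_le_divide_eq mult_ac)
    then have ls: "l powr s \<le> Q" unfolding Q_def using l0 s by (intro powr_mono2) auto
    have gp: "0 < cm * (1 + \<bar>(l - m) - \<nu>'\<bar>) * X" using const_pos X0 by (intro mult_pos_pos) auto
    have "cm * (1 + \<bar>(l - m) - \<nu>'\<bar>) * X \<le> l + \<bar>g (l, m)\<bar>"
      using mid_gap[of l m l' m'] p p' by (simp add: lm lm' \<nu>'_def X_def)
    then have "1 / sqrt (l + \<bar>g (l, m)\<bar>) \<le> 1 / sqrt (cm * (1 + \<bar>(l - m) - \<nu>'\<bar>) * X)"
      using gp by (intro divide_left_mono) auto
    also have "\<dots> = 1 / (sqrt cm * sqrt X) * (1 / sqrt (1 + \<bar>(l - m) - \<nu>'\<bar>))"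
      by (simp add: real_sqrt_mult mult_ac)
    finally have gs: "1 / sqrt (l + \<bar>g (l, m)\<bar>) \<le> 1 / (sqrt cm * sqrt X) * (1 / sqrt (1 + \<bar>(l - m) - \<nu>'\<bar>))" .
    define E where "E = (1 + l^2 * z^2 / (real i)\<^sup>2) ^ K"
    have "1 \<le> E" unfolding E_def by (intro one_le_power) simp
    then have "1 / E \<le> 1" by simp
    have "h p = l powr s * (1 / sqrt (l + \<bar>g (l, m)\<bar>)) * (1 / E)" by (simp add: h_def lm E_def)
    also have "\<dots> \<le> l powr s * (1 / sqrt (l + \<bar>g (l, m)\<bar>)) * 1"
      using \<open>1 / E \<le> 1\<close> l0 by (intro mult_left_mono) auto
    also have "\<dots> \<le> Q * (1 / (sqrt cm * sqrt X) * (1 / sqrt (1 + \<bar>(l - m) - \<nu>'\<bar>)))"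
      unfolding mult_1_right using ls gs l0 by (intro mult_mono) (auto simp: Q_def)
    finally show "h p \<le> F (fst p - snd p)" by (simp add: F_def lm)
  qed
  also have "\<dots> \<le> (\<Sum>\<nu>\<in>(\<lambda>p. fst p - snd p) ` mid. (2 + C0) * (real i / \<nu>) * F \<nu>)"
    by (rule sum_by_nu) (use F0 in \<open>auto simp: mid_def\<close>)
  also have "\<dots> \<le> (\<Sum>\<nu>\<in>(\<lambda>p. fst p - snd p) ` mid. (2 + C0) * (a * (real i / Y)) * F \<nu>)"
  proof (intro sum_mono mult_right_mono mult_left_mono F0)
    fix \<nu> assume "\<nu> \<in> (\<lambda>p. fst p - snd p) ` mid"
    then obtain p where "p \<in> mid" "\<nu> = fst p - snd p" by blast
    then have "Y \<le> a * \<nu>" "0 < \<nu>" using nu_half[of p] by (auto simp: mid_def)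
    then have "real i * Y \<le> real i * (a * \<nu>)" by (intro mult_left_mono) auto
    then show "real i / \<nu> \<le> a * (real i / Y)" using \<open>0 < \<nu>\<close> Y0 by (simp add: divide_simps mult_ac)
  qed (use C0 in auto)
  also have "\<dots> = (2 + C0) * (a * (real i / Y)) * Q * (1 / (sqrt cm * sqrt X)) * (\<Sum>\<nu>\<in>(\<lambda>p. fst p - snd p) ` mid. 1 / sqrt (1 + \<bar>\<nu> - \<nu>'\<bar>))"
    unfolding F_def sum_distrib_left by (intro sum.cong refl) (simp add: mult_ac)
  also have "\<dots> \<le> (2 + C0) * (a * (real i / Y)) * Q * (1 / (sqrt cm * sqrt X)) * (4 * sqrt (1 + a * Y))"
  proof (intro mult_left_mono sum_spaced_le[where r = "d - k + 1"])
    show "(\<lambda>p. fst p - snd p) ` mid \<subseteq> NN (d - k + 1)" using nu_NN unfolding mid_def by blast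
    fix \<nu> assume "\<nu> \<in> (\<lambda>p. fst p - snd p) ` mid"
    then obtain p where "p \<in> mid" "\<nu> = fst p - snd p" by blast
    then have "\<nu> \<le> a * Y" "0 < \<nu>" using nu_half[of p] by (auto simp: mid_def)
    then show "\<bar>\<nu> - \<nu>'\<bar> \<le> a * Y" using nu' by linarith
  qed (use fm C0 a0 Y0 const_pos X0 in \<open>auto simp: Q_def\<close>)
  also have "\<dots> \<le> (2 + C0) * (a * (real i / Y)) * Q * (1 / (sqrt cm * sqrt X)) * (4 * (sqrt (3 * a) * sqrt Y))"
  proof (intro mult_left_mono)
    have "sqrt (1 + a * Y) \<le> sqrt (3 * a * Y)" using aY by (intro real_sqrt_le_mono) (simp add: mult_ac)
    then show "sqrt (1 + a * Y) \<le> sqrt (3 * a) * sqrt Y" by (simp add: real_sqrt_mult)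
  qed (use C0 a0 Y0 const_pos X0 in \<open>auto simp: Q_def\<close>)
  also have "\<dots> = Q * (1 / sqrt cm) * (2 + C0) * a * 4 * sqrt (3 * a) * ((real i / Y) * (sqrt Y / sqrt X))"
    by (simp add: mult_ac)
  also have "(real i / Y) * (sqrt Y / sqrt X) = 1"
  proof -
    have "sqrt X = real i / sqrt Y" using i0 by (simp add: X_def real_sqrt_divide)
    then have "(real i / Y) * (sqrt Y / sqrt X) = (real i / Y) * (sqrt Y / (real i / sqrt Y))" by (simp only:)
    also have "\<dots> = sqrt Y * sqrt Y / Y"
    proof -
      have "(r / y) * (w / (r / w)) = w * w / y" if "r \<noteq> 0" for r y w :: real
        using that by simp
      moreover have "real i \<noteq> 0" using i0 by simp
      ultimately show ?thesis .
    qed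
    finally have "(real i / Y) * (sqrt Y / sqrt X) = sqrt Y * sqrt Y / Y" .
    moreover have "sqrt Y * sqrt Y / Y = 1" using Y0 by simp
    ultimately show ?thesis by (rule trans)
  qed
  also have "Q * (1 / sqrt cm) * (2 + C0) * a * 4 * sqrt (3 * a) * 1
      \<le> (C0 * a * (2 * a + 1)) powr s * (real i ^ 2 / (1 + Y)) powr s * (1 / sqrt cm) * (2 + C0) * a * 4 * sqrt (3 * a) * 1"
    using Q_le const_pos C0 a0 by (intro mult_right_mono) auto
  finally show ?thesis unfolding Cmid_def by (simp add: mult_ac)
qed

lemma sum_h: "(\<Sum>p\<in>cl. h p) \<le> (Cout + Cmid) * (real i ^ 2 / (1 + real i * z)) powr s"
proof -
  have "(\<Sum>p\<in>cl. h p) = (\<Sum>p\<in>cl - mid. h p) + (\<Sum>p\<in>mid. h p)"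
    by (rule sum.subset_diff[OF _ finite_cl]) (auto simp: mid_def)
  also have "\<dots> \<le> (Cout + Cmid) * (real i ^ 2 / (1 + Y)) powr s"
    using sum_out sum_mid by (simp add: distrib_right)
  finally show ?thesis by (simp add: Y_def)
qed

end
end
end

section \<open>Comparison with |x| and the final estimate\<close>

lemma le_one_minus_prod:
  fixes a :: "'a \<Rightarrow> real"
  assumes "finite I" "\<And>j. j \<in> I \<Longrightarrow> 0 \<le> a j \<and> a j \<le> 1" "j \<in> I"
  shows "a j \<le> 1 - (\<Prod>j\<in>I. 1 - a j)"
proof -
  have "(\<Prod>j\<in>I. 1 - a j) = (1 - a j) * (\<Prod>j\<in>I - {j}. 1 - a j)"
    using assms by (simp add: prod.remove)
  also have "\<dots> \<le> (1 - a j) * 1"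
    using assms by (intro mult_left_mono prod_le_1) auto
  finally show ?thesis by simp
qed

theorem proposition5p1:
  fixes \<epsilon> \<alpha> :: real and d k :: nat
  assumes "0 < \<epsilon>" and "\<epsilon> < 1"
    and "2 \<le> d" and "1 \<le> k" and "k \<le> d - 1"
    and "0 \<le> \<alpha>" and "\<alpha> < real k / 2"
  shows "\<exists>C>0. \<forall>(i::nat) (x :: nat \<Rightarrow> real).
    i \<noteq> 0 \<longrightarrow> x \<in> {k+1..d} \<rightarrow> {-1..1} \<longrightarrow>
    (\<Sum>(l, m)\<in>cluster_set \<epsilon> d k i.
        real (sph_dim k m) * X_scr d k l m x * (sqrt (eigval2 d k l m) / l) powr (2 * \<alpha>))
    \<le> C * real i ^ (d - 1) * min_inv i (L2_set x {k+1..d}) powr (real k - 2 * \<alpha>)"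
proof -
  interpret C: cluster \<epsilon> d k by standard (use assms in auto)
  define s where "s = real k - 2 * \<alpha>"
  have s: "0 < s" using assms by (simp add: s_def)
  \<comment> \<open>As \<open>s \<le> k\<close>, this decay order meets the requirement of the
    cluster sum.\<close>
  define K where "K = k + 1"
  have K: "1 + s \<le> 2 * real K" using assms by (simp add: K_def s_def)
  obtain C1 where C1: "C1 > 0" "\<And>l m x. l \<in> NN d \<Longrightarrow> m \<in> NN k \<Longrightarrow> x \<in> {k+1..d} \<rightarrow> {-1..1} \<Longrightarrow>
      m + (real d - real k) / 2 \<le> l \<Longrightarrow> \<epsilon> * l \<le> m \<Longrightarrow> X_scr d k l m x \<le> C1 * X_scr_bound K d k l m x"
  proof -
    have "k < d" using assms by simp
    then show ?thesis using X_scr_le[of k d \<epsilon> K] assms that by auto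
  qed
  define D where "D = d - k"
  define Ct where "Ct = 2 * 2 ^ (k - 1) * C1 * C.C0 ^ (D - 1) * C.C0 ^ K * 2 powr (2 * \<alpha>)"
  define Cs where "Cs = C.Cout s K + C.Cmid s"
  have C0: "4 \<le> C.C0" by (rule C.C0)
  have Ct0: "0 \<le> Ct" using C1(1) C0 by (simp add: Ct_def)
  \<comment> \<open>The absolute value and the \<open>+ 1\<close> make the constant positive; it
    depends on \<alpha> through \<open>s\<close>, \<open>Cs\<close> and \<open>Ct\<close>.\<close>
  have main: "(\<Sum>(l, m)\<in>cluster_set \<epsilon> d k i.
        real (sph_dim k m) * X_scr d k l m x * (sqrt (eigval2 d k l m) / l) powr (2 * \<alpha>))
    \<le> (\<bar>Ct * Cs * real d powr s\<bar> + 1) * real i ^ (d - 1) * min_inv i (L2_set x {k+1..d}) powr s"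
    if i: "1 \<le> i" and x: "x \<in> {k+1..d} \<rightarrow> {-1..1}" for i :: nat and x :: "nat \<Rightarrow> real"
  proof -
    define w where "w = (\<Prod>j\<in>{k+1..d}. 1 - (x j)^2)"
    define n where "n = (\<Sum>j\<in>{k+1..d}. (x j)^2)"
    \<comment> \<open>\<open>z\<close> plays the role of |x|: the Weierstrass product inequality
      gives \<open>z^2 \<le> n\<close>, and each single \<open>(x j)^2\<close> is at most
      \<open>1 - w\<close>, hence \<open>n \<le> real d * z^2\<close>.\<close>
    define z where "z = sqrt (1 - w)"
    define N where "N = L2_set x {k+1..d}"
    have i0: "1 \<le> real i" using i by simp
    have xj: "0 \<le> (x j)^2 \<and> (x j)^2 \<le> 1" if "j \<in> {k+1..d}" for j
    proof -
      have "x j \<in> {-1..1}" using x that by auto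
      then show ?thesis by (simp add: abs_square_le_1 abs_le_iff)
    qed
    have w: "0 \<le> w" "w \<le> 1" unfolding w_def using xj by (auto intro!: prod_nonneg prod_le_1)
    have z: "0 \<le> z" "z \<le> 1" "z^2 = 1 - w" using w by (auto simp: z_def)
    have zn: "z^2 \<le> n"
      using Weierstrass_prod_ineq[of "{k+1..d}" "\<lambda>j. (x j)^2"] xj unfolding z(3) w_def n_def by auto
    have nz: "n \<le> real d * z^2"
    proof -
      have "n \<le> (\<Sum>j\<in>{k+1..d}. z^2)"
        unfolding n_def z(3) w_def by (intro sum_mono le_one_minus_prod) (use xj in auto)
      also have "\<dots> = real (d - k) * z^2" by simp
      also have "\<dots> \<le> real d * z^2" by (intro mult_right_mono) auto
      finally show ?thesis .
    qed
    have N: "0 \<le> N" "N \<le> real d * z"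
    proof -
      show "0 \<le> N" by (simp add: N_def)
      have "N^2 = n" by (simp add: N_def L2_set_def n_def sum_nonneg)
      also have "\<dots> \<le> real d * z^2" by (rule nz)
      also have "\<dots> \<le> (real d)^2 * z^2" using assms by (intro mult_right_mono) (auto simp: power2_eq_square)
      finally show "N \<le> real d * z"
        using z by (intro power2_le_imp_le[of N "real d * z"]) (auto simp: power_mult_distrib)
    qed
    define h where "h = C.h i z s K"
    have h: "h (l, m) = l powr s / (sqrt (l + \<bar>l^2 - m^2 - l^2 * z^2\<bar>) * (1 + l^2 * z^2 / (real i)\<^sup>2) ^ K)" for l m
      unfolding h_def C.h_def[OF i z(1,2) s K] C.g_def[OF i z(1,2) s K] by simp
    have tm: "real (sph_dim k m) * X_scr d k l m x * (sqrt (eigval2 d k l m) / l) powr (2 * \<alpha>)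
       \<le> Ct * real i ^ (D - 1) * real i powr (2 * \<alpha>) * h (l, m)" if lm: "(l, m) \<in> cluster_set \<epsilon> d k i" for l m
    proof -
      note c1 = C.cl_index[OF i lm] and c2 = C.cl_basic[OF i lm] and c3 = C.cl_size[OF i lm]
      have l0: "0 < l" using c2 by simp
      define lam where "lam = l^2 - m^2"
      have lam: "real i ^ 2 \<le> lam" "lam \<le> C.C0 * real i ^ 2" "0 < lam"
        using c3(1,2) power_strict_mono[OF c2(3), of 2] c2(1) by (auto simp: lam_def)
      define E where "E = 1 + l^2 * z^2 / real i ^ 2"
      define F where "F = 1 + l^2 * n / lam"
      define R where "R = sqrt (l + \<bar>l^2 - m^2 - l^2 * z^2\<bar>)"
      have E1: "1 \<le> E" by (simp add: E_def)
      have n0: "0 \<le> n" by (simp add: n_def sum_nonneg)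
      have F1: "1 \<le> F" using lam n0 by (simp add: F_def)
      have R0: "0 < R" using l0 by (simp add: R_def)
      have dim: "real (sph_dim k m) \<le> 2 * (2 ^ (k - 1) * l ^ (k - 1))"
      proof -
        have "real (sph_dim k m) \<le> 2 * (m + 1) ^ (k - 1)" using sph_dim_le c1(2) assms by blast
        also have "\<dots> \<le> 2 * (2 * l) ^ (k - 1)" using c2 by (intro mult_left_mono power_mono) auto
        finally show ?thesis by (simp add: power_mult_distrib)
      qed
      \<comment> \<open>Replaces \<open>n\<close> by \<open>z^2\<close> and \<open>lam\<close> by
        \<open>i^2\<close> in the decay factor, which is the form that the cluster sum
        expects.\<close>
      have FE: "1 / F ^ K \<le> C.C0 ^ K / E ^ K"
      proof -
        have "l^2 * z^2 / (C.C0 * real i ^ 2) \<le> l^2 * n / lam"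
          using zn lam C0 n0 by (intro frac_le mult_left_mono) auto
        then have "l^2 * z^2 / real i ^ 2 \<le> C.C0 * (l^2 * n / lam)"
          using C0 mult_left_mono[of "l^2 * z^2 / (C.C0 * real i ^ 2)" "l^2 * n / lam" C.C0] by simp
        then have "E \<le> C.C0 * F" using C0 by (simp add: E_def F_def distrib_left)
        then have "E ^ K \<le> (C.C0 * F) ^ K" using E1 by (intro power_mono) auto
        moreover have "0 < E ^ K" "0 < F ^ K" using E1 F1 by auto
        ultimately show ?thesis by (simp add: power_mult_distrib divide_simps mult.commute)
      qed
      have sl: "sqrt lam \<le> C.C0 * real i"
      proof -
        have "lam \<le> C.C0 * real i ^ 2" by (rule lam)
        also have "\<dots> \<le> C.C0^2 * real i ^ 2" using C0 by (intro mult_right_mono) (auto simp: power2_eq_square)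
        finally have "lam \<le> (C.C0 * real i)^2" by (simp add: power_mult_distrib)
        then show ?thesis using C0 i0 by (intro real_le_lsqrt) auto
      qed
      have X: "X_scr d k l m x \<le> C1 * (l * (C.C0 * real i) ^ (D - 1) * (1 / R) * (C.C0 ^ K / E ^ K))"
      proof -
        have g: "w * l^2 - m^2 = l^2 - m^2 - l^2 * z^2" unfolding z(3) by (simp add: algebra_simps)
        have "X_scr_bound K d k l m x = l * sqrt lam ^ (D - 1) * (1 / R) * (1 / F ^ K)"
          unfolding X_scr_bound_def w_def[symmetric] n_def[symmetric] g by (simp add: lam_def F_def R_def D_def)
        also have "\<dots> \<le> l * (C.C0 * real i) ^ (D - 1) * (1 / R) * (C.C0 ^ K / E ^ K)"
          using sl FE l0 lam R0 F1 C0 i0 by (intro mult_mono mult_nonneg_nonneg power_mono) auto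
        finally have "C1 * X_scr_bound K d k l m x \<le> C1 * (l * (C.C0 * real i) ^ (D - 1) * (1 / R) * (C.C0 ^ K / E ^ K))"
          using C1(1) by (intro mult_left_mono) auto
        then show ?thesis using C1(2)[OF c1(1,2) x c1(3,4)] by linarith
      qed
      have P: "(sqrt (eigval2 d k l m) / l) powr (2 * \<alpha>) \<le> 2 powr (2 * \<alpha>) * real i powr (2 * \<alpha>) * l powr (- (2 * \<alpha>))"
      proof -
        have "real i ^ 2 \<le> eigval2 d k l m" "eigval2 d k l m \<le> (real i + 1)^2" using lm by (auto simp: cluster_set_def)
        moreover have "0 \<le> real i ^ 2" by simp
        moreover have "(real i + 1)^2 \<le> (2 * real i)^2" using i0 by (intro power_mono) auto
        ultimately have ev: "0 \<le> eigval2 d k l m" "eigval2 d k l m \<le> (2 * real i)^2" by linarith+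
        then have "sqrt (eigval2 d k l m) \<le> 2 * real i" by (intro real_le_lsqrt) auto
        then have "sqrt (eigval2 d k l m) / l \<le> 2 * real i / l" using l0 by (intro divide_right_mono) auto
        then have "(sqrt (eigval2 d k l m) / l) powr (2 * \<alpha>) \<le> (2 * real i / l) powr (2 * \<alpha>)"
          using assms ev l0 by (intro powr_mono2) auto
        also have "\<dots> = (2 * real i) powr (2 * \<alpha>) / l powr (2 * \<alpha>)" using l0 by (simp add: powr_divide)
        also have "(2 * real i) powr (2 * \<alpha>) = 2 powr (2 * \<alpha>) * real i powr (2 * \<alpha>)" by (simp add: powr_mult)
        finally show ?thesis by (simp add: powr_minus_divide)
      qed
      \<comment> \<open>The powers of \<open>l\<close> come from the dimension, from the front
        factor of \<open>X_scr_bound\<close>, and from the bracket raised to 2 \<alpha>.\<close>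
      have lpow: "l ^ (k - 1) * l * l powr (- (2 * \<alpha>)) = l powr s"
      proof -
        have "l ^ (k - 1) * l = l ^ k" using assms by (simp add: power_eq_if[of l k] mult.commute)
        also have "\<dots> = l powr (real k)" using l0 by (simp add: powr_realpow)
        finally show ?thesis by (simp only: powr_add[symmetric] s_def) simp
      qed
      have "real (sph_dim k m) * X_scr d k l m x * (sqrt (eigval2 d k l m) / l) powr (2 * \<alpha>)
        \<le> (2 * (2 ^ (k - 1) * l ^ (k - 1))) * (C1 * (l * (C.C0 * real i) ^ (D - 1) * (1 / R) * (C.C0 ^ K / E ^ K)))
            * (2 powr (2 * \<alpha>) * real i powr (2 * \<alpha>) * l powr (- (2 * \<alpha>)))"
        using dim X P X_scr_nonneg l0 C1(1) C0 R0 E1 by (intro mult_mono mult_nonneg_nonneg) auto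
      also have "\<dots> = Ct * real i ^ (D - 1) * real i powr (2 * \<alpha>) * ((l ^ (k - 1) * l * l powr (- (2 * \<alpha>))) / (R * E ^ K))"
        by (simp add: Ct_def power_mult_distrib mult_ac)
      also have "(l ^ (k - 1) * l * l powr (- (2 * \<alpha>))) / (R * E ^ K) = h (l, m)"
        unfolding lpow h R_def E_def ..
      finally show ?thesis .
    qed
    define M where "M = min_inv i N"
    have M0: "0 \<le> M" using N by (simp add: M_def min_inv_def)
    \<comment> \<open>The quotient \<open>i / (1 + i * z)\<close> is below both \<open>i\<close> and
      \<open>1 / z\<close>, and \<open>N \<le> real d * z\<close> turns the latter into a multiple
      of \<open>1 / N\<close>.\<close>
    have frac: "real i ^ 2 / (1 + real i * z) \<le> real d * (real i * M)"
    proof -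
      have d1: "1 \<le> real d" using assms by simp
      have iz: "0 \<le> real i * z" using z by simp
      have a: "real i / (1 + real i * z) \<le> real d * real i"
      proof -
        have "real i / (1 + real i * z) \<le> real i / 1" using iz by (intro divide_left_mono) auto
        also have "\<dots> \<le> real d * real i" using mult_right_mono[OF d1, of "real i"] by simp
        finally show ?thesis .
      qed
      have "real i / (1 + real i * z) \<le> real d * M"
      proof (cases "N = 0")
        case True
        then show ?thesis using a by (simp add: M_def min_inv_def)
      next
        case False
        then have N0: "0 < N" using N by simp
        then have z0: "0 < z" using N(2) z(1) by (cases "z = 0") auto
        have "real i / (1 + real i * z) \<le> real i / (real i * z)"
          using z0 i0 by (intro divide_left_mono) (auto intro!: mult_pos_pos add_pos_nonneg)
        also have "\<dots> = 1 / z" using i0 by simp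
        also have "\<dots> \<le> real d * (1 / N)" using N(2) N0 z0 by (simp add: divide_simps mult.commute)
        finally show ?thesis using a N0 by (simp add: M_def min_inv_def min_def)
      qed
      then have "real i * (real i / (1 + real i * z)) \<le> real i * (real d * M)" by (intro mult_left_mono) auto
      then show ?thesis by (simp add: power2_eq_square mult_ac)
    qed
    have Cs_h: "(\<Sum>p\<in>cluster_set \<epsilon> d k i. h p) \<le> Cs * (real i ^ 2 / (1 + real i * z)) powr s"
      unfolding h_def Cs_def by (rule C.sum_h[OF i z(1,2) s K])
    have "(\<Sum>(l, m)\<in>cluster_set \<epsilon> d k i.
        real (sph_dim k m) * X_scr d k l m x * (sqrt (eigval2 d k l m) / l) powr (2 * \<alpha>))
      \<le> (\<Sum>p\<in>cluster_set \<epsilon> d k i. Ct * real i ^ (D - 1) * real i powr (2 * \<alpha>) * h p)"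
      by (rule sum_mono) (use tm in auto)
    also have "\<dots> = Ct * real i ^ (D - 1) * real i powr (2 * \<alpha>) * (\<Sum>p\<in>cluster_set \<epsilon> d k i. h p)"
      by (rule sum_distrib_left[symmetric])
    also have "\<dots> \<le> Ct * real i ^ (D - 1) * real i powr (2 * \<alpha>) * (Cs * (real i ^ 2 / (1 + real i * z)) powr s)"
      using Cs_h Ct0 by (intro mult_left_mono) auto
    also have "\<dots> = Ct * Cs * (real i ^ (D - 1) * real i powr (2 * \<alpha>) * (real i ^ 2 / (1 + real i * z)) powr s)"
      by (simp add: mult_ac)
    also have "\<dots> \<le> \<bar>Ct * Cs\<bar> * (real i ^ (D - 1) * real i powr (2 * \<alpha>) * (real d * (real i * M)) powr s)"
    proof (rule mult_mono)
      show "real i ^ (D - 1) * real i powr (2 * \<alpha>) * (real i ^ 2 / (1 + real i * z)) powr s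
        \<le> real i ^ (D - 1) * real i powr (2 * \<alpha>) * (real d * (real i * M)) powr s"
        using frac s z i0 by (intro mult_left_mono powr_mono2) auto
    qed auto
    also have "(real d * (real i * M)) powr s = real d powr s * (real i powr s * M powr s)"
      using M0 by (simp add: powr_mult)
    also have "\<bar>Ct * Cs\<bar> * (real i ^ (D - 1) * real i powr (2 * \<alpha>) * (real d powr s * (real i powr s * M powr s)))
       = \<bar>Ct * Cs * real d powr s\<bar> * (real i ^ (D - 1) * (real i powr (2 * \<alpha>) * real i powr s)) * M powr s"
      by (simp add: abs_mult mult_ac)
    also have "real i powr (2 * \<alpha>) * real i powr s = real i ^ k"
    proof -
      have "real i powr (2 * \<alpha>) * real i powr s = real i powr (real k)" by (simp only: powr_add[symmetric] s_def) simp
      then show ?thesis using i0 by (simp add: powr_realpow)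
    qed
    also have "real i ^ (D - 1) * real i ^ k = real i ^ (d - 1)"
      using assms by (simp add: D_def power_add[symmetric])
    also have "\<bar>Ct * Cs * real d powr s\<bar> * real i ^ (d - 1) * M powr s \<le> (\<bar>Ct * Cs * real d powr s\<bar> + 1) * real i ^ (d - 1) * M powr s"
      by (intro mult_right_mono) auto
    finally show ?thesis by (simp only: M_def N_def)
  qed
  show ?thesis
  proof (intro exI[of _ "\<bar>Ct * Cs * real d powr s\<bar> + 1"] conjI allI impI)
    show "0 < \<bar>Ct * Cs * real d powr s\<bar> + 1" by simp
    fix i :: nat and x :: "nat \<Rightarrow> real"
    assume "i \<noteq> 0" "x \<in> {k+1..d} \<rightarrow> {-1..1}"
    then show "(\<Sum>(l, m)\<in>cluster_set \<epsilon> d k i.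
        real (sph_dim k m) * X_scr d k l m x * (sqrt (eigval2 d k l m) / l) powr (2 * \<alpha>))
      \<le> (\<bar>Ct * Cs * real d powr s\<bar> + 1) * real i ^ (d - 1) * min_inv i (L2_set x {k+1..d}) powr (real k - 2 * \<alpha>)"
      using main[of i x] by (simp add: s_def)
  qed
qed

end
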